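(* Let $D>0$ with $D^2>1/4$ and put $\lambda_0=\dfrac{4D^2}{4D^2-1}$. Then there exists $\delta>0$ such that for every $\lambda\in(\lambda_0,\lambda_0+\delta)$ the upper-sheet system $$u_1'=u_2,\qquad v_1'=u_1+\lambda-\sqrt{\lambda^2+2u_1},\qquad D u_2'=v_2,\qquad D v_2'=-u_2-v_1,$$ considered on the half-space $\{u_1>-\lambda^2/2\}\subset\mathbb{R}^4$, has two distinct symmetric homoclinic orbits to the equilibrium $O=(0,0,0,0)$ (which is a saddle-focus for $\lambda>\lambda_0$).
   Context: The system arises from the fourth-order equation $D^2S^{(IV)}+S''+S=V$, $S=\lambda V+\tfrac12V^2$, for traveling waves of a nonlocal Whitham equation, via $u_1=S$, $u_2=S'$, $v_1=-S'-D^2S'''$, $v_2=DS''$, choosing the root $V=-\lambda+\sqrt{\lambda^2+2u_1}$ (the "upper sheet"). Phase-space points are written $(u_1,v_1,u_2,v_2)$, and $'$ denotes the derivative with respect to the independent variable $y$. The system is Hamiltonian with respect to the symplectic form $dv_1\wedge du_1+D\,dv_2\wedge du_2$ (up to sign convention), with Hamiltonian $H=u_2v_1-\frac{u_1^2}{2}-\lambda u_1+\frac{u_2^2+v_2^2}{2}+\frac13(\lambda^2+2u_1)^{3/2}$. It is reversible with respect to the involution $L(u_1,v_1,u_2,v_2)=(u_1,-v_1,-u_2,v_2)$: if $X(y)$ is a solution, so is $L(X(-y))$. A homoclinic orbit to $O$ is the orbit of a non-constant solution defined for all $y\in\mathbb{R}$ that tends to $O$ as $y\to+\infty$ and as $y\to-\infty$.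 It is symmetric if, as a set, it is invariant under $L$. A saddle-focus is an equilibrium whose linearization has a quadruple of eigenvalues $\pm a\pm ib$ with $a,b\neq0$. *)

theory Defs
  imports "HOL-Analysis.Analysis"
begin

lemma vector_4 [simp]:
  "(vector [x, y, z, w] :: 'a::zero^4) $ 1 = x"
  "(vector [x, y, z, w] :: 'a::zero^4) $ 2 = y"
  "(vector [x, y, z, w] :: 'a::zero^4) $ 3 = z"
  "(vector [x, y, z, w] :: 'a::zero^4) $ 4 = w"
  by (simp_all add: vector_def)

text \<open>Autonomous equations \<open>X' = F(X)\<close> on a phase space \<open>U\<close>.\<close>

definition solution_on_line ::
    "('a::real_normed_vector \<Rightarrow> 'a) \<Rightarrow> 'a set \<Rightarrow> (real \<Rightarrow> 'a) \<Rightarrow> bool" where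
  "solution_on_line F U X \<longleftrightarrow>
     (\<forall>y. X y \<in> U \<and> (X has_vector_derivative F (X y)) (at y))"

definition homoclinic_orbit ::
    "('a::real_normed_vector \<Rightarrow> 'a) \<Rightarrow> 'a set \<Rightarrow> 'a \<Rightarrow> 'a set \<Rightarrow> bool" where
  "homoclinic_orbit F U p \<Gamma> \<longleftrightarrow>
     (\<exists>X. solution_on_line F U X \<and> \<not> X constant_on UNIV \<and>
          (X \<longlongrightarrow> p) at_top \<and> (X \<longlongrightarrow> p) at_bot \<and> \<Gamma> = range X)"

definition symmetric_homoclinic_orbit ::
    "('a::real_normed_vector \<Rightarrow> 'a) \<Rightarrow> 'a set \<Rightarrow> ('a \<Rightarrow> 'a) \<Rightarrow> 'a \<Rightarrow> 'a set \<Rightarrow> bool" where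
  "symmetric_homoclinic_orbit F U R p \<Gamma> \<longleftrightarrow> homoclinic_orbit F U p \<Gamma> \<and> R ` \<Gamma> = \<Gamma>"

definition complex_eigenvalue :: "real^'n^'n \<Rightarrow> complex \<Rightarrow> bool" where
  "complex_eigenvalue A \<mu> \<longleftrightarrow>
     (\<exists>w :: complex^'n. w \<noteq> 0 \<and> (\<chi> i j. complex_of_real (A $ i $ j)) *v w = \<mu> *s w)"

definition saddle_focus :: "(real^4 \<Rightarrow> real^4) \<Rightarrow> real^4 \<Rightarrow> bool" where
  "saddle_focus F p \<longleftrightarrow>
     F p = 0 \<and> F differentiable (at p) \<and>
     (\<exists>a b. a \<noteq> 0 \<and> b \<noteq> 0 \<and>
        {\<mu>. complex_eigenvalue (jacobian F (at p)) \<mu>} =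
        {Complex a b, Complex a (- b), Complex (- a) b, Complex (- a) (- b)})"

text \<open>Coordinates 1, 2, 3, 4 of a phase point are \<open>u\<^sub>1, v\<^sub>1, u\<^sub>2, v\<^sub>2\<close>, in this order;
  the last two equations are divided by \<open>D\<close>.\<close>

definition upper_sheet_field :: "real \<Rightarrow> real \<Rightarrow> real^4 \<Rightarrow> real^4" where
  "upper_sheet_field D lam X =
     vector [X $ 3,
             X $ 1 + lam - sqrt (lam^2 + 2 * X $ 1),
             X $ 4 / D,
             (- X $ 3 - X $ 2) / D]"

definition upper_sheet_space :: "real \<Rightarrow> (real^4) set" where
  "upper_sheet_space lam = {X. X $ 1 > - (lam^2) / 2}"

definition reversor :: "real^4 \<Rightarrow> real^4" where
  "reversor X = vector [X $ 1, - X $ 2, - X $ 3, X $ 4]"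

end

theory Submission
  imports Defs
begin

text \<open>Put \<open>u\<^sub>1 = \<lambda>\<^sup>2 s\<close> and rescale \<open>y\<close>, so that \<open>s'''' + 2 s'' + (1 + 4 \<mu>\<^sup>2) s + N(s) = 0\<close>, where
  \<open>4 \<mu>\<^sup>2 = 4 D\<^sup>2 (1 - 1/\<lambda>) - 1\<close> is small and positive for \<open>\<lambda>\<close> just above \<open>\<lambda>\<^sub>0\<close>. In complex amplitude
  variables \<open>(A, C)\<close>, which are of order one on the slow time scale \<open>t = \<mu> x\<close>, the quadratic terms of
  size \<open>1/\<mu>\<close> and then the remaining oscillating terms are removed by two explicit averaging steps. The
  averaged system is \<open>A' = C, C' = A - 2 |A|\<^sup>2 A\<close>, the cubic coefficient being negative (focusing) for all
  \<open>D\<close>, with the homoclinics \<open>A = \<plusminus> sech t\<close>. Each of them is nondegenerate among solutions on the half-line that decay and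
  start on the fixed space of the reversor, so a contraction argument in a space of exponentially weighted functions
  on \<open>[0, \<infinity>)\<close> continues it to small \<open>\<mu> > 0\<close>. Reflecting by the reversor gives the full orbits; they differ
  because an orbit symmetric about two different points would be periodic.\<close>

section \<open>The saddle-focus\<close>

text \<open>The averaged system commutes with all rotations of \<open>(A, C)\<close>, hence has a
  circle of homoclinics; the reversor, acting as \<open>(cnj A, - cnj C)\<close>, singles out the
  two real ones. Nondegeneracy is a matter of parity: the decaying solutions of the linearized
  equation are the translation mode in the real part, with nonzero derivative at \<open>0\<close>,
  and the phase mode in the imaginary part, with nonzero value at \<open>0\<close>. Neither
  satisfies \<open>Im A = 0\<close>, \<open>Re C = 0\<close> there. The obstacle is the phase
  \<open>t / \<mu>\<close>, which has no limit as \<open>\<mu>\<close> tends to \<open>0\<close>;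
  smallness comes only from the factor \<open>\<mu>\<close> before bounded oscillating terms. The
  second averaging relation \<open>Z = W + \<mu> S(t, Z)\<close> is never solved for
  \<open>Z\<close>: the contraction acts on \<open>Z\<close> itself, in an integral equation without
  derivatives of the unknown, and the differential equation is recovered afterwards. The quadratic
  Taylor term contributes \<open>19/18 b^2\<close> to the cubic coefficient and the cubic one
  \<open>3/8 c\<close>. With \<open>\<beta> = 4 D^2 - 1\<close>, \<open>b = \<beta> k / 4\<close>,
  \<open>c = \<beta> k^2 / 4\<close> both are positive; \<open>k\<close> is chosen to make the sum
  \<open>2\<close>.\<close>

lemma vector_4_eq_sum:
  "(vector [a, b, c, d] :: real^4) =
     a *\<^sub>R axis 1 1 + b *\<^sub>R axis 2 1 + c *\<^sub>R axis 3 1 + d *\<^sub>R axis 4 1"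
  by (simp add: vec_eq_iff forall_4 axis_def)

lemma has_derivative_vector_4:
  fixes f g h k :: "'a::real_normed_vector \<Rightarrow> real"
  assumes "(f has_derivative f') F" "(g has_derivative g') F"
    "(h has_derivative h') F" "(k has_derivative k') F"
  shows "((\<lambda>x. vector [f x, g x, h x, k x] :: real^4) has_derivative
          (\<lambda>t. vector [f' t, g' t, h' t, k' t])) F"
  unfolding vector_4_eq_sum using assms by (auto intro!: derivative_eq_intros)

lemma upper_sheet_field_has_derivative_0:
  assumes "lam > 0"
  shows "(upper_sheet_field D lam has_derivative
     (\<lambda>h. vector [h $ 3, (1 - 1 / lam) * h $ 1, h $ 4 / D, (- h $ 3 - h $ 2) / D])) (at 0)"
proof -
  have nth: "((\<lambda>X::real^4. X $ i) has_derivative (\<lambda>h. h $ i)) (at x)" for i x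
    by (rule bounded_linear_imp_has_derivative[OF bounded_linear_vec_nth])
  have sq: "((\<lambda>X::real^4. sqrt (lam^2 + 2 * X $ 1)) has_derivative (\<lambda>h. h $ 1 / lam)) (at 0)"
    using assms by (auto intro!: derivative_eq_intros nth simp: field_simps)
  have "((\<lambda>X::real^4. X $ 1 + lam - sqrt (lam^2 + 2 * X $ 1)) has_derivative
      (\<lambda>h. (1 - 1 / lam) * h $ 1)) (at 0)"
    by (rule has_derivative_eq_rhs[OF has_derivative_diff[OF has_derivative_add_const[OF nth] sq]])
       (simp add: algebra_simps)
  moreover have "((\<lambda>X::real^4. X $ 4 / D) has_derivative (\<lambda>h. h $ 4 / D)) (at 0)"
    "((\<lambda>X::real^4. (- X $ 3 - X $ 2) / D) has_derivative (\<lambda>h. (- h $ 3 - h $ 2) / D)) (at 0)"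
    unfolding divide_inverse by (auto intro!: derivative_eq_intros nth)
  ultimately show ?thesis
    unfolding upper_sheet_field_def by (intro has_derivative_vector_4 nth)
qed

text \<open>Eliminating three components of an eigenvector leaves the characteristic polynomial of
  the scalar equation \<open>D^2 S'''' + S'' + (1 - 1/lam) S = 0\<close>. Working with eigenvectors
  avoids a determinant.\<close>

lemma complex_eigenvalue_upper_sheet_iff:
  assumes "D > 0" "lam > 0"
  shows "complex_eigenvalue (jacobian (upper_sheet_field D lam) (at 0)) z \<longleftrightarrow>
     of_real (D^2) * z^4 + z^2 + of_real (1 - 1 / lam) = 0"
    (is "complex_eigenvalue ?J z \<longleftrightarrow> ?poly = 0")
proof -
  define k where "k = 1 - 1 / lam"
  have J: "?J = matrix (\<lambda>h. vector [h $ 3, k * h $ 1, h $ 4 / D, (- h $ 3 - h $ 2) / D])"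
    unfolding jacobian_def k_def
    using frechet_derivative_at[OF upper_sheet_field_has_derivative_0[OF assms(2)]] by simp
  have mv: "((\<chi> i j. complex_of_real (?J $ i $ j)) *v w) =
     vector [w $ 3, of_real k * w $ 1, w $ 4 / of_real D, (- w $ 3 - w $ 2) / of_real D]"
    for w :: "complex^4"
    by (simp add: J vec_eq_iff forall_4 matrix_vector_mult_def sum_4 matrix_def axis_def
        diff_divide_distrib add_divide_distrib)
  have eig: "complex_eigenvalue ?J z \<longleftrightarrow> (\<exists>w :: complex^4. w \<noteq> 0 \<and>
     w $ 3 = z * w $ 1 \<and> of_real k * w $ 1 = z * w $ 2 \<and> w $ 4 / of_real D = z * w $ 3 \<and>
     (- w $ 3 - w $ 2) / of_real D = z * w $ 4)"
    unfolding complex_eigenvalue_def mv by (simp add: vec_eq_iff forall_4)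
  have D: "complex_of_real D \<noteq> 0" using assms by simp
  show ?thesis
  proof
    assume "complex_eigenvalue ?J z"
    then obtain w :: "complex^4" where w: "w \<noteq> 0" "w $ 3 = z * w $ 1"
      "of_real k * w $ 1 = z * w $ 2" "w $ 4 / of_real D = z * w $ 3"
      "(- w $ 3 - w $ 2) / of_real D = z * w $ 4"
      using eig by auto
    have w4: "w $ 4 = of_real D * z^2 * w $ 1"
      using w(2,4) D by (simp add: field_simps power2_eq_square)
    have w2: "w $ 2 = - (of_real (D^2) * z^3 + z) * w $ 1"
    proof -
      have "- w $ 3 - w $ 2 = z * w $ 4 * of_real D"
        using w(5) D by (simp add: field_simps)
      then have "w $ 2 = - w $ 3 - z * w $ 4 * of_real D"
        by (metis add.commute diff_add_cancel diff_diff_eq2 minus_diff_eq)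
      then show ?thesis by (simp add: w(2) w4 algebra_simps power2_eq_square power3_eq_cube)
    qed
    have "w $ 1 \<noteq> 0"
      using w(1,2) w2 w4 by (auto simp: vec_eq_iff forall_4)
    moreover have "(of_real (D^2) * z^4 + z^2 + of_real k) * w $ 1 = 0"
    proof -
      have "of_real k * w $ 1 + z * ((of_real (D^2) * z^3 + z) * w $ 1) = 0"
        using w(3) unfolding w2 by algebra
      then show ?thesis
        by (simp add: algebra_simps power2_eq_square power3_eq_cube power4_eq_xxxx)
    qed
    ultimately show "?poly = 0" unfolding k_def by simp
  next
    assume *: "?poly = 0"
    \<comment> \<open>The phase point of \<open>S = exp (z y)\<close> at \<open>y = 0\<close>:
      \<open>u1 = 1\<close>, \<open>u2 = z\<close>, \<open>v2 = D z^2\<close>,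
      \<open>v1 = - z - D^2 z^3\<close>.\<close>
    define w :: "complex^4" where
      "w = vector [1, - (of_real (D^2) * z^3 + z), z, of_real D * z^2]"
    have "of_real k = z * w $ 2"
      using * unfolding w_def k_def
      by (simp add: algebra_simps power2_eq_square power3_eq_cube power4_eq_xxxx add_eq_0_iff)
    moreover have "w \<noteq> 0" by (auto simp: w_def vec_eq_iff forall_4)
    ultimately show "complex_eigenvalue ?J z" unfolding eig
      using D by (intro exI[of _ w]) (auto simp: w_def field_simps power2_eq_square power3_eq_cube)
  qed
qed

text \<open>The four numbers are the zeros of
  \<open>z^4 + 2 (b^2 - a^2) z^2 + (a^2 + b^2)^2\<close>; the hypotheses compare its coefficients
  with those of the given quartic.\<close>

lemma quartic_roots:
  fixes z :: complex
  assumes "D > 0" "D^2 * (a^2 + b^2)^2 = k" "2 * D^2 * (b^2 - a^2) = 1"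
  shows "of_real (D^2) * z^4 + z^2 + of_real k = 0 \<longleftrightarrow>
     z \<in> {Complex a b, Complex a (- b), Complex (- a) b, Complex (- a) (- b)}"
proof -
  have "of_real (D^2) * z^4 + of_real (2 * D^2 * (b^2 - a^2)) * z^2 + of_real (D^2 * (a^2 + b^2)^2) =
    of_real (D^2) * ((z - Complex a b) * (z - Complex a (- b)) * (z - Complex (- a) b) * (z - Complex (- a) (- b)))"
  proof -
    have c: "Complex x y = of_real x + \<i> * of_real y" for x y by (simp add: complex_eq_iff)
    have i2: "\<i> * \<i> = -1" by simp
    have p: "((z - u - v) * (z - u + v)) * ((z + u - v) * (z + u + v)) =
       z^4 - 2 * (u^2 + v^2) * z^2 + (u^2 - v^2)^2" for u v :: complex by algebra
    have v2: "(\<i> * complex_of_real b)^2 = - of_real (b^2)" by (simp add: power_mult_distrib)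
    have eq: "(z - Complex a b) * (z - Complex a (- b)) * (z - Complex (- a) b) * (z - Complex (- a) (- b)) =
       z^4 - 2 * ((of_real a)^2 + (\<i> * of_real b)^2) * z^2 + ((of_real a)^2 - (\<i> * of_real b)^2)^2"
      unfolding p[symmetric] c of_real_minus by algebra
    show ?thesis unfolding eq v2 by (simp add: algebra_simps power2_eq_square power4_eq_xxxx)
  qed
  then show ?thesis using assms by (auto simp: )
qed

lemma upper_sheet_saddle_focus:
  assumes "D > 0" and "D^2 > 1/4" and "lam > 4 * D^2 / (4 * D^2 - 1)"
  shows "saddle_focus (upper_sheet_field D lam) 0"
proof -
  have p: "4 * D^2 - 1 > 0" using assms by simp
  then have l1: "1 < 4 * D^2 / (4 * D^2 - 1)" by simp
  then have lam: "lam > 1" using assms by linarith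
  define k where "k = 1 - 1 / lam"
  have k: "4 * D^2 * k > 1"
    using assms(3) p lam unfolding k_def by (simp add: field_simps)
  have k0: "k > 0" using lam by (simp add: k_def)
  \<comment> \<open>\<open>n\<close> is to be \<open>a^2 + b^2\<close>, read off from the constant
    coefficient; with \<open>b^2 - a^2 = 1 / (2 D^2)\<close> it determines both. That
    \<open>a\<close> is real and nonzero amounts to \<open>4 D^2 k > 1\<close>, which is
    \<open>lam > lam0\<close>.\<close>
  define n where "n = sqrt k / D"
  have n: "n > 0" "D^2 * n^2 = k" using k0 assms(1) by (simp_all add: n_def power_divide)
  have nn: "2 * n * D^2 > 1"
  proof -
    have "(2 * n * D^2)^2 = 4 * D^2 * (D^2 * n^2)" by algebra
    then have "(2 * n * D^2)^2 > 1^2" using k n by simp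
    then show ?thesis using n assms(1) by (metis less_eq_real_def mult_nonneg_nonneg power2_less_imp_less zero_le_numeral zero_le_power2)
  qed
  define a where "a = sqrt (n / 2 - 1 / (4 * D^2))"
  define b where "b = sqrt (n / 2 + 1 / (4 * D^2))"
  have "n / 2 - 1 / (4 * D^2) > 0" using nn assms(1) by (simp add: field_simps)
  then have a: "a > 0" "a^2 = n / 2 - 1 / (4 * D^2)" by (simp_all add: a_def)
  have "n / 2 + 1 / (4 * D^2) > 0" using n assms(1) by (simp add: add_pos_pos)
  then have b: "b > 0" "b^2 = n / 2 + 1 / (4 * D^2)" by (simp_all add: b_def)
  have "{z. complex_eigenvalue (jacobian (upper_sheet_field D lam) (at 0)) z} =
        {Complex a b, Complex a (- b), Complex (- a) b, Complex (- a) (- b)}"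
    using quartic_roots[of D a b k] assms(1) n(2) lam
    by (auto simp: complex_eigenvalue_upper_sheet_iff a b k_def[symmetric])
  moreover have "upper_sheet_field D lam 0 = 0"
    using lam by (simp add: upper_sheet_field_def vec_eq_iff forall_4)
  moreover have "upper_sheet_field D lam differentiable (at 0)"
    using upper_sheet_field_has_derivative_0[of lam D] lam unfolding differentiable_def by auto
  ultimately show ?thesis
    unfolding saddle_focus_def using a(1) b(1) by (metis less_irrefl)
qed

section \<open>Uniform Lipschitz bounds and implicitly given curves\<close>

text \<open>One constant serves the whole parameter set, later a range of \<open>\<mu>\<close>. The
  class is closed under sums, products and bounded linear maps, so the constants of the averaging
  polynomials are obtained from their syntax and never computed.\<close>

definition ulip :: "'p set \<Rightarrow> real \<Rightarrow> ('p \<Rightarrow> 'a::real_normed_vector \<Rightarrow> 'b::real_normed_vector) \<Rightarrow> bool" where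
  "ulip P \<rho> f \<longleftrightarrow> (\<exists>B\<ge>0. \<forall>p\<in>P. \<forall>z w. norm z \<le> \<rho> \<longrightarrow> norm w \<le> \<rho> \<longrightarrow>
     norm (f p z) \<le> B \<and> norm (f p z - f p w) \<le> B * norm (z - w))"

lemma ulipI:
  assumes "\<And>p z. p \<in> P \<Longrightarrow> norm z \<le> \<rho> \<Longrightarrow> norm (f p z) \<le> B"
    and "\<And>p z w. p \<in> P \<Longrightarrow> norm z \<le> \<rho> \<Longrightarrow> norm w \<le> \<rho> \<Longrightarrow> norm (f p z - f p w) \<le> B' * norm (z - w)"
  shows "ulip P \<rho> f"
proof -
  have "norm (f p z - f p w) \<le> max (max B B') 0 * norm (z - w)"
    if "p \<in> P" "norm z \<le> \<rho>" "norm w \<le> \<rho>" for p z w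
    using assms(2)[OF that] by (rule order_trans) (intro mult_right_mono, auto)
  moreover have "norm (f p z) \<le> max (max B B') 0" if "p \<in> P" "norm z \<le> \<rho>" for p z
    using assms(1)[OF that] by auto
  ultimately show ?thesis unfolding ulip_def by (intro exI[of _ "max (max B B') 0"]) auto
qed

lemma ulipE:
  assumes "ulip P \<rho> f"
  obtains B where "B \<ge> 0" "\<And>p z. p \<in> P \<Longrightarrow> norm z \<le> \<rho> \<Longrightarrow> norm (f p z) \<le> B"
    "\<And>p z w. p \<in> P \<Longrightarrow> norm z \<le> \<rho> \<Longrightarrow> norm w \<le> \<rho> \<Longrightarrow> norm (f p z - f p w) \<le> B * norm (z - w)"
  using assms unfolding ulip_def by blast

lemma ulip_param:
  assumes "\<And>p. p \<in> P \<Longrightarrow> norm (h p) \<le> B"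
  shows "ulip P \<rho> (\<lambda>p z. h p)"
  by (rule ulipI[where B = B and B' = 0]) (use assms in auto)

lemma ulip_const: "ulip P \<rho> (\<lambda>p z. c)"
  by (rule ulip_param[where B = "norm c"]) simp

lemma ulip_add:
  assumes "ulip P \<rho> f" "ulip P \<rho> g"
  shows "ulip P \<rho> (\<lambda>p z. f p z + g p z)"
proof -
  obtain B where B: "\<And>p z. p \<in> P \<Longrightarrow> norm z \<le> \<rho> \<Longrightarrow> norm (f p z) \<le> B"
    "\<And>p z w. p \<in> P \<Longrightarrow> norm z \<le> \<rho> \<Longrightarrow> norm w \<le> \<rho> \<Longrightarrow> norm (f p z - f p w) \<le> B * norm (z - w)"
    using assms(1) by (elim ulipE) blast
  obtain C where C: "\<And>p z. p \<in> P \<Longrightarrow> norm z \<le> \<rho> \<Longrightarrow> norm (g p z) \<le> C"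
    "\<And>p z w. p \<in> P \<Longrightarrow> norm z \<le> \<rho> \<Longrightarrow> norm w \<le> \<rho> \<Longrightarrow> norm (g p z - g p w) \<le> C * norm (z - w)"
    using assms(2) by (elim ulipE) blast
  show ?thesis
  proof (rule ulipI)
    fix p z w assume *: "p \<in> P" "norm (z::'b) \<le> \<rho>" "norm (w::'b) \<le> \<rho>"
    have "norm (f p z + g p z - (f p w + g p w)) \<le> norm (f p z - f p w) + norm (g p z - g p w)"
      by (metis add_diff_add norm_triangle_ineq)
    also have "\<dots> \<le> (B + C) * norm (z - w)" using B(2)[OF *] C(2)[OF *] by (simp add: algebra_simps)
    finally show "norm (f p z + g p z - (f p w + g p w)) \<le> (B + C) * norm (z - w)" .
  next
    fix p z assume *: "p \<in> P" "norm (z::'b) \<le> \<rho>"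
    show "norm (f p z + g p z) \<le> B + C" using B(1)[OF *] C(1)[OF *] by (meson norm_add_rule_thm)
  qed
qed

lemma ulip_bounded_linear:
  assumes "ulip P \<rho> f" "bounded_linear L"
  shows "ulip P \<rho> (\<lambda>p z. L (f p z))"
proof -
  interpret bounded_linear L by fact
  obtain B where B: "\<And>p z. p \<in> P \<Longrightarrow> norm z \<le> \<rho> \<Longrightarrow> norm (f p z) \<le> B"
    "\<And>p z w. p \<in> P \<Longrightarrow> norm z \<le> \<rho> \<Longrightarrow> norm w \<le> \<rho> \<Longrightarrow> norm (f p z - f p w) \<le> B * norm (z - w)"
    using assms(1) by (elim ulipE) blast
  obtain K where K: "K \<ge> 0" "\<And>x. norm (L x) \<le> norm x * K" using nonneg_bounded by auto
  show ?thesis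
  proof (rule ulipI)
    fix p z w assume *: "p \<in> P" "norm (z::'b) \<le> \<rho>" "norm (w::'b) \<le> \<rho>"
    have "norm (L (f p z) - L (f p w)) \<le> norm (f p z - f p w) * K" using K(2) by (metis diff)
    also have "\<dots> \<le> B * norm (z - w) * K" using B(2)[OF *] K(1) by (rule mult_right_mono)
    finally show "norm (L (f p z) - L (f p w)) \<le> (B * K) * norm (z - w)" by (simp add: mult_ac)
  next
    fix p z assume *: "p \<in> P" "norm (z::'b) \<le> \<rho>"
    show "norm (L (f p z)) \<le> B * K"
      using K(2)[of "f p z"] mult_right_mono[OF B(1)[OF *] K(1)] by linarith
  qed
qed

lemma ulip_mult:
  fixes f g :: "'p \<Rightarrow> 'a::real_normed_vector \<Rightarrow> 'b::real_normed_algebra"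
  assumes "ulip P \<rho> f" "ulip P \<rho> g"
  shows "ulip P \<rho> (\<lambda>p z. f p z * g p z)"
proof -
  obtain B where B: "B \<ge> 0" "\<And>p z. p \<in> P \<Longrightarrow> norm z \<le> \<rho> \<Longrightarrow> norm (f p z) \<le> B"
    "\<And>p z w. p \<in> P \<Longrightarrow> norm z \<le> \<rho> \<Longrightarrow> norm w \<le> \<rho> \<Longrightarrow> norm (f p z - f p w) \<le> B * norm (z - w)"
    using assms(1) by (elim ulipE) blast
  obtain C where C: "C \<ge> 0" "\<And>p z. p \<in> P \<Longrightarrow> norm z \<le> \<rho> \<Longrightarrow> norm (g p z) \<le> C"
    "\<And>p z w. p \<in> P \<Longrightarrow> norm z \<le> \<rho> \<Longrightarrow> norm w \<le> \<rho> \<Longrightarrow> norm (g p z - g p w) \<le> C * norm (z - w)"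
    using assms(2) by (elim ulipE) blast
  show ?thesis
  proof (rule ulipI)
    fix p z w assume *: "p \<in> P" "norm (z::'a) \<le> \<rho>" "norm (w::'a) \<le> \<rho>"
    have "f p z * g p z - f p w * g p w = f p z * (g p z - g p w) + (f p z - f p w) * g p w"
      by (simp add: algebra_simps)
    then have "norm (f p z * g p z - f p w * g p w)
      \<le> norm (f p z) * norm (g p z - g p w) + norm (f p z - f p w) * norm (g p w)"
      by (metis norm_triangle_mono norm_mult_ineq)
    also have "\<dots> \<le> B * (C * norm (z - w)) + (B * norm (z - w)) * C"
      using B(2)[OF *(1,2)] C(3)[OF *] B(3)[OF *] C(2)[OF *(1,3)] B(1) C(1)
      by (intro add_mono mult_mono) auto
    finally show "norm (f p z * g p z - f p w * g p w) \<le> (2 * B * C) * norm (z - w)"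
      by (simp add: algebra_simps)
  next
    fix p z assume *: "p \<in> P" "norm (z::'a) \<le> \<rho>"
    show "norm (f p z * g p z) \<le> B * C"
      using B(1) B(2)[OF *] C(2)[OF *] by (metis mult_mono' norm_ge_zero norm_mult_ineq order_trans)
  qed
qed

lemma ulip_ident: "ulip P \<rho> (\<lambda>p z. z)"
  by (rule ulipI[where B = \<rho> and B' = 1]) auto

lemma ulip_Pair:
  assumes "ulip P \<rho> f" "ulip P \<rho> g"
  shows "ulip P \<rho> (\<lambda>p z. (f p z, g p z))"
proof -
  have "bounded_linear (\<lambda>x. (x, 0 :: 'd))" "bounded_linear (\<lambda>y. (0 :: 'c, y))"
    by (auto intro: bounded_linear_Pair bounded_linear_ident bounded_linear_zero)
  from ulip_add[OF ulip_bounded_linear[OF assms(1) this(1)] ulip_bounded_linear[OF assms(2) this(2)]]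
  show ?thesis by simp
qed

lemma ulip_power:
  fixes f :: "'p \<Rightarrow> 'a::real_normed_vector \<Rightarrow> 'b::real_normed_algebra_1"
  assumes "ulip P \<rho> f"
  shows "ulip P \<rho> (\<lambda>p z. f p z ^ n)"
  by (induction n) (auto intro: ulip_const ulip_mult assms)

lemma ulip_minus: "ulip P \<rho> f \<Longrightarrow> ulip P \<rho> (\<lambda>p z. - f p z)"
  by (rule ulip_bounded_linear) (auto intro: bounded_linear_minus bounded_linear_ident)

lemma ulip_diff: "ulip P \<rho> f \<Longrightarrow> ulip P \<rho> g \<Longrightarrow> ulip P \<rho> (\<lambda>p z. f p z - g p z)"
  using ulip_add[OF _ ulip_minus, of P \<rho> f g] by simp

lemmas ulip_fst = ulip_bounded_linear[OF _ bounded_linear_fst]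
  and ulip_snd = ulip_bounded_linear[OF _ bounded_linear_snd]
  and ulip_cnj = ulip_bounded_linear[OF _ bounded_linear_cnj]
  and ulip_of_real = ulip_bounded_linear[OF _ bounded_linear_of_real]

lemmas ulip_intros = ulip_const ulip_add ulip_diff ulip_minus ulip_mult ulip_power ulip_ident ulip_Pair
  ulip_fst ulip_snd ulip_cnj ulip_of_real

text \<open>Only continuity of \<open>Z\<close> is known in advance. First-order expansions of
  \<open>W\<close> and \<open>S\<close> give the deviation from the candidate derivative as small
  errors plus \<open>S'\<close> applied to the deviation itself; as \<open>S'\<close> halves norms
  in the space direction, that last term is absorbed on the left.\<close>

lemma implicit_curve_has_vector_derivative:
  fixes Z W :: "real \<Rightarrow> 'a::real_normed_vector" and S :: "real \<times> 'a \<Rightarrow> 'a"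
  assumes t: "t \<in> T"
    and Z: "\<And>s. s \<in> T \<Longrightarrow> Z s = W s + S (s, Z s)"
    and cont: "continuous (at t within T) Z"
    and W: "(W has_vector_derivative W') (at t within T)"
    and S: "(S has_derivative S') (at (t, Z t))"
    and small: "\<And>v. norm (S' (0, v)) \<le> norm v / 2"
    and d: "d = W' + S' (1, d)"
  shows "(Z has_vector_derivative d) (at t within T)"
proof -
  interpret S': bounded_linear S' using S by (rule has_derivative_bounded_linear)
  have "((\<lambda>s. Z s - Z t - (s - t) *\<^sub>R d) has_derivative (\<lambda>_. 0)) (at t within T)"
    unfolding has_derivative_within_alt
  proof (intro conjI allI impI bounded_linear_zero)
    fix \<epsilon> :: real assume "\<epsilon> > 0"
    define M where "M = 1 + norm d"
    \<comment> \<open>The bound \<open>1/4\<close> allows a second absorption, of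
      \<open>2 \<eta> norm r\<close>, once \<open>norm r / 2\<close> has been absorbed. The other
      bound yields the final constant, because \<open>4 (2 + norm d) \<le> 8 M\<close>.\<close>
    define \<eta> where "\<eta> = min (1/4) (\<epsilon> / (8 * M))"
    have M: "M \<ge> 1" by (simp add: M_def)
    have \<eta>: "\<eta> > 0" "\<eta> \<le> 1/4" "8 * M * \<eta> \<le> \<epsilon>" using \<open>\<epsilon> > 0\<close> M by (auto simp: \<eta>_def min_def field_simps)
    obtain d1 where d1: "d1 > 0" "\<And>y. norm (y - (t, Z t)) < d1 \<Longrightarrow>
        norm (S y - S (t, Z t) - S' (y - (t, Z t))) \<le> \<eta> * norm (y - (t, Z t))"
      using S \<eta>(1) unfolding has_derivative_within_alt by (auto simp: )
    obtain d2 where d2: "d2 > 0" "\<And>s. s \<in> T \<Longrightarrow> norm (s - t) < d2 \<Longrightarrow>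
        norm (W s - W t - (s - t) *\<^sub>R W') \<le> \<eta> * norm (s - t)"
      using W \<eta>(1) unfolding has_vector_derivative_def has_derivative_within_alt by (auto simp: )
    obtain d3 where d3: "d3 > 0" "\<And>s. s \<in> T \<Longrightarrow> dist s t < d3 \<Longrightarrow> dist (Z s) (Z t) < d1 / 2"
      using cont d1(1) unfolding continuous_within_eps_delta by (metis half_gt_zero)
    show "\<exists>\<delta>>0. \<forall>s\<in>T. norm (s - t) < \<delta> \<longrightarrow>
        norm (Z s - Z t - (s - t) *\<^sub>R d - (Z t - Z t - (t - t) *\<^sub>R d) - 0) \<le> \<epsilon> * norm (s - t)"
    proof (intro exI[of _ "min (min d2 d3) (d1 / 2)"] conjI ballI impI)
      fix s assume s: "s \<in> T" "norm (s - t) < min (min d2 d3) (d1 / 2)"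
      define h where "h = s - t"
      define \<Delta> where "\<Delta> = Z s - Z t"
      define r where "r = \<Delta> - h *\<^sub>R d"
      have n: "norm ((s, Z s) - (t, Z t)) \<le> norm h + norm \<Delta>"
        unfolding h_def \<Delta>_def using norm_Pair_le[of "s - t" "Z s - Z t"] by simp
      have "norm \<Delta> < d1 / 2" "norm h < d1 / 2"
        using d3(2)[OF s(1)] s by (auto simp: \<Delta>_def h_def dist_norm)
      then have "norm ((s, Z s) - (t, Z t)) < d1" using n by linarith
      then have e1: "norm (S (s, Z s) - S (t, Z t) - S' (h, \<Delta>)) \<le> \<eta> * (norm h + norm \<Delta>)"
        using order_trans[OF d1(2) mult_left_mono[OF n, of \<eta>]] \<eta>(1) by (simp add: h_def \<Delta>_def)
      have e2: "norm (W s - W t - h *\<^sub>R W') \<le> \<eta> * norm h"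
        using d2(2)[OF s(1)] s(2) by (simp add: h_def)
      have "S' (h, \<Delta>) = h *\<^sub>R S' (1, d) + S' (0, r)"
        unfolding r_def by (simp flip: S'.scaleR S'.add)
      moreover have "\<Delta> = (W s - W t) + (S (s, Z s) - S (t, Z t))"
        unfolding \<Delta>_def using Z[OF s(1)] Z[OF t] by (metis add_diff_add)
      moreover have "h *\<^sub>R d = h *\<^sub>R W' + h *\<^sub>R S' (1, d)" by (metis d scaleR_add_right)
      ultimately have "r = (W s - W t - h *\<^sub>R W') + (S (s, Z s) - S (t, Z t) - S' (h, \<Delta>)) + S' (0, r)"
        unfolding r_def by (simp only: diff_conv_add_uminus minus_add_distrib) (simp add: add_ac)
      then have "norm r \<le> \<eta> * norm h + \<eta> * (norm h + norm \<Delta>) + norm r / 2"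
        using e1 e2 small[of r] by (metis add_mono norm_triangle_mono)
      moreover have "norm \<Delta> \<le> norm r + norm h * norm d"
        unfolding r_def by (metis diff_add_cancel norm_scaleR norm_triangle_ineq real_norm_def)
      ultimately have "norm r \<le> 2 * (\<eta> * (2 * norm h + norm h * norm d)) + 2 * (\<eta> * norm r)"
        using mult_left_mono[of "norm \<Delta>" "norm r + norm h * norm d" \<eta>] \<eta>(1) by (simp add: algebra_simps)
      moreover have "\<eta> * norm r \<le> norm r / 4" using mult_right_mono[OF \<eta>(2), of "norm r"] by simp
      ultimately have "norm r \<le> 4 * (\<eta> * (2 * norm h + norm h * norm d))" by linarith
      also have "\<dots> = (4 * (2 + norm d) * \<eta>) * norm h" by (simp add: algebra_simps)
      also have "\<dots> \<le> (8 * M * \<eta>) * norm h"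
        using \<eta>(1) by (intro mult_right_mono) (auto simp: M_def)
      also have "\<dots> \<le> \<epsilon> * norm h" using \<eta>(3) by (rule mult_right_mono) simp
      finally show "norm (Z s - Z t - (s - t) *\<^sub>R d - (Z t - Z t - (t - t) *\<^sub>R d) - 0) \<le> \<epsilon> * norm (s - t)"
        by (simp add: r_def \<Delta>_def h_def)
    qed (use d1 d2 d3 in auto)
  qed
  moreover have "((\<lambda>s. Z t + (s - t) *\<^sub>R d) has_derivative (\<lambda>h. h *\<^sub>R d)) (at t within T)"
    by (auto intro!: derivative_eq_intros)
  ultimately have "((\<lambda>s. (Z s - Z t - (s - t) *\<^sub>R d) + (Z t + (s - t) *\<^sub>R d))
      has_derivative (\<lambda>h. 0 + h *\<^sub>R d)) (at t within T)"
    by (rule has_derivative_add)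
  then show ?thesis by (simp add: has_vector_derivative_def)
qed

section \<open>Linear equations with a dichotomy on the half-line\<close>

lemma integrable_on_Ici_exp_bound:
  fixes f :: "real \<Rightarrow> real"
  assumes "continuous_on {a..} f" "\<And>t. t \<ge> a \<Longrightarrow> \<bar>f t\<bar> \<le> B * exp (- r * t)" "r > 0"
  shows "f integrable_on {a..}" "\<bar>integral {a..} f\<bar> \<le> B * exp (- r * a) / r"
proof -
  have i: "((\<lambda>t. B * exp (- r * t)) has_integral B * (exp (- r * a) / r)) {a..}"
    using has_integral_exp_minus_to_infinity[OF \<open>r > 0\<close>, of a] by (intro has_integral_mult_right) auto
  have "f \<in> borel_measurable (lebesgue_on {a..})"
    by (rule continuous_imp_measurable_on_sets_lebesgue) (use assms in auto)
  then show f: "f integrable_on {a..}"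
    by (rule measurable_bounded_by_integrable_imp_integrable_real)
       (use i assms in \<open>auto intro: has_integral_integrable\<close>)
  have "norm (integral {a..} f) \<le> integral {a..} (\<lambda>t. B * exp (- r * t))"
    by (rule integral_norm_bound_integral) (use f i assms in \<open>auto intro: has_integral_integrable\<close>)
  then show "\<bar>integral {a..} f\<bar> \<le> B * exp (- r * a) / r"
    using integral_unique[OF i] by simp
qed

lemma integral_Ici_split:
  fixes f :: "real \<Rightarrow> real"
  assumes "f integrable_on {0..}" "f integrable_on {a..}" "f integrable_on {0..a}" "a \<ge> 0"
  shows "integral {0..} f = integral {0..a} f + integral {a..} f"
proof -
  have "(f has_integral (integral {0..a} f + integral {a..} f)) ({0..a} \<union> {a..})"
    by (rule has_integral_Un) (use assms in \<open>auto simp: has_integral_integral intro: negligible_subset[OF negligible_sing[of a]]\<close>)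
  moreover have "{0..a} \<union> {a..} = {0..}" using assms(4) by auto
  ultimately show ?thesis by (simp add: integral_unique)
qed

lemma integral_Ici_has_derivative:
  fixes f :: "real \<Rightarrow> real"
  assumes c: "continuous_on {0..} f" and b: "\<And>t. t \<ge> 0 \<Longrightarrow> \<bar>f t\<bar> \<le> B * exp (- r * t)" "r > 0" and t: "t \<ge> 0"
  shows "((\<lambda>t. integral {t..} f) has_real_derivative - f t) (at t within {0..})"
proof -
  have i: "f integrable_on {a..}" if "a \<ge> 0" for a
    by (rule integrable_on_Ici_exp_bound[where B = B and r = r])
       (use that b in \<open>auto intro: continuous_on_subset[OF c]\<close>)
  have eq: "integral {s..} f = integral {0..} f - integral {0..s} f" if "s \<ge> 0" for s
    using integral_Ici_split[of f s] i that
    by (force intro: integrable_continuous_interval continuous_on_subset[OF c])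
  have "((\<lambda>s. integral {0..s} f) has_real_derivative f t) (at t within {0..t+1})"
    using t integral_has_real_derivative[of 0 "t + 1" f t] continuous_on_subset[OF c, of "{0..t+1}"] by auto
  moreover have "at t within {0..t+1} = at t within {0..}"
    by (rule at_within_nhd[where S = "{..<t+1}"]) auto
  ultimately have "((\<lambda>s. integral {0..} f - integral {0..s} f) has_real_derivative - f t) (at t within {0..})"
    by (auto intro!: derivative_eq_intros)
  then show ?thesis unfolding has_field_derivative_def
    by (rule has_derivative_transform[rotated -1]) (auto intro: t eq)
qed

text \<open>Variation of constants for \<open>u'' = V u\<close> with a decaying solution \<open>p\<close>, a growing solution \<open>q\<close>
  and Wronskian \<open>1\<close>. Integrating the coefficient of \<open>q\<close> from infinity keeps the solution bounded.\<close>

definition coeff_decaying :: "(real \<Rightarrow> real) \<Rightarrow> (real \<Rightarrow> real) \<Rightarrow> (real \<Rightarrow> real) \<Rightarrow> (real \<Rightarrow> real) \<Rightarrow> real \<Rightarrow> real" where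
  "coeff_decaying q q' h1 h2 t = integral {0..t} (\<lambda>s. h1 s * q' s - h2 s * q s)"

definition coeff_growing :: "(real \<Rightarrow> real) \<Rightarrow> (real \<Rightarrow> real) \<Rightarrow> (real \<Rightarrow> real) \<Rightarrow> (real \<Rightarrow> real) \<Rightarrow> real \<Rightarrow> real" where
  "coeff_growing p p' h1 h2 t = integral {t..} (\<lambda>s. h1 s * p' s - h2 s * p s)"

locale dichotomy =
  fixes p p' q q' V :: "real \<Rightarrow> real" and C :: real
  assumes deriv: "\<And>t. t \<ge> 0 \<Longrightarrow> (p has_real_derivative p' t) (at t within {0..})"
    "\<And>t. t \<ge> 0 \<Longrightarrow> (p' has_real_derivative V t * p t) (at t within {0..})"
    "\<And>t. t \<ge> 0 \<Longrightarrow> (q has_real_derivative q' t) (at t within {0..})"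
    "\<And>t. t \<ge> 0 \<Longrightarrow> (q' has_real_derivative V t * q t) (at t within {0..})"
    and wronskian: "\<And>t. t \<ge> 0 \<Longrightarrow> p t * q' t - p' t * q t = 1"
    and bound: "\<And>t. t \<ge> 0 \<Longrightarrow> \<bar>p t\<bar> \<le> C * exp (- t)" "\<And>t. t \<ge> 0 \<Longrightarrow> \<bar>p' t\<bar> \<le> C * exp (- t)"
     "\<And>t. t \<ge> 0 \<Longrightarrow> \<bar>q t\<bar> \<le> C * exp t" "\<And>t. t \<ge> 0 \<Longrightarrow> \<bar>q' t\<bar> \<le> C * exp t"
begin

definition forced :: "(real \<Rightarrow> real) \<Rightarrow> (real \<Rightarrow> real) \<Rightarrow> real \<Rightarrow> real" where
  "forced h1 h2 t = coeff_decaying q q' h1 h2 t * p t + coeff_growing p p' h1 h2 t * q t"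

text \<open>The second component of the first-order system \<open>u1' = u2 + h1\<close>,
  \<open>u2' = V u1 + h2\<close>. It differs from the derivative of \<open>forced\<close> by
  \<open>h1\<close>, so that forcing in both components is covered.\<close>

definition forced' :: "(real \<Rightarrow> real) \<Rightarrow> (real \<Rightarrow> real) \<Rightarrow> real \<Rightarrow> real" where
  "forced' h1 h2 t = coeff_decaying q q' h1 h2 t * p' t + coeff_growing p p' h1 h2 t * q' t"

lemma C_nonneg: "C \<ge> 0"
  using bound(1)[of 0] by (auto intro: order_trans[OF abs_ge_zero])

lemma cont: "continuous_on {0..} p" "continuous_on {0..} p'" "continuous_on {0..} q" "continuous_on {0..} q'"
  using deriv by (auto intro!: has_real_derivative_imp_continuous_on DERIV_continuous_on)

lemma integrand_cont:
  assumes "continuous_on {0..} h1" "continuous_on {0..} h2"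
  shows "continuous_on {0..} (\<lambda>t. h1 t * p' t - h2 t * p t)"
    and "continuous_on {0..} (\<lambda>t. h1 t * q' t - h2 t * q t)"
  by (intro continuous_intros assms cont)+

context
  fixes h1 h2 :: "real \<Rightarrow> real" and N :: real
  assumes h_cont: "continuous_on {0..} h1" "continuous_on {0..} h2"
    and h_bound: "\<And>t. t \<ge> 0 \<Longrightarrow> \<bar>h1 t\<bar> \<le> N * exp (- (t / 2))" "\<And>t. t \<ge> 0 \<Longrightarrow> \<bar>h2 t\<bar> \<le> N * exp (- (t / 2))"
begin

lemma N_nonneg: "N \<ge> 0"
  using h_bound(1)[of 0] by (auto intro: order_trans[OF abs_ge_zero])

lemma p_integrand_bound: "\<bar>h1 t * p' t - h2 t * p t\<bar> \<le> (2 * C * N) * exp (- (3/2) * t)" if "t \<ge> 0"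
proof -
  have "\<bar>h1 t * p' t - h2 t * p t\<bar> \<le> \<bar>h1 t\<bar> * \<bar>p' t\<bar> + \<bar>h2 t\<bar> * \<bar>p t\<bar>"
    by (metis abs_mult abs_triangle_ineq4)
  also have "\<dots> \<le> (N * exp (- (t / 2))) * (C * exp (- t)) + (N * exp (- (t / 2))) * (C * exp (- t))"
    by (intro add_mono mult_mono h_bound bound that) (auto simp: N_nonneg)
  also have "\<dots> = (2 * C * N) * exp (- (3/2) * t)" by (simp add: mult_exp_exp)
  finally show ?thesis .
qed

lemma q_integrand_bound: "\<bar>h1 t * q' t - h2 t * q t\<bar> \<le> (2 * C * N) * exp (t / 2)" if "t \<ge> 0"
proof -
  have "\<bar>h1 t * q' t - h2 t * q t\<bar> \<le> \<bar>h1 t\<bar> * \<bar>q' t\<bar> + \<bar>h2 t\<bar> * \<bar>q t\<bar>"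
    by (metis abs_mult abs_triangle_ineq4)
  also have "\<dots> \<le> (N * exp (- (t / 2))) * (C * exp t) + (N * exp (- (t / 2))) * (C * exp t)"
    by (intro add_mono mult_mono h_bound bound that) (auto simp: N_nonneg)
  also have "\<dots> = (2 * C * N) * exp (t / 2)" by (simp add: mult_exp_exp)
  finally show ?thesis .
qed

lemma coeff_growing_bound: "\<bar>coeff_growing p p' h1 h2 t\<bar> \<le> 2 * C * N * exp (- (3/2) * t)" if "t \<ge> 0"
proof -
  have "\<bar>coeff_growing p p' h1 h2 t\<bar> \<le> 2 * C * N * exp (- (3/2) * t) / (3/2)"
    unfolding coeff_growing_def
    by (rule integrable_on_Ici_exp_bound)
       (use that p_integrand_bound in \<open>auto intro: continuous_on_subset[OF integrand_cont(1)[OF h_cont]]\<close>)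
  also have "\<dots> \<le> 2 * C * N * exp (- (3/2) * t)"
    using C_nonneg N_nonneg by (simp add: field_simps)
  finally show ?thesis .
qed

lemma coeff_decaying_bound: "\<bar>coeff_decaying q q' h1 h2 t\<bar> \<le> 4 * C * N * exp (t / 2)" if "t \<ge> 0"
proof -
  have *: "((\<lambda>s. (2 * C * N) * exp (s / 2)) has_integral
      4 * C * N * exp (t / 2) - 4 * C * N * exp (0 / 2)) {0..t}"
    by (rule fundamental_theorem_of_calculus[OF that])
       (auto intro!: derivative_eq_intros simp flip: has_real_derivative_iff_has_vector_derivative)
  have "norm (coeff_decaying q q' h1 h2 t) \<le> integral {0..t} (\<lambda>s. (2 * C * N) * exp (s / 2))"
    unfolding coeff_decaying_def
    by (rule integral_norm_bound_integral)
       (use q_integrand_bound in \<open>auto intro!: integrable_continuous_interval continuous_intros continuous_on_subset[OF integrand_cont(2)[OF h_cont]]\<close>)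
  also have "\<dots> = 4 * C * N * exp (t / 2) - 4 * C * N" using integral_unique[OF *] by simp
  also have "\<dots> \<le> 4 * C * N * exp (t / 2)" using mult_nonneg_nonneg[OF C_nonneg N_nonneg] by linarith
  finally show ?thesis by simp
qed

text \<open>The weight \<open>exp (- t / 2)\<close> decays more slowly than the homogeneous solution
  and is therefore reproduced: the integral from \<open>0\<close> gives \<open>exp (t/2)\<close>
  times \<open>exp (- t)\<close>, the tail gives \<open>exp (- 3 t / 2)\<close> times
  \<open>exp t\<close>. With weight \<open>exp (- t)\<close> the first integral would cost a factor
  \<open>t\<close>.\<close>

lemma forced_bound:
  assumes "t \<ge> 0"
  shows "\<bar>forced h1 h2 t\<bar> \<le> 6 * C\<^sup>2 * N * exp (- (t / 2))" "\<bar>forced' h1 h2 t\<bar> \<le> 6 * C\<^sup>2 * N * exp (- (t / 2))"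
proof -
  have *: "\<bar>coeff_decaying q q' h1 h2 t * a + coeff_growing p p' h1 h2 t * b\<bar> \<le> 6 * C\<^sup>2 * N * exp (- (t / 2))"
    if "\<bar>a\<bar> \<le> C * exp (- t)" "\<bar>b\<bar> \<le> C * exp t" for a b
  proof -
    have "\<bar>coeff_decaying q q' h1 h2 t * a + coeff_growing p p' h1 h2 t * b\<bar> \<le> \<bar>coeff_decaying q q' h1 h2 t\<bar> * \<bar>a\<bar> + \<bar>coeff_growing p p' h1 h2 t\<bar> * \<bar>b\<bar>"
      by (metis abs_mult abs_triangle_ineq)
    also have "\<dots> \<le> (4 * C * N * exp (t / 2)) * (C * exp (- t)) + (2 * C * N * exp (- (3/2) * t)) * (C * exp t)"
      by (intro add_mono mult_mono coeff_decaying_bound coeff_growing_bound that assms) (auto simp: N_nonneg C_nonneg)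
    also have "\<dots> = 4 * C\<^sup>2 * N * (exp (t / 2) * exp (- t)) + 2 * C\<^sup>2 * N * (exp (- (3/2) * t) * exp t)"
      by (simp add: power2_eq_square)
    also have "\<dots> = 6 * C\<^sup>2 * N * exp (- (t / 2))" unfolding mult_exp_exp by simp
    finally show ?thesis .
  qed
  show "\<bar>forced h1 h2 t\<bar> \<le> 6 * C\<^sup>2 * N * exp (- (t / 2))" "\<bar>forced' h1 h2 t\<bar> \<le> 6 * C\<^sup>2 * N * exp (- (t / 2))"
    unfolding forced_def forced'_def using assms by (auto intro!: * bound)
qed

lemma coeff_deriv:
  assumes "t \<ge> 0"
  shows "(coeff_decaying q q' h1 h2 has_real_derivative h1 t * q' t - h2 t * q t) (at t within {0..})"
   "(coeff_growing p p' h1 h2 has_real_derivative - (h1 t * p' t - h2 t * p t)) (at t within {0..})"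
proof -
  have "((\<lambda>u. integral {0..u} (\<lambda>s. h1 s * q' s - h2 s * q s)) has_real_derivative
     h1 t * q' t - h2 t * q t) (at t within {0..t+1})"
    using assms integral_has_real_derivative[of 0 "t + 1" _ t] continuous_on_subset[OF integrand_cont(2)[OF h_cont], of "{0..t+1}"] by auto
  moreover have "at t within {0..t+1} = at t within {0..}"
    by (rule at_within_nhd[where S = "{..<t+1}"]) auto
  ultimately show "(coeff_decaying q q' h1 h2 has_real_derivative h1 t * q' t - h2 t * q t) (at t within {0..})"
    unfolding coeff_decaying_def[abs_def] by simp
  show "(coeff_growing p p' h1 h2 has_real_derivative - (h1 t * p' t - h2 t * p t)) (at t within {0..})"
    unfolding coeff_growing_def[abs_def]
    by (rule integral_Ici_has_derivative[OF integrand_cont(1)[OF h_cont] p_integrand_bound]) (use assms in auto)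
qed

lemma forced_deriv:
  assumes "t \<ge> 0"
  shows "(forced h1 h2 has_real_derivative forced' h1 h2 t + h1 t) (at t within {0..})"
   "(forced' h1 h2 has_real_derivative V t * forced h1 h2 t + h2 t) (at t within {0..})"
proof -
  have "((\<lambda>t. coeff_decaying q q' h1 h2 t * f t + coeff_growing p p' h1 h2 t * g t) has_real_derivative
     coeff_decaying q q' h1 h2 t * f' + coeff_growing p p' h1 h2 t * g' + h1 t * (f t * q' t - p' t * g t)
       + h2 t * (p t * g t - f t * q t)) (at t within {0..})"
    if "(f has_real_derivative f') (at t within {0..})" "(g has_real_derivative g') (at t within {0..})" for f g f' g'
    by (rule DERIV_cong[OF DERIV_add[OF DERIV_mult'[OF coeff_deriv(1) that(1)] DERIV_mult'[OF coeff_deriv(2) that(2)]]])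
       (use assms in \<open>simp_all add: algebra_simps\<close>)
  note * = this
  show "(forced h1 h2 has_real_derivative forced' h1 h2 t + h1 t) (at t within {0..})"
    unfolding forced_def[abs_def] forced'_def
    using *[OF deriv(1,3)[OF assms]] unfolding wronskian[OF assms] by simp
  show "(forced' h1 h2 has_real_derivative V t * forced h1 h2 t + h2 t) (at t within {0..})"
    unfolding forced_def forced'_def[abs_def]
    using *[OF deriv(2,4)[OF assms]] unfolding wronskian[OF assms]
    by (rule DERIV_cong) (simp add: distrib_left mult.left_commute)
qed

end

lemma forced_diff:
  assumes "continuous_on {0..} h1" "continuous_on {0..} h2"
    and "\<And>t. t \<ge> 0 \<Longrightarrow> \<bar>h1 t\<bar> \<le> N * exp (- (t / 2))" "\<And>t. t \<ge> 0 \<Longrightarrow> \<bar>h2 t\<bar> \<le> N * exp (- (t / 2))"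
    and "continuous_on {0..} g1" "continuous_on {0..} g2"
    and "\<And>t. t \<ge> 0 \<Longrightarrow> \<bar>g1 t\<bar> \<le> M * exp (- (t / 2))" "\<And>t. t \<ge> 0 \<Longrightarrow> \<bar>g2 t\<bar> \<le> M * exp (- (t / 2))"
    and "t \<ge> 0"
  shows "forced (\<lambda>t. h1 t - g1 t) (\<lambda>t. h2 t - g2 t) t = forced h1 h2 t - forced g1 g2 t"
    "forced' (\<lambda>t. h1 t - g1 t) (\<lambda>t. h2 t - g2 t) t = forced' h1 h2 t - forced' g1 g2 t"
proof -
  have i1: "(\<lambda>s. f1 s * q' s - f2 s * q s) integrable_on {0..t}"
    if "continuous_on {0..} f1" "continuous_on {0..} f2" for f1 f2
    by (auto intro!: integrable_continuous_interval continuous_on_subset[OF integrand_cont(2)[OF that]])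
  have e1: "coeff_decaying q q' (\<lambda>t. h1 t - g1 t) (\<lambda>t. h2 t - g2 t) t = coeff_decaying q q' h1 h2 t - coeff_decaying q q' g1 g2 t"
    unfolding coeff_decaying_def using assms by (subst integral_diff[symmetric]) (auto intro!: i1 simp: algebra_simps)
  have i2: "(\<lambda>s. f1 s * p' s - f2 s * p s) integrable_on {t..}"
    if c: "continuous_on {0..} f1" "continuous_on {0..} f2"
      and hb: "\<And>t. t \<ge> 0 \<Longrightarrow> \<bar>f1 t\<bar> \<le> K * exp (- (t / 2))" "\<And>t. t \<ge> 0 \<Longrightarrow> \<bar>f2 t\<bar> \<le> K * exp (- (t / 2))" for f1 f2 K
  proof (rule integrable_on_Ici_exp_bound(1)[where r = "3/2" and B = "2 * C * K"])
    show "\<bar>f1 s * p' s - f2 s * p s\<bar> \<le> 2 * C * K * exp (- (3/2) * s)" if "s \<ge> t" for s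
      by (rule p_integrand_bound[OF \<open>continuous_on {0..} f1\<close> \<open>continuous_on {0..} f2\<close>])
         (use that \<open>t \<ge> 0\<close> hb in auto)
  qed (use \<open>t \<ge> 0\<close> in \<open>auto intro!: continuous_on_subset[OF integrand_cont(1)[OF c]]\<close>)
  have e2: "coeff_growing p p' (\<lambda>t. h1 t - g1 t) (\<lambda>t. h2 t - g2 t) t = coeff_growing p p' h1 h2 t - coeff_growing p p' g1 g2 t"
    unfolding coeff_growing_def
    by (subst integral_diff[symmetric])
       (use i2[OF assms(1,2,3,4)] i2[OF assms(5,6,7,8)] in \<open>auto simp: algebra_simps\<close>)
  show "forced (\<lambda>t. h1 t - g1 t) (\<lambda>t. h2 t - g2 t) t = forced h1 h2 t - forced g1 g2 t"
    "forced' (\<lambda>t. h1 t - g1 t) (\<lambda>t. h2 t - g2 t) t = forced' h1 h2 t - forced' g1 g2 t"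
    unfolding forced_def forced'_def e1 e2 by (simp_all add: left_diff_distrib)
qed

end

section \<open>Linearization about the sech profile\<close>

lemma exp_cosh_bounds:
  fixes t :: real
  assumes "t \<ge> 0"
  shows "1 / cosh t \<le> 2 * exp (- t)" "cosh t \<le> exp t" "0 \<le> sinh t" "sinh t \<le> cosh t" "t \<le> cosh t"
    "exp (- t) \<le> 1" "1 \<le> exp t"
proof -
  have "exp t / 2 \<le> cosh t" by (simp add: cosh_def)
  then show "1 / cosh t \<le> 2 * exp (- t)" by (simp add: field_simps exp_minus)
  show "exp (- t) \<le> 1" "1 \<le> exp t" using assms by auto
  then have "exp (- t) \<le> exp t" by linarith
  then show "cosh t \<le> exp t" "0 \<le> sinh t" by (simp_all add: cosh_def sinh_def)
  show "sinh t \<le> cosh t" by (simp add: cosh_def sinh_def)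
  have "1 + t \<le> exp t" "1 - t \<le> exp (- t)" by (rule exp_ge_add_one_self) (metis exp_ge_add_one_self uminus_add_conv_diff add.commute)
  \<comment> \<open>Averaging \<open>1 + t + t^2 / 2 \<le> exp t\<close> and
    \<open>1 - t \<le> exp (- t)\<close> gives \<open>1 + t^2 / 4 \<le> cosh t\<close>, and this
    square says that the left side is at least \<open>t\<close>.\<close>
  moreover have "0 \<le> (t / 2 - 1)^2" by simp
  ultimately show "t \<le> cosh t"
    using exp_lower_Taylor_quadratic[OF assms] by (simp add: cosh_def power2_eq_square algebra_simps)
qed

text \<open>Minus the derivative of \<open>sech\<close>: the translation mode of the averaged
  homoclinic, an odd function.\<close>

definition sech_p where "sech_p t = sinh t / cosh t ^ 2" for t :: real
definition sech_p' where "sech_p' t = 2 / cosh t ^ 3 - 1 / cosh t" for t :: real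
text \<open>\<open>sech_q\<close> and \<open>sech_s\<close> come from \<open>sech_p\<close> and \<open>sech_r\<close> by reduction of order.\<close>

definition sech_q where "sech_q t = 3/2 * t * sech_p t + cosh t / 2 - 3/2 / cosh t" for t :: real
definition sech_q' where "sech_q' t = 3 * sech_p t + 3/2 * t * sech_p' t + sinh t / 2" for t :: real

lemma sech_p_deriv:
  fixes t :: real
  shows "(sech_p has_real_derivative sech_p' t) (at t within A)"
    "(sech_p' has_real_derivative (1 - 6 / cosh t ^ 2) * sech_p t) (at t within A)"
proof -
  have c: "cosh t \<noteq> 0" by simp
  have s: "sinh t * sinh t = cosh t * cosh t - 1" using cosh_square_eq[of t] by (simp add: power2_eq_square)
  have "((\<lambda>t. sinh t / cosh t ^ 2) has_real_derivative
      (cosh t * cosh t ^ 2 - sinh t * (2 * cosh t * sinh t)) / (cosh t ^ 2 * cosh t ^ 2)) (at t within A)"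
    using c by (auto intro!: derivative_eq_intros)
  moreover have "(cosh t * cosh t ^ 2 - sinh t * (2 * cosh t * sinh t)) / (cosh t ^ 2 * cosh t ^ 2) = sech_p' t"
    using c s unfolding sech_p'_def by (simp add: field_simps) algebra
  ultimately show "(sech_p has_real_derivative sech_p' t) (at t within A)"
    unfolding sech_p_def[abs_def] by simp
  have "((\<lambda>t. 2 / cosh t ^ 3 - 1 / cosh t) has_real_derivative
      - (2 * (3 * cosh t ^ 2 * sinh t)) / (cosh t ^ 3 * cosh t ^ 3) + sinh t / (cosh t * cosh t)) (at t within A)"
    using c by (auto intro!: derivative_eq_intros)
  moreover have "- (2 * (3 * cosh t ^ 2 * sinh t)) / (cosh t ^ 3 * cosh t ^ 3) + sinh t / (cosh t * cosh t)
      = (1 - 6 / cosh t ^ 2) * sech_p t"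
    using c unfolding sech_p_def by (simp add: field_simps power2_eq_square power3_eq_cube)
  ultimately show "(sech_p' has_real_derivative (1 - 6 / cosh t ^ 2) * sech_p t) (at t within A)"
    unfolding sech_p'_def[abs_def] by simp
qed

lemma sech_q_deriv:
  fixes t :: real
  shows "(sech_q has_real_derivative sech_q' t) (at t within A)"
    "(sech_q' has_real_derivative (1 - 6 / cosh t ^ 2) * sech_q t) (at t within A)"
proof -
  have c: "cosh t \<noteq> 0" by simp
  have "(sech_q has_real_derivative 3/2 * sech_p t + 3/2 * t * sech_p' t + sinh t / 2
      + 3/2 * sinh t / (cosh t * cosh t)) (at t within A)"
    unfolding sech_q_def[abs_def] using c by (auto intro!: derivative_eq_intros sech_p_deriv)
  then show "(sech_q has_real_derivative sech_q' t) (at t within A)"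
    by (rule DERIV_cong) (use c in \<open>simp add: sech_q'_def sech_p_def power2_eq_square\<close>)
  define V where "V = 1 - 6 / cosh t ^ 2"
  note d = sech_p_deriv(2)[of t A, folded V_def]
  have "(sech_q' has_real_derivative 3 * sech_p' t + 3/2 * sech_p' t
     + 3/2 * t * (V * sech_p t) + cosh t / 2) (at t within A)"
    unfolding sech_q'_def[abs_def]
    by (auto intro!: derivative_eq_intros sech_p_deriv(1) d simp: field_simps)
  moreover have "3 * sech_p' t + 3/2 * sech_p' t + cosh t / 2 = V * (cosh t / 2 - 3/2 / cosh t)"
    using c unfolding sech_p'_def V_def by (simp add: field_simps power2_eq_square power3_eq_cube)
  ultimately show "(sech_q' has_real_derivative (1 - 6 / cosh t ^ 2) * sech_q t) (at t within A)"
    unfolding sech_q_def V_def[symmetric] by (auto elim!: DERIV_cong simp: algebra_simps)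
qed

text \<open>The phase mode: rotating the real homoclinic by a small angle moves it by
  \<open>\<i>\<close> times \<open>sech\<close>.\<close>

definition sech_r where "sech_r t = 1 / cosh t" for t :: real
definition sech_r' where "sech_r' t = - sech_p t" for t :: real
definition sech_s where "sech_s t = (sinh t + t / cosh t) / 2" for t :: real
definition sech_s' where "sech_s' t = (cosh t + 1 / cosh t - t * sech_p t) / 2" for t :: real

text \<open>The linearization about the sech profile splits into its real part, with potential
  \<open>1 - 6 sech\<^sup>2\<close>, and its imaginary part, with potential \<open>1 - 2 sech\<^sup>2\<close>.\<close>

interpretation re_part: dichotomy sech_p sech_p' sech_q sech_q' "\<lambda>t. 1 - 6 / cosh t ^ 2" 8
proof
  fix t :: real assume t: "t \<ge> 0"
  note b = exp_cosh_bounds[OF t]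
  have c: "cosh t \<ge> 1" "cosh t \<noteq> 0" by (simp_all add: cosh_real_ge_1)
  have i: "0 \<le> 1 / cosh t" "1 / cosh t \<le> 1" using c by simp_all
  have p: "0 \<le> sech_p t" "sech_p t \<le> 1 / cosh t"
    using b c by (simp_all add: sech_p_def power2_eq_square divide_simps)
  have "2 / cosh t ^ 3 \<le> 2 * (1 / cosh t)"
    using c power_increasing[of 1 3 "cosh t"] by (simp add: divide_simps)
  moreover have "0 \<le> 2 / cosh t ^ 3" using c by simp
  ultimately have p': "\<bar>sech_p' t\<bar> \<le> 2 * (1 / cosh t)"
    using i unfolding sech_p'_def by linarith
  have tc: "t * (1 / cosh t) \<le> 1" using b c by simp
  have tp: "0 \<le> t * sech_p t" "t * sech_p t \<le> 1" "\<bar>t * sech_p' t\<bar> \<le> 2"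
  proof -
    show "0 \<le> t * sech_p t" "t * sech_p t \<le> 1"
      using t p order_trans[OF mult_left_mono[OF p(2) t] tc] by simp_all
    have "t * \<bar>sech_p' t\<bar> \<le> t * (2 * (1 / cosh t))" by (rule mult_left_mono[OF p' t])
    also have "\<dots> = 2 * (t * (1 / cosh t))" by simp
    also have "\<dots> \<le> 2" using tc by linarith
    finally show "\<bar>t * sech_p' t\<bar> \<le> 2" using t by (simp add: abs_mult)
  qed
  show "\<bar>sech_p t\<bar> \<le> 8 * exp (- t)" "\<bar>sech_p' t\<bar> \<le> 8 * exp (- t)"
    using p p' b(1) i by linarith+
  \<comment> \<open>The factor \<open>t\<close> from the reduction of order is harmless, since
    \<open>t \<le> cosh t\<close>. The largest sum, for \<open>sech_q'\<close>, is
    \<open>3 + 3 + exp t / 2\<close>, so \<open>8\<close> leaves room.\<close>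
  show "\<bar>sech_q t\<bar> \<le> 8 * exp t" "\<bar>sech_q' t\<bar> \<le> 8 * exp t"
    unfolding sech_q_def sech_q'_def mult.assoc
    by (rule abs_leI; use tp(1,2) tp(3)[unfolded abs_le_iff] p b i in argo)+
  have s: "sinh t ^ 2 = cosh t ^ 2 - 1" using cosh_square_eq[of t] by simp
  have "sech_p t * sech_q' t - sech_p' t * sech_q t =
      sech_p t * (3 * sech_p t + sinh t / 2) - sech_p' t * (cosh t / 2 - 3/2 / cosh t)"
    by (simp add: sech_q_def sech_q'_def algebra_simps)
  also have "\<dots> = 3 * sinh t ^ 2 / cosh t ^ 4 + sinh t ^ 2 / (2 * cosh t ^ 2)
      - (2 / cosh t ^ 3 - 1 / cosh t) * (cosh t / 2 - 3/2 / cosh t)"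
    using c by (simp add: sech_p_def sech_p'_def field_simps power2_eq_square power4_eq_xxxx)
  also have "\<dots> = 1" unfolding s using c
    by (simp add: field_simps power2_eq_square power3_eq_cube power4_eq_xxxx)
  finally show "sech_p t * sech_q' t - sech_p' t * sech_q t = 1" .
qed (rule sech_p_deriv sech_q_deriv)+

interpretation im_part: dichotomy sech_r sech_r' sech_s sech_s' "\<lambda>t. 1 - 2 / cosh t ^ 2" 8
proof
  fix t :: real assume t: "t \<ge> 0"
  note b = exp_cosh_bounds[OF t]
  have c: "cosh t \<ge> 1" "cosh t \<noteq> 0" by (simp_all add: cosh_real_ge_1)
  have i: "0 \<le> 1 / cosh t" "1 / cosh t \<le> 1" using c by simp_all
  have p: "0 \<le> sech_p t" "sech_p t \<le> 1 / cosh t"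
    using b c by (simp_all add: sech_p_def power2_eq_square divide_simps)
  have tc: "t / cosh t \<le> 1" "0 \<le> t / cosh t" "t * (1 / cosh t) \<le> 1" using b c t by simp_all
  have tp: "0 \<le> t * sech_p t" "t * sech_p t \<le> 1"
    using t p order_trans[OF mult_left_mono[OF p(2) t] tc(3)] by simp_all
  show "\<bar>sech_r t\<bar> \<le> 8 * exp (- t)" "\<bar>sech_r' t\<bar> \<le> 8 * exp (- t)"
    using b(1) i p unfolding sech_r_def sech_r'_def by linarith+
  show "\<bar>sech_s t\<bar> \<le> 8 * exp t" "\<bar>sech_s' t\<bar> \<le> 8 * exp t"
    unfolding sech_s_def sech_s'_def
    by (rule abs_leI; use tc tp b i in argo)+
  have s: "sinh t * sinh t = cosh t * cosh t - 1" using cosh_square_eq[of t] by (simp add: power2_eq_square)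
  show "(sech_r has_real_derivative sech_r' t) (at t within {0..})"
    unfolding sech_r_def[abs_def] sech_r'_def sech_p_def
    using c by (auto intro!: derivative_eq_intros simp: power2_eq_square)
  show "(sech_r' has_real_derivative (1 - 2 / cosh t ^ 2) * sech_r t) (at t within {0..})"
    unfolding sech_r'_def[abs_def] sech_r_def
    by (rule DERIV_cong[OF DERIV_minus[OF sech_p_deriv(1)]])
       (use c in \<open>simp add: sech_p'_def field_simps power2_eq_square power3_eq_cube\<close>)
  show "(sech_s has_real_derivative sech_s' t) (at t within {0..})"
    unfolding sech_s_def[abs_def] sech_s'_def
    using c by (auto intro!: derivative_eq_intros simp: sech_p_def field_simps power2_eq_square)
  have "(sech_s' has_real_derivative
     (sinh t - sinh t / (cosh t * cosh t) - (sech_p t + t * sech_p' t)) / 2) (at t within {0..})"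
    unfolding sech_s'_def[abs_def] using c by (auto intro!: derivative_eq_intros sech_p_deriv)
  then show "(sech_s' has_real_derivative (1 - 2 / cosh t ^ 2) * sech_s t) (at t within {0..})"
    by (rule DERIV_cong)
       (use c in \<open>simp add: sech_s_def sech_p_def sech_p'_def field_simps power2_eq_square power3_eq_cube\<close>)
  have "sech_r t * sech_s' t - sech_r' t * sech_s t =
      (1 + 1 / (cosh t * cosh t) + (sinh t * sinh t) / (cosh t * cosh t)) / 2"
    using c by (simp add: sech_r_def sech_r'_def sech_s_def sech_s'_def sech_p_def field_simps power2_eq_square)
  also have "\<dots> = 1" unfolding s using c by (simp add: field_simps)
  finally show "sech_r t * sech_s' t - sech_r' t * sech_s t = 1" .
qed

text \<open>A particular decaying solution of the linearized equation with forcing \<open>h\<close>.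
  No multiple of the homogeneous decaying modes is added, and this normalization determines the
  value at \<open>0\<close>.\<close>

definition solveK :: "(real \<Rightarrow> complex \<times> complex) \<Rightarrow> real \<Rightarrow> complex \<times> complex" where
  "solveK h t =
    (let h1 = \<lambda>t. fst (h t); h2 = \<lambda>t. snd (h t) in
    (Complex (re_part.forced (\<lambda>t. Re (h1 t)) (\<lambda>t. Re (h2 t)) t) (im_part.forced (\<lambda>t. Im (h1 t)) (\<lambda>t. Im (h2 t)) t),
     Complex (re_part.forced' (\<lambda>t. Re (h1 t)) (\<lambda>t. Re (h2 t)) t) (im_part.forced' (\<lambda>t. Im (h1 t)) (\<lambda>t. Im (h2 t)) t)))"

definition sech_lin :: "real \<Rightarrow> complex \<times> complex \<Rightarrow> complex \<times> complex" where
  "sech_lin t z = (snd z, Complex ((1 - 6 / cosh t ^ 2) * Re (fst z)) ((1 - 2 / cosh t ^ 2) * Im (fst z)))"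

text \<open>Here nondegeneracy is used. The coefficients of the decaying modes vanish at
  \<open>0\<close>, and the growing solutions have the right parity: \<open>sech_q\<close> is even,
  so \<open>sech_q'\<close> vanishes at \<open>0\<close>, and \<open>sech_s\<close> is odd. The
  boundary condition thus holds for every forcing, with no parameter to adjust.\<close>

lemma solveK_0: "Im (fst (solveK h 0)) = 0" "Re (snd (solveK h 0)) = 0"
  by (simp_all add: solveK_def Let_def im_part.forced_def re_part.forced'_def coeff_decaying_def sech_q'_def sech_p_def sech_s_def)

context
  fixes h :: "real \<Rightarrow> complex \<times> complex" and N :: real
  assumes h: "continuous_on {0..} h" "\<And>t. t \<ge> 0 \<Longrightarrow> norm (h t) \<le> N * exp (- (t / 2))"
begin

lemma solveK_components:
  "continuous_on {0..} (\<lambda>t. Re (fst (h t)))" "continuous_on {0..} (\<lambda>t. Re (snd (h t)))"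
  "\<And>t. t \<ge> 0 \<Longrightarrow> \<bar>Re (fst (h t))\<bar> \<le> N * exp (- (t / 2))"
  "\<And>t. t \<ge> 0 \<Longrightarrow> \<bar>Re (snd (h t))\<bar> \<le> N * exp (- (t / 2))"
  "continuous_on {0..} (\<lambda>t. Im (fst (h t)))" "continuous_on {0..} (\<lambda>t. Im (snd (h t)))"
  "\<And>t. t \<ge> 0 \<Longrightarrow> \<bar>Im (fst (h t))\<bar> \<le> N * exp (- (t / 2))"
  "\<And>t. t \<ge> 0 \<Longrightarrow> \<bar>Im (snd (h t))\<bar> \<le> N * exp (- (t / 2))"
proof -
  have n: "norm (fst z) \<le> norm z" "norm (snd z) \<le> norm z" for z :: "complex \<times> complex"
    by (metis norm_fst_le prod.collapse) (metis norm_snd_le prod.collapse)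
  note b = order_trans[OF abs_Re_le_cmod order_trans[OF n(1) h(2)]] order_trans[OF abs_Re_le_cmod order_trans[OF n(2) h(2)]]
    order_trans[OF abs_Im_le_cmod order_trans[OF n(1) h(2)]] order_trans[OF abs_Im_le_cmod order_trans[OF n(2) h(2)]]
  show "\<bar>Re (fst (h t))\<bar> \<le> N * exp (- (t / 2))" "\<bar>Re (snd (h t))\<bar> \<le> N * exp (- (t / 2))"
    "\<bar>Im (fst (h t))\<bar> \<le> N * exp (- (t / 2))" "\<bar>Im (snd (h t))\<bar> \<le> N * exp (- (t / 2))"
    if "t \<ge> 0" for t using b[OF that] .
qed (intro continuous_intros h(1))+

text \<open>Four real components, each at most \<open>6 * 8^2\<close> times the weighted bound:
  \<open>1536 = 4 * 384\<close>.\<close>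

lemma solveK_bound: "norm (solveK h t) \<le> 1536 * N * exp (- (t / 2))" if "t \<ge> 0"
proof -
  let ?r1 = "\<lambda>t. Re (fst (h t))" and ?r2 = "\<lambda>t. Re (snd (h t))"
    and ?i1 = "\<lambda>t. Im (fst (h t))" and ?i2 = "\<lambda>t. Im (snd (h t))"
  have "\<bar>re_part.forced ?r1 ?r2 t\<bar> \<le> 6 * 8\<^sup>2 * N * exp (- (t / 2))" "\<bar>re_part.forced' ?r1 ?r2 t\<bar> \<le> 6 * 8\<^sup>2 * N * exp (- (t / 2))"
    by (rule re_part.forced_bound; use that in \<open>auto intro!: solveK_components\<close>)+
  moreover have "\<bar>im_part.forced ?i1 ?i2 t\<bar> \<le> 6 * 8\<^sup>2 * N * exp (- (t / 2))" "\<bar>im_part.forced' ?i1 ?i2 t\<bar> \<le> 6 * 8\<^sup>2 * N * exp (- (t / 2))"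
    by (rule im_part.forced_bound; use that in \<open>auto intro!: solveK_components\<close>)+
  moreover have "norm (Complex a b, Complex c d) \<le> \<bar>a\<bar> + \<bar>b\<bar> + \<bar>c\<bar> + \<bar>d\<bar>" for a b c d
    using norm_Pair_le[of "Complex a b" "Complex c d"] cmod_le[of "Complex a b"] cmod_le[of "Complex c d"] by simp
  from this[of "re_part.forced ?r1 ?r2 t" "im_part.forced ?i1 ?i2 t" "re_part.forced' ?r1 ?r2 t" "im_part.forced' ?i1 ?i2 t"]
  have "norm (solveK h t) \<le> \<bar>re_part.forced ?r1 ?r2 t\<bar> + \<bar>im_part.forced ?i1 ?i2 t\<bar> + \<bar>re_part.forced' ?r1 ?r2 t\<bar> + \<bar>im_part.forced' ?i1 ?i2 t\<bar>"
    by (simp add: solveK_def Let_def)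
  moreover have "x \<le> 1536 * N * e" if "x \<le> a + b + c + d" "a \<le> 6 * 8\<^sup>2 * N * e" "c \<le> 6 * 8\<^sup>2 * N * e"
     "b \<le> 6 * 8\<^sup>2 * N * e" "d \<le> 6 * 8\<^sup>2 * N * e" for x a b c d e :: real
    using that by (simp add: mult.assoc)
  ultimately show ?thesis by blast
qed

lemma solveK_deriv: "(solveK h has_vector_derivative sech_lin t (solveK h t) + h t) (at t within {0..})" if "t \<ge> 0"
proof -
  let ?r1 = "\<lambda>t. Re (fst (h t))" and ?r2 = "\<lambda>t. Re (snd (h t))"
    and ?i1 = "\<lambda>t. Im (fst (h t))" and ?i2 = "\<lambda>t. Im (snd (h t))"
  have C: "((\<lambda>t. Complex (f t) (g t)) has_vector_derivative Complex f' g') F"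
    if "(f has_real_derivative f') F" "(g has_real_derivative g') F" for f g f' g' F
    using that unfolding has_vector_derivative_complex_iff by simp
  have "(re_part.forced ?r1 ?r2 has_real_derivative re_part.forced' ?r1 ?r2 t + ?r1 t) (at t within {0..})"
    "(re_part.forced' ?r1 ?r2 has_real_derivative (1 - 6 / cosh t ^ 2) * re_part.forced ?r1 ?r2 t + ?r2 t) (at t within {0..})"
    by (rule re_part.forced_deriv[of _ _ N]; use that in \<open>auto intro!: solveK_components\<close>)+
  moreover have "(im_part.forced ?i1 ?i2 has_real_derivative im_part.forced' ?i1 ?i2 t + ?i1 t) (at t within {0..})"
    "(im_part.forced' ?i1 ?i2 has_real_derivative (1 - 2 / cosh t ^ 2) * im_part.forced ?i1 ?i2 t + ?i2 t) (at t within {0..})"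
    by (rule im_part.forced_deriv[of _ _ N]; use that in \<open>auto intro!: solveK_components\<close>)+
  ultimately have "(solveK h has_vector_derivative
     (Complex (re_part.forced' ?r1 ?r2 t + ?r1 t) (im_part.forced' ?i1 ?i2 t + ?i1 t),
      Complex ((1 - 6 / cosh t ^ 2) * re_part.forced ?r1 ?r2 t + ?r2 t) ((1 - 2 / cosh t ^ 2) * im_part.forced ?i1 ?i2 t + ?i2 t)))
     (at t within {0..})"
    unfolding solveK_def[abs_def] Let_def by (intro has_vector_derivative_Pair C)
  then show ?thesis
    by (rule has_vector_derivative_eq_rhs)
       (simp add: solveK_def Let_def sech_lin_def plus_prod_def prod_eq_iff complex_eq_iff)
qed

end

lemma solveK_diff:
  assumes h: "continuous_on {0..} h" "\<And>t. t \<ge> 0 \<Longrightarrow> norm (h t) \<le> N * exp (- (t / 2))"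
    and g: "continuous_on {0..} g" "\<And>t. t \<ge> 0 \<Longrightarrow> norm (g t) \<le> M * exp (- (t / 2))" and "t \<ge> 0"
  shows "solveK (\<lambda>t. h t - g t) t = solveK h t - solveK g t"
proof -
  note c = solveK_components[OF h] solveK_components[OF g]
  have "re_part.forced (\<lambda>t. Re (fst (h t)) - Re (fst (g t))) (\<lambda>t. Re (snd (h t)) - Re (snd (g t))) t =
     re_part.forced (\<lambda>t. Re (fst (h t))) (\<lambda>t. Re (snd (h t))) t - re_part.forced (\<lambda>t. Re (fst (g t))) (\<lambda>t. Re (snd (g t))) t"
    "re_part.forced' (\<lambda>t. Re (fst (h t)) - Re (fst (g t))) (\<lambda>t. Re (snd (h t)) - Re (snd (g t))) t =
     re_part.forced' (\<lambda>t. Re (fst (h t))) (\<lambda>t. Re (snd (h t))) t - re_part.forced' (\<lambda>t. Re (fst (g t))) (\<lambda>t. Re (snd (g t))) t"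
    by (rule re_part.forced_diff[where N = N and M = M]; use \<open>t \<ge> 0\<close> in \<open>auto intro!: c\<close>)+
  moreover have "im_part.forced (\<lambda>t. Im (fst (h t)) - Im (fst (g t))) (\<lambda>t. Im (snd (h t)) - Im (snd (g t))) t =
     im_part.forced (\<lambda>t. Im (fst (h t))) (\<lambda>t. Im (snd (h t))) t - im_part.forced (\<lambda>t. Im (fst (g t))) (\<lambda>t. Im (snd (g t))) t"
    "im_part.forced' (\<lambda>t. Im (fst (h t)) - Im (fst (g t))) (\<lambda>t. Im (snd (h t)) - Im (snd (g t))) t =
     im_part.forced' (\<lambda>t. Im (fst (h t))) (\<lambda>t. Im (snd (h t))) t - im_part.forced' (\<lambda>t. Im (fst (g t))) (\<lambda>t. Im (snd (g t))) t"
    by (rule im_part.forced_diff[where N = N and M = M]; use \<open>t \<ge> 0\<close> in \<open>auto intro!: c\<close>)+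
  ultimately show ?thesis by (simp add: solveK_def Let_def minus_prod_def complex_eq_iff)
qed

section \<open>A contraction principle in weighted functions\<close>

text \<open>The nonlinear terms are small for different reasons: \<open>Q\<close> is of higher order
  and has a small Lipschitz constant only on the ball of radius \<open>r\<close> for the correction,
  whereas \<open>S\<close> and \<open>R\<close> carry a small constant on the ball of radius
  \<open>\<rho>\<close> that contains the whole curve. \<open>S\<close> stands outside
  \<open>K\<close> because it is the algebraic part of an averaging relation. Of \<open>K\<close>
  only a bound, continuity and compatibility with differences enter.\<close>

lemma weighted_fixed_point:
  fixes K :: "(real \<Rightarrow> 'a::banach) \<Rightarrow> real \<Rightarrow> 'a" and Z0 :: "real \<Rightarrow> 'a" and Q S R :: "real \<Rightarrow> 'a \<Rightarrow> 'a"
  assumes K_bound: "\<And>h N t. continuous_on {0..} h \<Longrightarrow> (\<And>t. t \<ge> 0 \<Longrightarrow> norm (h t) \<le> N * exp (- (t / 2)))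
      \<Longrightarrow> t \<ge> 0 \<Longrightarrow> norm (K h t) \<le> CK * N * exp (- (t / 2))"
    and K_cont: "\<And>h N. continuous_on {0..} h \<Longrightarrow> (\<And>t. t \<ge> 0 \<Longrightarrow> norm (h t) \<le> N * exp (- (t / 2)))
      \<Longrightarrow> continuous_on {0..} (K h)"
    and K_diff: "\<And>h g N M t. continuous_on {0..} h \<Longrightarrow> (\<And>t. t \<ge> 0 \<Longrightarrow> norm (h t) \<le> N * exp (- (t / 2)))
      \<Longrightarrow> continuous_on {0..} g \<Longrightarrow> (\<And>t. t \<ge> 0 \<Longrightarrow> norm (g t) \<le> M * exp (- (t / 2))) \<Longrightarrow> t \<ge> 0
      \<Longrightarrow> K (\<lambda>t. h t - g t) t = K h t - K g t"
    and Z0: "continuous_on {0..} Z0" "\<And>t. t \<ge> 0 \<Longrightarrow> norm (Z0 t) \<le> C0 * exp (- (t / 2))" "C0 + 1 \<le> \<rho>"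
    and r: "0 < r" "r \<le> 1"
    and Q_cont: "\<And>z. continuous_on {0..} z \<Longrightarrow> continuous_on {0..} (\<lambda>t. Q t (z t))"
    and Q: "\<And>t. t \<ge> 0 \<Longrightarrow> Q t 0 = 0" "\<And>t z w. t \<ge> 0 \<Longrightarrow> norm z \<le> r \<Longrightarrow> norm w \<le> r \<Longrightarrow>
      norm (Q t z - Q t w) \<le> LQ * norm (z - w)" "0 \<le> LQ"
    and S_cont: "\<And>z. continuous_on {0..} z \<Longrightarrow> (\<And>t. t \<ge> 0 \<Longrightarrow> norm (z t) \<le> \<rho>) \<Longrightarrow>
      continuous_on {0..} (\<lambda>t. S t (z t))"
    and S: "\<And>t. t \<ge> 0 \<Longrightarrow> S t 0 = 0" "\<And>t z w. t \<ge> 0 \<Longrightarrow> norm z \<le> \<rho> \<Longrightarrow> norm w \<le> \<rho> \<Longrightarrow>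
      norm (S t z - S t w) \<le> L * norm (z - w)" "0 \<le> L"
    and R_cont: "\<And>z. continuous_on {0..} z \<Longrightarrow> (\<And>t. t \<ge> 0 \<Longrightarrow> norm (z t) \<le> \<rho>) \<Longrightarrow>
      continuous_on {0..} (\<lambda>t. R t (z t))"
    and R: "\<And>t. t \<ge> 0 \<Longrightarrow> R t 0 = 0" "\<And>t z w. t \<ge> 0 \<Longrightarrow> norm z \<le> \<rho> \<Longrightarrow> norm w \<le> \<rho> \<Longrightarrow>
      norm (R t z - R t w) \<le> L * norm (z - w)"
    and CK: "0 \<le> CK"
    and contr: "CK * (LQ + L) + L \<le> 1 / 2"
    and self: "(CK * L + L) * C0 \<le> r / 2"
  shows "\<exists>\<zeta>. continuous_on {0..} \<zeta> \<and> (\<forall>t\<ge>0. norm (\<zeta> t) \<le> r * exp (- (t / 2)) \<and>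
     \<zeta> t = S t (Z0 t + \<zeta> t) + K (\<lambda>t. Q t (\<zeta> t) + R t (Z0 t + \<zeta> t)) t)"
proof -
  \<comment> \<open>Dividing by the weight turns the weighted norm into the sup norm, so the
    contraction runs in the complete space of bounded continuous functions.\<close>
  define emb where "emb \<eta> t = exp (- (t / 2)) *\<^sub>R apply_bcontfun \<eta> t" for \<eta> :: "real \<Rightarrow>\<^sub>C 'a" and t
  define H where "H \<eta> t = Q t (emb \<eta> t) + R t (Z0 t + emb \<eta> t)" for \<eta> t
  define F where "F \<eta> t = S t (Z0 t + emb \<eta> t) + K (H \<eta>) t" for \<eta> t
  \<comment> \<open>The equation concerns \<open>t \<ge> 0\<close> only; \<open>max 0 t\<close>
    extends the values constantly to negative \<open>t\<close>, keeping them continuous and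
    bounded.\<close>
  define G where "G \<eta> t = exp (max 0 t / 2) *\<^sub>R F \<eta> (max 0 t)" for \<eta> t
  define B where "B = cball (0 :: real \<Rightarrow>\<^sub>C 'a) r"
  have exp1: "exp (- (t / 2)) \<le> 1" if "t \<ge> 0" for t :: real using that by simp
  have C0: "0 \<le> C0" using Z0(2)[of 0] by (auto intro: order_trans[OF norm_ge_zero])
  have emb_diff: "norm (emb \<eta> t - emb \<theta> t) \<le> dist \<eta> \<theta> * exp (- (t / 2))" for \<eta> \<theta> t
    using mult_left_mono[OF dist_bounded[of \<eta> t \<theta>], of "exp (- (t / 2))"]
    by (simp add: emb_def dist_norm mult.commute flip: scaleR_diff_right)
  have emb0: "emb 0 t = 0" for t by (simp add: emb_def)
  have emb_bound: "norm (emb \<eta> t) \<le> r * exp (- (t / 2))" "t \<ge> 0 \<Longrightarrow> norm (emb \<eta> t) \<le> r" if "\<eta> \<in> B" for \<eta> t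
  proof -
    have "dist \<eta> 0 \<le> r" using that by (simp add: B_def dist_commute)
    then show 1: "norm (emb \<eta> t) \<le> r * exp (- (t / 2))"
      using emb_diff[of \<eta> t 0] emb0[of t] by (auto intro: order_trans mult_right_mono)
    show "norm (emb \<eta> t) \<le> r" if "t \<ge> 0"
      using order_trans[OF 1 mult_left_mono[OF exp1[OF that], of r]] r by simp
  qed
  have emb_cont: "continuous_on A (emb \<eta>)" for \<eta> A
    unfolding emb_def[abs_def] by (intro continuous_intros) auto
  have Zb: "norm (Z0 t + emb \<eta> t) \<le> \<rho>" if "\<eta> \<in> B" "t \<ge> 0" for \<eta> t
  proof -
    have "norm (Z0 t) \<le> C0" using order_trans[OF Z0(2)[OF that(2)] mult_left_mono[OF exp1[OF that(2)] C0]] by simp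
    then show ?thesis using emb_bound(2)[OF that] Z0(3) r norm_triangle_ineq[of "Z0 t" "emb \<eta> t"] by linarith
  qed
  have Zc: "continuous_on {0..} (\<lambda>t. Z0 t + emb \<eta> t)" for \<eta>
    by (intro continuous_intros Z0 emb_cont)
  have Hc: "continuous_on {0..} (H \<eta>)" if "\<eta> \<in> B" for \<eta>
    unfolding H_def[abs_def] by (intro continuous_on_add Q_cont R_cont emb_cont Zc Zb that) auto
  have Hdiff: "norm (H \<eta> t - H \<theta> t) \<le> ((LQ + L) * dist \<eta> \<theta>) * exp (- (t / 2))"
    if "\<eta> \<in> B" "\<theta> \<in> B" "t \<ge> 0" for \<eta> \<theta> t
  proof -
    have "norm (H \<eta> t - H \<theta> t) \<le> norm (Q t (emb \<eta> t) - Q t (emb \<theta> t))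
       + norm (R t (Z0 t + emb \<eta> t) - R t (Z0 t + emb \<theta> t))"
      unfolding H_def by (metis add_diff_add norm_triangle_ineq)
    also have "\<dots> \<le> LQ * norm (emb \<eta> t - emb \<theta> t) + L * norm (emb \<eta> t - emb \<theta> t)"
      using Q(2)[OF that(3) emb_bound(2)[OF that(1,3)] emb_bound(2)[OF that(2,3)]]
        R(2)[OF that(3) Zb[OF that(1,3)] Zb[OF that(2,3)]] by simp
    also have "\<dots> \<le> (LQ + L) * (dist \<eta> \<theta> * exp (- (t / 2)))"
      using mult_left_mono[OF emb_diff[of \<eta> t \<theta>], of "LQ + L"] Q(3) S(3) by (simp add: algebra_simps)
    finally show ?thesis by (simp add: mult.assoc)
  qed
  have B0: "0 \<in> B" using r by (simp add: B_def)
  have SR0: "norm (S t (Z0 t)) \<le> L * C0 * exp (- (t / 2))" "norm (R t (Z0 t)) \<le> L * C0 * exp (- (t / 2))"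
    if "t \<ge> 0" for t
  proof -
    have "norm (Z0 t) \<le> \<rho>" "norm (0::'a) \<le> \<rho>"
      using Zb[OF B0 that] emb0 Z0(3) C0 by simp_all
    then show "norm (S t (Z0 t)) \<le> L * C0 * exp (- (t / 2))" "norm (R t (Z0 t)) \<le> L * C0 * exp (- (t / 2))"
      using S(2)[OF that, of "Z0 t" 0] S(1)[OF that] R(2)[OF that, of "Z0 t" 0] R(1)[OF that]
        mult_left_mono[OF Z0(2)[OF that] S(3)] by (auto simp: mult.assoc)
  qed
  have H0b: "norm (H 0 t) \<le> L * C0 * exp (- (t / 2))" if "t \<ge> 0" for t
    using SR0(2)[OF that] Q(1)[OF that] by (simp add: H_def emb0)
  have Hb: "norm (H \<eta> t) \<le> ((LQ + L) * dist \<eta> 0 + L * C0) * exp (- (t / 2))" if "\<eta> \<in> B" "t \<ge> 0" for \<eta> t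
    using H0b[OF that(2)] Hdiff[OF that(1) B0 that(2)] norm_triangle_sub[of "H \<eta> t" "H 0 t"]
    by (simp add: algebra_simps)
  have Fc: "continuous_on {0..} (F \<eta>)" if "\<eta> \<in> B" for \<eta>
    unfolding F_def[abs_def]
    by (intro continuous_on_add S_cont Zc K_cont[OF Hc[OF that] Hb[OF that]] Zb that) auto
  have Fdiff: "norm (F \<eta> t - F \<theta> t) \<le> (1/2 * dist \<eta> \<theta>) * exp (- (t / 2))"
    if "\<eta> \<in> B" "\<theta> \<in> B" "t \<ge> 0" for \<eta> \<theta> t
  proof -
    have "K (H \<eta>) t - K (H \<theta>) t = K (\<lambda>t. H \<eta> t - H \<theta> t) t"
      by (rule K_diff[symmetric, OF Hc[OF that(1)] Hb[OF that(1)] Hc[OF that(2)] Hb[OF that(2)] that(3)])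
    also have "norm \<dots> \<le> CK * ((LQ + L) * dist \<eta> \<theta>) * exp (- (t / 2))"
      by (rule K_bound) (use that Hc Hdiff in \<open>auto intro!: continuous_intros\<close>)
    finally have 1: "norm (K (H \<eta>) t - K (H \<theta>) t) \<le> CK * ((LQ + L) * dist \<eta> \<theta>) * exp (- (t / 2))" .
    have "norm (S t (Z0 t + emb \<eta> t) - S t (Z0 t + emb \<theta> t)) \<le> L * norm (emb \<eta> t - emb \<theta> t)"
      using S(2)[OF that(3) Zb[OF that(1,3)] Zb[OF that(2,3)]] by simp
    also have "\<dots> \<le> L * (dist \<eta> \<theta> * exp (- (t / 2)))" by (rule mult_left_mono[OF emb_diff S(3)])
    finally have "norm (F \<eta> t - F \<theta> t) \<le> L * (dist \<eta> \<theta> * exp (- (t / 2))) + CK * ((LQ + L) * dist \<eta> \<theta>) * exp (- (t / 2))"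
      using 1 unfolding F_def by (metis add_diff_add norm_triangle_mono)
    also have "\<dots> = (CK * (LQ + L) + L) * (dist \<eta> \<theta> * exp (- (t / 2)))" by (simp add: algebra_simps)
    also have "\<dots> \<le> 1/2 * (dist \<eta> \<theta> * exp (- (t / 2)))" using contr by (rule mult_right_mono) simp
    finally show ?thesis by simp
  qed
  have F0: "norm (F 0 t) \<le> r / 2 * exp (- (t / 2))" if "t \<ge> 0" for t
  proof -
    have "norm (K (H 0) t) \<le> CK * (L * C0) * exp (- (t / 2))"
      by (rule K_bound[OF Hc[OF B0] H0b that]) 
    then have "norm (F 0 t) \<le> L * C0 * exp (- (t / 2)) + CK * (L * C0) * exp (- (t / 2))"
      using SR0(1)[OF that] unfolding F_def emb0 by (simp add: norm_triangle_mono)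
    also have "\<dots> = (CK * L + L) * C0 * exp (- (t / 2))" by (simp add: algebra_simps)
    also have "\<dots> \<le> r / 2 * exp (- (t / 2))" using self by (rule mult_right_mono) simp
    finally show ?thesis .
  qed
  have Fb: "norm (F \<eta> t) \<le> r * exp (- (t / 2))" if "\<eta> \<in> B" "t \<ge> 0" for \<eta> t
  proof -
    have "(1/2 * dist \<eta> 0) * exp (- (t / 2)) \<le> r / 2 * exp (- (t / 2))"
      using that(1) by (intro mult_right_mono) (auto simp: B_def dist_commute)
    then show ?thesis
      using F0[OF that(2)] Fdiff[OF that(1) B0 that(2)] norm_triangle_sub[of "F \<eta> t" "F 0 t"] by linarith
  qed
  have G_scale: "norm (exp (s / 2) *\<^sub>R v) \<le> c" if "norm v \<le> c * exp (- (s / 2))" for s c :: real and v :: 'a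
    using mult_left_mono[OF that, of "exp (s / 2)"] by (simp add: mult_exp_exp mult.left_commute)
  have Gb: "norm (G \<eta> t) \<le> r" if "\<eta> \<in> B" for \<eta> t
    unfolding G_def by (rule G_scale[OF Fb[OF that]]) simp
  have Gc: "continuous_on UNIV (G \<eta>)" if "\<eta> \<in> B" for \<eta>
    unfolding G_def[abs_def]
    by (intro continuous_intros continuous_on_compose2[OF Fc[OF that]]) auto
  have Gin: "G \<eta> \<in> bcontfun" if "\<eta> \<in> B" for \<eta>
    unfolding bcontfun_def using Gc[OF that] Gb[OF that] by (auto simp: bounded_iff)
  have app: "apply_bcontfun (Bcontfun (G \<eta>)) = G \<eta>" if "\<eta> \<in> B" for \<eta>
    by (rule Bcontfun_inverse[OF Gin[OF that]])
  have "\<exists>!\<eta>\<in>B. Bcontfun (G \<eta>) = \<eta>"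
  proof (rule Banach_fix)
    show "complete B" unfolding B_def by (simp add: complete_eq_closed)
    show "B \<noteq> {}" using B0 by auto
    show "(\<lambda>\<eta>. Bcontfun (G \<eta>)) ` B \<subseteq> B"
    proof clarify
      fix \<eta> assume "\<eta> \<in> B"
      then have "dist (Bcontfun (G \<eta>)) 0 \<le> r"
        by (intro dist_bound) (simp add: app Gb)
      then show "Bcontfun (G \<eta>) \<in> B" by (simp add: B_def dist_commute)
    qed
    show "dist (Bcontfun (G \<eta>)) (Bcontfun (G \<theta>)) \<le> 1/2 * dist \<eta> \<theta>" if "\<eta> \<in> B" "\<theta> \<in> B" for \<eta> \<theta>
    proof (rule dist_bound)
      fix t :: real
      have "norm (G \<eta> t - G \<theta> t) \<le> 1/2 * dist \<eta> \<theta>"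
        unfolding G_def scaleR_diff_right[symmetric] by (rule G_scale, rule Fdiff) (use that in auto)
      then show "dist (apply_bcontfun (Bcontfun (G \<eta>)) t) (apply_bcontfun (Bcontfun (G \<theta>)) t) \<le> 1/2 * dist \<eta> \<theta>"
        using that by (simp add: app dist_norm)
    qed
  qed auto
  then obtain \<eta> where \<eta>: "\<eta> \<in> B" "Bcontfun (G \<eta>) = \<eta>" by auto
  have "emb \<eta> t = F \<eta> t" if "t \<ge> 0" for t
  proof -
    have "apply_bcontfun \<eta> t = G \<eta> t" using app[OF \<eta>(1)] \<eta>(2) by simp
    then show ?thesis using that by (simp add: emb_def G_def mult_exp_exp)
  qed
  then show ?thesis
    using emb_bound(1)[OF \<eta>(1)] emb_cont[of "{0..}" \<eta>]
    by (intro exI[of _ "emb \<eta>"]) (auto simp: F_def H_def[abs_def])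
qed

section \<open>Averaging\<close>

definition cscale :: "complex \<Rightarrow> complex \<times> complex \<Rightarrow> complex \<times> complex" where
  "cscale e z = (e * fst z, e * snd z)"

lemma norm_cscale: "norm (cscale e z) = norm e * norm z"
  by (simp add: cscale_def norm_prod_def norm_mult power_mult_distrib real_sqrt_mult flip: distrib_left)

lemma cscale_cscale [simp]: "cscale e (cscale f z) = cscale (e * f) z"
  and cscale_1 [simp]: "cscale 1 z = z"
  by (simp_all add: cscale_def mult.assoc)

lemma bounded_bilinear_cscale: "bounded_bilinear cscale"
proof
  show "\<exists>K. \<forall>a b. norm (cscale a b) \<le> norm a * norm b * K"
    by (intro exI[of _ 1]) (simp add: norm_cscale)
qed (simp_all add: cscale_def algebra_simps prod_eq_iff)

interpretation cscale: bounded_bilinear cscale by (rule bounded_bilinear_cscale)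

lemma has_vector_derivative_cis_scaled:
  "((\<lambda>t. cis (t / \<mu>)) has_vector_derivative (\<i> / of_real \<mu>) * cis (t / \<mu>)) (at t within A)"
  unfolding has_vector_derivative_complex_iff
  by (cases "\<mu> = 0") (auto intro!: derivative_eq_intros simp: Re_divide Im_divide field_simps power2_eq_square)

text \<open>The polynomials of the two averaging steps, in terms of \<open>p = e A\<close>, \<open>q = e C\<close>, where \<open>e\<close> is the
  fast phase. \<open>nf_T\<close> removes the quadratic terms from the second equation; the remaining field \<open>nf_Phi\<close>
  is averaged to \<open>nf_avg\<close> by the generator \<open>nf_S\<close>, see \<open>nf_homological\<close>.\<close>

definition nf_T :: "real \<Rightarrow> complex \<Rightarrow> complex" where
  "nf_T b p = (\<i> * of_real b / 4) * (- (p^2) + 2 * p * cnj p + (1/3) * (cnj p)^2)"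

definition nf_dT :: "real \<Rightarrow> complex \<Rightarrow> complex \<Rightarrow> complex" where
  "nf_dT b p a = (\<i> * of_real b / 4) * (- 2 * p * a + 2 * (a * cnj p + p * cnj a) + (2/3) * cnj p * cnj a)"

definition nf_Phi1 :: "real \<Rightarrow> complex \<times> complex \<Rightarrow> complex" where
  "nf_Phi1 b z = (let p = fst z; q = snd z; P = cnj p; Q = cnj q in
     q - Q + (\<i> * of_real b / 4) * (- (2/3) * p^2 + 4 * p * P - (2/3) * P^2))"

definition nf_Phi2 :: "real \<Rightarrow> real \<Rightarrow> complex \<times> complex \<Rightarrow> complex" where
  "nf_Phi2 b c z = (let p = fst z; q = snd z; P = cnj p; Q = cnj q in
     p + P - of_real c * ((p + P) / 2)^3
     - (\<i> * of_real b / 2) * (- 2 * p * q + 2 * p * Q + (2/3) * P * q - (2/3) * P * Q)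
     - (of_real b^2 / 8) * (- (4/3) * p^3 + (76/9) * p^2 * P - 4 * p * P^2 + (4/9) * P^3))"

definition nf_Phi :: "real \<Rightarrow> real \<Rightarrow> complex \<times> complex \<Rightarrow> complex \<times> complex" where
  "nf_Phi b c z = (nf_Phi1 b z, nf_Phi2 b c z)"

definition nf_avg :: "complex \<times> complex \<Rightarrow> complex \<times> complex" where
  "nf_avg z = (snd z, fst z - 2 * (fst z)^2 * cnj (fst z))"

definition nf_S :: "real \<Rightarrow> real \<Rightarrow> complex \<times> complex \<Rightarrow> complex \<times> complex" where
  "nf_S b c z = (let p = fst z; q = snd z; P = cnj p; Q = cnj q in
     (- (\<i> / 2) * Q - (of_real b / 4) * ((2/3) * p^2 + 4 * p * P - (2/9) * P^2),
      (\<i> / 2) * P - (of_real c / 8) * (- (\<i> / 2) * p^3 + (3 * \<i> / 2) * p * P^2 + (\<i> / 4) * P^3)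
      + (of_real b / 2) * (2 * p * q + 2 * p * Q + (2/3) * P * q - (2/9) * P * Q)
      - (\<i> * of_real b^2 / 8) * ((2/3) * p^3 - 2 * p * P^2 + (1/9) * P^3)))"

definition nf_dS :: "real \<Rightarrow> real \<Rightarrow> complex \<times> complex \<Rightarrow> complex \<times> complex \<Rightarrow> complex \<times> complex" where
  "nf_dS b c z w = (let p = fst z; q = snd z; P = cnj p; Q = cnj q;
     a = fst w; k = snd w; A = cnj a; K = cnj k in
     (- (\<i> / 2) * K - (of_real b / 4) * ((4/3) * p * a + 4 * (a * P + p * A) - (4/9) * P * A),
      (\<i> / 2) * A - (of_real c / 8) * (- (3 * \<i> / 2) * p^2 * a + (3 * \<i> / 2) * (a * P^2 + 2 * p * P * A)
          + (3 * \<i> / 4) * P^2 * A)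
      + (of_real b / 2) * (2 * (a * q + p * k) + 2 * (a * Q + p * K) + (2/3) * (A * q + P * k) - (2/9) * (A * Q + P * K))
      - (\<i> * of_real b^2 / 8) * (2 * p^2 * a - 2 * (a * P^2 + 2 * p * P * A) + (1/3) * P^2 * A)))"

lemma nf_Phi1_eq: "(q + nf_T b p) - cnj (q + nf_T b p) = nf_Phi1 b (p, q)"
  unfolding nf_T_def nf_Phi1_def Let_def
  by (simp add: field_simps power2_eq_square)

text \<open>Differentiating \<open>q + nf_T b p\<close> produces \<open>nf_dT\<close> along
  \<open>nf_Phi1\<close>. Moved to the other side, it is the order-one debris of the first averaging
  step and the source of the cubic terms with \<open>b^2\<close>.\<close>

lemma nf_Phi2_eq:
  "p + cnj p - of_real c * ((p + cnj p) / 2)^3 - nf_dT b p (nf_Phi1 b (p, q)) = nf_Phi2 b c (p, q)"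
  unfolding nf_dT_def nf_Phi1_def nf_Phi2_def Let_def
  by (simp add: field_simps power2_eq_square power3_eq_cube)

text \<open>The left side multiplies a monomial \<open>p^j * cnj p ^ l\<close> by
  \<open>\<i> * (j - l - 1)\<close>. In degree two \<open>j - l\<close> is even, so there is no
  resonance; the coefficients of \<open>nf_T\<close> are those on the right divided by
  \<open>\<i>\<close>, \<open>- \<i>\<close>, \<open>- 3 * \<i>\<close>.\<close>

lemma nf_dT_homological:
  "nf_dT b p (\<i> * p) - \<i> * nf_T b p = of_real b * ((p + cnj p) / 2)^2"
  unfolding nf_dT_def nf_T_def by (simp add: field_simps power2_eq_square)

text \<open>The assumption normalizes the averaged cubic coefficient to \<open>2\<close>.\<close>

lemma nf_homological:
  assumes "3 / 8 * c + 19 / 18 * b^2 = 2"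
  shows "nf_dS b c z (cscale \<i> z) - cscale \<i> (nf_S b c z) = nf_Phi b c z - nf_avg z"
proof -
  have c: "complex_of_real c = (2 - 19 / 18 * of_real b ^ 2) * 8 / 3"
  proof -
    have "c = (2 - 19 / 18 * b ^ 2) * 8 / 3" using assms by (simp add: field_simps)
    then have "complex_of_real c = of_real ((2 - 19 / 18 * b ^ 2) * 8 / 3)" by (rule arg_cong)
    then show ?thesis by simp
  qed
  obtain p q where z: "z = (p, q)" by fastforce
  \<comment> \<open>A monomial that picks up \<open>e^m\<close> under rotation by \<open>e\<close>
    is multiplied by \<open>\<i> * (m - 1)\<close> on the left, so \<open>nf_S\<close> divides the
    coefficients of \<open>nf_Phi\<close> by this number. The monomials with \<open>m = 1\<close>
    remain and form \<open>nf_avg\<close>; for \<open>p^2 * cnj p\<close> the coefficient is minus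
    \<open>3/8 c + (76/9)/8 b^2\<close>.\<close>
  have "fst (nf_dS b c z (cscale \<i> z)) - \<i> * fst (nf_S b c z) = fst (nf_Phi b c z) - fst (nf_avg z)"
    unfolding z nf_dS_def nf_S_def nf_Phi_def nf_Phi1_def nf_avg_def cscale_def Let_def
    by (simp add: field_simps power2_eq_square)
  moreover have "snd (nf_dS b c z (cscale \<i> z)) - \<i> * snd (nf_S b c z) = snd (nf_Phi b c z) - snd (nf_avg z)"
    unfolding z nf_dS_def nf_S_def nf_Phi_def nf_Phi2_def nf_avg_def cscale_def Let_def c
    by (simp add: field_simps power2_eq_square power3_eq_cube)
  ultimately show ?thesis by (simp add: prod_eq_iff cscale_def)
qed

text \<open>Every term of the averaged field is resonant, so the fast phase drops out in the
  rotating frame and the averaged equation is autonomous.\<close>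

lemma nf_avg_cscale: "norm e = 1 \<Longrightarrow> nf_avg (cscale e z) = cscale e (nf_avg z)"
  using complex_norm_square[of e]
  by (simp add: nf_avg_def cscale_def prod_eq_iff algebra_simps power2_eq_square)

lemma nf_dS_add: "nf_dS b c z (w1 + w2) = nf_dS b c z w1 + nf_dS b c z w2"
  and nf_dS_scaleR: "nf_dS b c z (r *\<^sub>R w) = r *\<^sub>R nf_dS b c z w"
  unfolding nf_dS_def Let_def by (simp_all add: prod_eq_iff scaleR_conv_of_real algebra_simps add_divide_distrib)

lemma nf_S_has_derivative: "(nf_S b c has_derivative nf_dS b c z) (at z)"
proof -
  have S: "nf_S b c = (\<lambda>z. (fst (nf_S b c z), snd (nf_S b c z)))" by simp
  have dS: "nf_dS b c z = (\<lambda>w. (fst (nf_dS b c z w), snd (nf_dS b c z w)))" by simp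
  \<comment> \<open>Opaque names keep the differentiation rules from descending into the
    coefficients.\<close>
  define g1 g2 g3 g4 g5 g6 g7 g8 :: complex where g: "g1 = \<i> / 2" "g2 = of_real b / 4" "g3 = of_real c / 8"
    "g4 = 3 * \<i> / 2" "g5 = \<i> / 4" "g6 = of_real b / 2" "g7 = \<i> * of_real b^2 / 8" "g8 = 3 * \<i> / 4"
  have 8: "g8 = 3 * g5" "g4 = 3 * g1" by (simp_all add: g)
  have 1: "((\<lambda>z. fst (nf_S b c z)) has_derivative (\<lambda>w. fst (nf_dS b c z w))) (at z)"
    unfolding nf_S_def nf_dS_def Let_def fst_conv g[symmetric]
    by (rule has_derivative_eq_rhs, (rule has_derivative_const derivative_eq_intros refl)+)
       (simp add: fun_eq_iff algebra_simps power2_eq_square)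
  have 2: "((\<lambda>z. snd (nf_S b c z)) has_derivative (\<lambda>w. snd (nf_dS b c z w))) (at z)"
    unfolding nf_S_def nf_dS_def Let_def snd_conv g[symmetric] 8
    by (rule has_derivative_eq_rhs, (rule has_derivative_const derivative_eq_intros refl)+)
       (simp add: fun_eq_iff algebra_simps power2_eq_square)
  show ?thesis by (subst S, subst dS) (rule has_derivative_Pair[OF 1 2])
qed

lemma nf_T_has_derivative: "(nf_T b has_derivative nf_dT b p) (at p)"
  unfolding nf_T_def[abs_def]
  by (rule has_derivative_eq_rhs, (rule has_derivative_const derivative_eq_intros refl)+)
     (simp add: nf_dT_def fun_eq_iff algebra_simps power2_eq_square)

text \<open>The map \<open>(cnj A, - cnj C)\<close> is the reversor in amplitude variables.
  Commuting with it at phase \<open>0\<close>, the second averaging relation preserves the boundary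
  condition at \<open>t = 0\<close>.\<close>

lemma nf_S_reverse:
  "nf_S b c (cnj (fst z), - cnj (snd z)) = (cnj (fst (nf_S b c z)), - cnj (snd (nf_S b c z)))"
  unfolding nf_S_def Let_def by (simp add: algebra_simps)

lemma ulip_divide_const:
  fixes f :: "'p \<Rightarrow> 'a::real_normed_vector \<Rightarrow> 'b::real_normed_field"
  shows "ulip P \<rho> f \<Longrightarrow> ulip P \<rho> (\<lambda>p z. f p z / c)"
  unfolding divide_inverse by (intro ulip_mult ulip_const)

section \<open>The square root beyond its cubic Taylor polynomial\<close>

definition sqrt_rem :: "real \<Rightarrow> real" where
  "sqrt_rem s = s + 1 - sqrt (1 + 2 * s) - s^2 / 2 + s^3 / 2"

text \<open>In the variable \<open>t = sqrt (1 + 2 * s)\<close> the derivative contains the factor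
  \<open>(t - 1)^3\<close>. With \<open>\<bar>t - 1\<bar> \<le> 2 * \<bar>s\<bar>\<close> and a
  cofactor of at most \<open>38 / 4\<close> on \<open>1/2 \<le> t \<le> 2\<close>, the constant is
  \<open>8 * 19 / 2 = 76\<close>.\<close>

lemma sqrt_rem_has_derivative:
  assumes "\<bar>s\<bar> \<le> 1 / 4"
  shows "\<exists>D. (sqrt_rem has_real_derivative D) (at s) \<and> \<bar>D\<bar> \<le> 76 * \<bar>s\<bar> ^ 3"
proof -
  define t where "t = sqrt (1 + 2 * s)"
  have p: "1 + 2 * s \<ge> 1 / 4" "1 + 2 * s \<le> 4" using assms by (auto simp: abs_le_iff)
  have t2: "t^2 = 1 + 2 * s" unfolding t_def using p by simp
  have t: "1 / 2 \<le> t" "t \<le> 2"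
    using real_sqrt_le_mono[OF p(1)] real_sqrt_le_mono[OF p(2)] by (simp_all add: t_def real_sqrt_divide)
  define D where "D = 1 - 1 / t - s + 3 / 2 * s^2"
  have "(sqrt_rem has_real_derivative D) (at s)"
    unfolding sqrt_rem_def[abs_def] D_def t_def using p
    by (auto intro!: derivative_eq_intros simp: field_simps power2_eq_square)
  moreover have "D = (t - 1)^3 * ((3 * t^2 + 9 * t + 8) / (8 * t))"
  proof -
    have s: "s = (t^2 - 1) / 2" using t2 by simp
    show ?thesis unfolding D_def s using t
      by (simp add: field_simps power2_eq_square power3_eq_cube power4_eq_xxxx)
  qed
  moreover have "\<bar>t - 1\<bar> \<le> 2 * \<bar>s\<bar>"
  proof -
    have "2 * s = (t - 1) * (t + 1)" using t2 by (simp add: power2_eq_square algebra_simps)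
    then have "2 * \<bar>s\<bar> = \<bar>t - 1\<bar> * (t + 1)" using t by (metis abs_mult abs_numeral abs_of_nonneg add_nonneg_nonneg order_trans zero_le_divide_1_iff zero_le_numeral zero_le_one)
    then show ?thesis using mult_left_mono[of 1 "t + 1" "\<bar>t - 1\<bar>"] t by simp
  qed
  then have "\<bar>t - 1\<bar>^3 \<le> (2 * \<bar>s\<bar>)^3" by (rule power_mono) simp
  moreover have "\<bar>(3 * t^2 + 9 * t + 8) / (8 * t)\<bar> \<le> 19 / 2"
  proof -
    have "3 * t^2 + 9 * t + 8 \<le> 38" using t power_mono[of t 2 2] by simp
    then show ?thesis using t by (simp add: abs_of_pos field_simps)
  qed
  ultimately have "\<bar>D\<bar> \<le> (2 * \<bar>s\<bar>)^3 * (19 / 2)"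
    by (simp only: abs_mult power_abs[symmetric]) (rule mult_mono, auto)
  then show ?thesis using \<open>(sqrt_rem has_real_derivative D) (at s)\<close> by (auto simp: power_mult_distrib)
qed

lemma sqrt_rem_lipschitz:
  assumes "d \<le> 1 / 4" "\<bar>x\<bar> \<le> d" "\<bar>y\<bar> \<le> d"
  shows "\<bar>sqrt_rem x - sqrt_rem y\<bar> \<le> 76 * d^3 * \<bar>x - y\<bar>"
proof -
  define D where "D s = (SOME D. (sqrt_rem has_real_derivative D) (at s) \<and> \<bar>D\<bar> \<le> 76 * \<bar>s\<bar> ^ 3)" for s
  have D: "(sqrt_rem has_real_derivative D s) (at s)" "\<bar>D s\<bar> \<le> 76 * \<bar>s\<bar> ^ 3" if "\<bar>s\<bar> \<le> d" for s
  proof -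
    have "\<bar>s\<bar> \<le> 1 / 4" using that assms(1) by simp
    from someI_ex[OF sqrt_rem_has_derivative[OF this]]
    show "(sqrt_rem has_real_derivative D s) (at s)" "\<bar>D s\<bar> \<le> 76 * \<bar>s\<bar> ^ 3" unfolding D_def by auto
  qed
  have "norm (sqrt_rem x - sqrt_rem y) \<le> 76 * d^3 * norm (x - y)"
  proof (rule field_differentiable_bound[where S = "{-d..d}" and f' = D])
    fix s assume s: "s \<in> {-d..d}"
    then have "\<bar>s\<bar> \<le> d" by auto
    then show "(sqrt_rem has_field_derivative D s) (at s within {-d..d})"
      using D(1) has_field_derivative_at_within by blast
    have "\<bar>s\<bar>^3 \<le> d^3" using \<open>\<bar>s\<bar> \<le> d\<close> by (rule power_mono) simp
    then show "norm (D s) \<le> 76 * d^3" using D(2)[OF \<open>\<bar>s\<bar> \<le> d\<close>] by simp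
  qed (use assms in auto)
  then show ?thesis by simp
qed

text \<open>With \<open>s = \<mu> k v\<close>, \<open>2 \<mu>\<^sup>4 k residual\<close> is the difference between the nonlinearity
  \<open>(\<beta> - 4 \<mu>\<^sup>2) (s + 1 - sqrt (1 + 2 s))\<close> and \<open>\<beta> (s\<^sup>2 - s\<^sup>3) / 2\<close>, its Taylor polynomial at leading order in \<open>\<mu>\<close>.\<close>

definition residual :: "real \<Rightarrow> real \<Rightarrow> real \<Rightarrow> real \<Rightarrow> real" where
  "residual \<beta> k \<mu> v = (\<beta> - 4 * \<mu>^2) * sqrt_rem (\<mu> * k * v) / (2 * \<mu>^4 * k) - (k * v^2 - \<mu> * k^2 * v^3)"

lemma sqrt_rem_0 [simp]: "sqrt_rem 0 = 0" by (simp add: sqrt_rem_def)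

lemma residual_0 [simp]: "residual \<beta> k \<mu> 0 = 0" by (simp add: residual_def)

text \<open>The divisor \<open>\<mu>^4\<close> is compensated exactly: on arguments of size
  \<open>\<mu> k \<rho>\<close> the function \<open>sqrt_rem\<close> has a Lipschitz constant of
  order \<open>\<mu>^3\<close>, and the inner scaling supplies the fourth power. This is why the
  Taylor polynomial is split off up to degree three.\<close>

lemma ulip_residual:
  assumes "k > 0" "\<rho> > 0" "\<mu>1 * k * \<rho> \<le> 1 / 4" "\<mu>1 \<le> 1"
  shows "ulip {0<..\<mu>1} \<rho> (residual \<beta> k)"
proof -
  define B where "B = (\<bar>\<beta>\<bar> + 4) * (38 * k^3 * \<rho>^3)"
  have lip: "\<bar>(\<beta> - 4 * \<mu>^2) * sqrt_rem (\<mu> * k * v) / (2 * \<mu>^4 * k) - (\<beta> - 4 * \<mu>^2) * sqrt_rem (\<mu> * k * w) / (2 * \<mu>^4 * k)\<bar>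
     \<le> B * \<bar>v - w\<bar>" if "\<mu> \<in> {0<..\<mu>1}" "\<bar>v\<bar> \<le> \<rho>" "\<bar>w\<bar> \<le> \<rho>" for \<mu> v w
  proof -
    have \<mu>: "0 < \<mu>" "\<mu> \<le> \<mu>1" using that by auto
    have "\<mu> * k * \<rho> \<le> 1 / 4" using \<mu> assms by (meson mult_right_mono less_imp_le order_trans)
    moreover have "\<bar>\<mu> * k * v\<bar> \<le> \<mu> * k * \<rho>" "\<bar>\<mu> * k * w\<bar> \<le> \<mu> * k * \<rho>"
      using \<mu> assms that by (simp_all add: abs_mult)
    ultimately have "\<bar>sqrt_rem (\<mu> * k * v) - sqrt_rem (\<mu> * k * w)\<bar> \<le> 76 * (\<mu> * k * \<rho>)^3 * \<bar>\<mu> * k * v - \<mu> * k * w\<bar>"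
      by (rule sqrt_rem_lipschitz)
    also have "\<bar>\<mu> * k * v - \<mu> * k * w\<bar> = \<mu> * k * \<bar>v - w\<bar>"
      using \<mu> assms by (simp add: abs_mult flip: right_diff_distrib)
    also have "76 * (\<mu> * k * \<rho>)^3 * (\<mu> * k * \<bar>v - w\<bar>) = (2 * \<mu>^4 * k) * (38 * k^3 * \<rho>^3 * \<bar>v - w\<bar>)"
      by (simp add: power_mult_distrib power3_eq_cube power4_eq_xxxx)
    finally have 1: "\<bar>sqrt_rem (\<mu> * k * v) - sqrt_rem (\<mu> * k * w)\<bar> / (2 * \<mu>^4 * k) \<le> 38 * k^3 * \<rho>^3 * \<bar>v - w\<bar>"
      using \<mu> assms by (simp add: field_simps)
    have "\<mu>^2 \<le> 1" using \<mu> assms(4) by (simp add: power_le_one)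
    then have 2: "\<bar>\<beta> - 4 * \<mu>^2\<bar> \<le> \<bar>\<beta>\<bar> + 4" by (smt (verit) zero_le_power2)
    have "\<bar>\<beta> - 4 * \<mu>^2\<bar> * (\<bar>sqrt_rem (\<mu> * k * v) - sqrt_rem (\<mu> * k * w)\<bar> / (2 * \<mu>^4 * k))
      \<le> (\<bar>\<beta>\<bar> + 4) * (38 * k^3 * \<rho>^3 * \<bar>v - w\<bar>)"
      by (rule mult_mono[OF 2 1]) (use \<mu> assms in auto)
    also have "\<dots> = B * \<bar>v - w\<bar>" by (simp add: B_def)
    finally show ?thesis using \<mu> assms
      by (simp add: abs_mult flip: right_diff_distrib diff_divide_distrib)
  qed
  have B: "B \<ge> 0" using assms by (simp add: B_def)
  have "ulip {0<..\<mu>1} \<rho> (\<lambda>\<mu> v. (\<beta> - 4 * \<mu>^2) * sqrt_rem (\<mu> * k * v) / (2 * \<mu>^4 * k))"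
  proof (rule ulipI[where B = "B * \<rho>" and B' = B])
    show "norm ((\<beta> - 4 * \<mu>^2) * sqrt_rem (\<mu> * k * v) / (2 * \<mu>^4 * k)) \<le> B * \<rho>"
      if "\<mu> \<in> {0<..\<mu>1}" "norm v \<le> \<rho>" for \<mu> v
      using lip[of \<mu> v 0] that assms mult_left_mono[of "\<bar>v\<bar>" \<rho> B] B by simp
  qed (use lip in auto)
  moreover have "ulip {0<..\<mu>1} \<rho> (\<lambda>\<mu> v. k * v^2 - \<mu> * k^2 * v^3)"
    by (intro ulip_intros ulip_param[where B = \<mu>1]) auto
  ultimately show ?thesis unfolding residual_def[abs_def] by (rule ulip_diff)
qed

text \<open>The field \<open>f\<close> seen in the rotating frame \<open>z = e Z\<close> with
  \<open>e = cis (t / \<mu>)\<close>; the passage to this frame removes the singular linear term of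
  size \<open>1 / \<mu>\<close>.\<close>

definition rot :: "complex \<Rightarrow> (complex \<times> complex \<Rightarrow> complex \<times> complex) \<Rightarrow> complex \<times> complex \<Rightarrow> complex \<times> complex" where
  "rot e f z = cscale (cnj e) (f (cscale e z))"

lemma rot_lipschitz:
  assumes "norm e = 1" "norm z \<le> \<rho>" "norm w \<le> \<rho>"
    and "\<And>z w. norm z \<le> \<rho> \<Longrightarrow> norm w \<le> \<rho> \<Longrightarrow> norm (f z - f w) \<le> B * norm (z - w)"
  shows "norm (rot e f z - rot e f w) \<le> B * norm (z - w)"
  using assms(4)[of "cscale e z" "cscale e w"] assms(1-3)
  by (simp add: rot_def norm_cscale flip: cscale.diff_right)

definition G_rem where
  "G_rem \<beta> k \<mu> z = (0 :: complex, complex_of_real (residual \<beta> k \<mu> (Re (fst z))))" for z :: "complex \<times> complex"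

definition full_field where
  "full_field \<beta> k b c \<mu> z = nf_Phi b c z + \<mu> *\<^sub>R G_rem \<beta> k \<mu> z"

text \<open>The order-\<open>\<mu>\<close> error of the second averaging step: if \<open>Z\<close>
  moves by the full field in the rotating frame, then \<open>W = Z - \<mu> S(t, Z)\<close> has
  derivative \<open>nf_avg Z\<close> plus \<open>\<mu>\<close> times the rotated
  \<open>R_rem\<close>. The subtracted term comes from differentiating \<open>nf_S\<close> along the
  motion.\<close>

definition R_rem where
  "R_rem \<beta> k b c \<mu> z = G_rem \<beta> k \<mu> z - nf_dS b c z (full_field \<beta> k b c \<mu> z)"

lemma nf_Phi_0 [simp]: "nf_Phi b c 0 = 0"
  unfolding nf_Phi_def nf_Phi1_def nf_Phi2_def Let_def by (simp add: zero_prod_def)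

lemma G_rem_0 [simp]: "G_rem \<beta> k \<mu> 0 = 0"
  by (simp add: G_rem_def zero_prod_def)

lemma nf_dS_0 [simp]: "nf_dS b c z 0 = 0"
  using nf_dS_scaleR[of b c z 0 0] by simp

lemma R_rem_0 [simp]: "R_rem \<beta> k b c \<mu> 0 = 0"
  by (simp add: R_rem_def full_field_def)

lemma nf_S_0 [simp]: "nf_S b c 0 = 0"
  unfolding nf_S_def Let_def by (simp add: zero_prod_def)

lemma ulip_nf_S: "ulip P \<rho> (\<lambda>_. nf_S b c)"
  unfolding nf_S_def[abs_def] Let_def by (intro ulip_intros)

lemma ulip_G_rem:
  assumes "k > 0" "\<rho> > 0" "\<mu>1 * k * \<rho> \<le> 1 / 4" "\<mu>1 \<le> 1"
  shows "ulip {0<..\<mu>1} \<rho> (G_rem \<beta> k)"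
proof -
  have n: "\<bar>Re (fst z)\<bar> \<le> norm z" for z :: "complex \<times> complex"
    by (metis abs_Re_le_cmod norm_fst_le order_trans prod.collapse)
  obtain B where B: "\<And>p z. p \<in> {0<..\<mu>1} \<Longrightarrow> norm z \<le> \<rho> \<Longrightarrow> norm (residual \<beta> k p z) \<le> B" "B \<ge> 0"
    "\<And>p z w. p \<in> {0<..\<mu>1} \<Longrightarrow> norm z \<le> \<rho> \<Longrightarrow> norm w \<le> \<rho> \<Longrightarrow> norm (residual \<beta> k p z - residual \<beta> k p w) \<le> B * norm (z - w)"
    using ulip_residual[OF assms, of \<beta>] by (elim ulipE) blast
  have "ulip {0<..\<mu>1} \<rho> (\<lambda>\<mu> z :: complex \<times> complex. residual \<beta> k \<mu> (Re (fst z)))"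
  proof (rule ulipI[where B = B and B' = B])
    fix p and z w :: "complex \<times> complex" assume *: "p \<in> {0<..\<mu>1}" "norm z \<le> \<rho>" "norm w \<le> \<rho>"
    have "norm (residual \<beta> k p (Re (fst z)) - residual \<beta> k p (Re (fst w))) \<le> B * norm (Re (fst z) - Re (fst w))"
      by (rule B) (use * n[of z] n[of w] in auto)
    also have "\<dots> \<le> B * norm (z - w)" using n[of "z - w"] B(2) by (intro mult_left_mono) auto
    finally show "norm (residual \<beta> k p (Re (fst z)) - residual \<beta> k p (Re (fst w))) \<le> B * norm (z - w)" .
  next
    fix p and z :: "complex \<times> complex" assume "p \<in> {0<..\<mu>1}" "norm z \<le> \<rho>"
    then show "norm (residual \<beta> k p (Re (fst z))) \<le> B" using n[of z] by (intro B) auto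
  qed
  then show ?thesis unfolding G_rem_def[abs_def] by (intro ulip_intros)
qed

lemma ulip_R_rem:
  assumes "k > 0" "\<rho> > 0" "\<mu>1 * k * \<rho> \<le> 1 / 4" "\<mu>1 \<le> 1"
  shows "ulip {0<..\<mu>1} \<rho> (R_rem \<beta> k b c)"
proof -
  note G = ulip_G_rem[OF assms]
  have "ulip {0<..\<mu>1} \<rho> (\<lambda>\<mu> z. nf_Phi b c z)"
    unfolding nf_Phi_def[abs_def] nf_Phi1_def nf_Phi2_def Let_def by (intro ulip_intros ulip_divide_const)
  moreover have "ulip {0<..\<mu>1} \<rho> (\<lambda>\<mu> z. \<mu> *\<^sub>R G_rem \<beta> k \<mu> z)"
  proof -
    have "ulip {0<..\<mu>1} \<rho> (\<lambda>\<mu> z. (of_real \<mu> * fst (G_rem \<beta> k \<mu> z), of_real \<mu> * snd (G_rem \<beta> k \<mu> z)))"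
      by (intro ulip_intros G ulip_param[where B = \<mu>1]) auto
    then show ?thesis by (simp add: scaleR_prod_def scaleR_conv_of_real)
  qed
  ultimately have "ulip {0<..\<mu>1} \<rho> (full_field \<beta> k b c)"
    unfolding full_field_def[abs_def] by (rule ulip_add)
  then have "ulip {0<..\<mu>1} \<rho> (\<lambda>\<mu> z. nf_dS b c z (full_field \<beta> k b c \<mu> z))"
    unfolding nf_dS_def[abs_def] Let_def by (intro ulip_intros)
  then show ?thesis unfolding R_rem_def[abs_def] by (intro ulip_diff G)
qed

lemma nf_dS_bound:
  obtains B where "B \<ge> 0" "\<And>z w. norm z \<le> \<rho> \<Longrightarrow> norm (nf_dS b c z w) \<le> B * norm w"
proof -
  have n: "norm (fst w) \<le> norm w" "norm (snd w) \<le> norm w" for w :: "complex \<times> complex"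
    by (metis norm_fst_le prod.collapse) (metis norm_snd_le prod.collapse)
  \<comment> \<open>The direction \<open>w\<close> is taken as the parameter, ranging over the unit
    ball; homogeneity in \<open>w\<close> then gives the linear bound.\<close>
  have "ulip (cball 0 1) \<rho> (\<lambda>w z. nf_dS b c z w)"
    unfolding nf_dS_def[abs_def] Let_def
    by (intro ulip_intros ulip_param[where B = 1]) (auto intro: order_trans[OF n(1)] order_trans[OF n(2)])
  then obtain B where B: "B \<ge> 0" "\<And>w z. w \<in> cball 0 1 \<Longrightarrow> norm z \<le> \<rho> \<Longrightarrow> norm (nf_dS b c z w) \<le> B"
    by (elim ulipE) blast
  show ?thesis
  proof (rule that[OF B(1)])
    fix z w :: "complex \<times> complex" assume z: "norm z \<le> \<rho>"
    show "norm (nf_dS b c z w) \<le> B * norm w"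
    proof (cases "w = 0")
      case True
      then show ?thesis by simp
    next
      case False
      have "nf_dS b c z w = norm w *\<^sub>R nf_dS b c z (w /\<^sub>R norm w)"
        using False by (simp flip: nf_dS_scaleR)
      also have "norm \<dots> = norm w * norm (nf_dS b c z (w /\<^sub>R norm w))" by simp
      also have "\<dots> \<le> norm w * B" using B(2)[of "w /\<^sub>R norm w" z] z False by (intro mult_left_mono) auto
      finally show ?thesis by (simp add: mult.commute)
    qed
  qed
qed

section \<open>Homoclinics of the slow system\<close>

definition sech_orbit :: "real \<Rightarrow> real \<Rightarrow> complex \<times> complex" where
  "sech_orbit \<sigma> t = (of_real (\<sigma> * sech_r t), of_real (\<sigma> * sech_r' t))"

definition avg_quad :: "real \<Rightarrow> real \<Rightarrow> complex \<times> complex \<Rightarrow> complex \<times> complex" where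
  "avg_quad \<sigma> t z = (0, - 2 * (of_real (\<sigma> * sech_r t) * (fst z)^2 + 2 * of_real (\<sigma> * sech_r t) * fst z * cnj (fst z)
      + (fst z)^2 * cnj (fst z)))"

lemma norm_fst_snd_le:
  "norm (fst w) \<le> norm w" "norm (snd w) \<le> norm w" for w :: "'a::real_normed_vector \<times> 'b::real_normed_vector"
  by (metis norm_fst_le prod.collapse) (metis norm_snd_le prod.collapse)

context
  fixes \<sigma> :: real
  assumes \<sigma>: "\<sigma>^2 = 1"
begin

lemma abs_sigma: "\<bar>\<sigma>\<bar> = 1"
  using \<sigma> by (metis abs_1 power2_eq_1_iff abs_minus_cancel)

lemma sech_orbit_bound: "t \<ge> 0 \<Longrightarrow> norm (sech_orbit \<sigma> t) \<le> 4 * exp (- (t / 2))"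
proof -
  assume t: "t \<ge> 0"
  note b = exp_cosh_bounds[OF t]
  have c: "cosh t \<ge> 1" by (rule cosh_real_ge_1)
  have "\<bar>sech_r t\<bar> \<le> 2 * exp (- t)" using b c by (simp add: sech_r_def)
  moreover have "\<bar>sech_r' t\<bar> \<le> 1 / cosh t"
    using b c by (simp add: sech_r'_def sech_p_def power2_eq_square divide_simps)
  then have "\<bar>sech_r' t\<bar> \<le> 2 * exp (- t)" using b by linarith
  moreover have "exp (- t) \<le> exp (- (t / 2))" using t by simp
  moreover have "norm (sech_orbit \<sigma> t) \<le> \<bar>sech_r t\<bar> + \<bar>sech_r' t\<bar>"
    unfolding sech_orbit_def by (rule order_trans[OF norm_Pair_le]) (simp add: norm_mult abs_sigma)
  ultimately show ?thesis by linarith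
qed

lemma sech_orbit_deriv:
  assumes "t \<ge> 0"
  shows "(sech_orbit \<sigma> has_vector_derivative nf_avg (sech_orbit \<sigma> t)) (at t within {0..})"
proof -
  have 1: "((\<lambda>t. complex_of_real (\<sigma> * sech_r t)) has_vector_derivative of_real (\<sigma> * sech_r' t)) (at t within {0..})"
    by (intro has_vector_derivative_of_real)
       (auto intro!: derivative_eq_intros im_part.deriv assms simp flip: has_real_derivative_iff_has_vector_derivative)
  have 2: "((\<lambda>t. complex_of_real (\<sigma> * sech_r' t)) has_vector_derivative
     of_real (\<sigma> * ((1 - 2 / cosh t ^ 2) * sech_r t))) (at t within {0..})"
    by (intro has_vector_derivative_of_real)
       (auto intro!: derivative_eq_intros im_part.deriv assms simp flip: has_real_derivative_iff_has_vector_derivative)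
  have "\<sigma> * ((1 - 2 / cosh t ^ 2) * sech_r t) = \<sigma> * sech_r t - 2 * (\<sigma> * sech_r t)^2 * (\<sigma> * sech_r t)"
  proof -
    have "sech_r t ^ 2 = 1 / cosh t ^ 2" by (simp add: sech_r_def power_divide)
    then show ?thesis using \<sigma> by (simp add: power_mult_distrib algebra_simps)
  qed
  then have "(of_real (\<sigma> * sech_r' t), of_real (\<sigma> * ((1 - 2 / cosh t ^ 2) * sech_r t))) = nf_avg (sech_orbit \<sigma> t)"
    by (simp only: nf_avg_def sech_orbit_def fst_conv snd_conv complex_cnj_complex_of_real) simp
  then show ?thesis
    using has_vector_derivative_Pair[OF 1 2] unfolding sech_orbit_def[abs_def] by simp
qed

lemma sech_lin_eq:
  "sech_lin t z = (snd z, fst z - 2 * (2 * (of_real (\<sigma> * sech_r t))^2 * fst z + (of_real (\<sigma> * sech_r t))^2 * cnj (fst z)))"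
proof -
  have s: "(\<sigma> * sech_r t)^2 = 1 / cosh t ^ 2"
    using \<sigma> by (simp add: sech_r_def power_mult_distrib power_divide)
  show ?thesis
    unfolding sech_lin_def of_real_power[symmetric] s
    by (simp add: complex_eq_iff algebra_simps)
qed

lemma nf_avg_expand:
  "nf_avg (sech_orbit \<sigma> t + z) = nf_avg (sech_orbit \<sigma> t) + sech_lin t z + avg_quad \<sigma> t z"
  unfolding sech_lin_eq nf_avg_def sech_orbit_def avg_quad_def
  by (simp add: algebra_simps power2_eq_square del: of_real_mult)

text \<open>Every monomial of \<open>avg_quad\<close> has degree at least two, so a factor
  \<open>r\<close> remains after a difference is extracted. The five terms of \<open>X\<close>
  contribute \<open>2 + 2 + 2 + 2 + 1 = 9\<close>, doubled by the factor \<open>- 2\<close>.\<close>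

lemma avg_quad_lipschitz:
  assumes t: "t \<ge> 0" and r: "norm z \<le> r" "norm w \<le> r" "r \<le> 1"
  shows "norm (avg_quad \<sigma> t z - avg_quad \<sigma> t w) \<le> 18 * r * norm (z - w)"
proof -
  define a where "a = complex_of_real (\<sigma> * sech_r t)"
  define x where "x = fst z"
  define y where "y = fst w"
  have a: "norm a \<le> 1" using cosh_real_ge_1[of t]
    unfolding a_def norm_of_real abs_mult abs_sigma by (simp add: sech_r_def)
  have x: "norm x \<le> r" "norm y \<le> r" and xy: "norm (x - y) \<le> norm (z - w)"
    using r norm_fst_snd_le(1)[of z] norm_fst_snd_le(1)[of w] norm_fst_snd_le(1)[of "z - w"]
    by (auto simp: x_def y_def)
  have r0: "0 \<le> r" using r norm_ge_zero order_trans by blast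
  define X where "X = (a * (x + y) * (x - y)) + (2 * a * cnj x * (x - y) + 2 * a * y * cnj (x - y))
      + (cnj x * (x + y) * (x - y) + y^2 * cnj (x - y))"
  have e: "avg_quad \<sigma> t z - avg_quad \<sigma> t w = (0, - 2 * X)"
    unfolding X_def avg_quad_def a_def[symmetric] x_def[symmetric] y_def[symmetric]
    by (simp add: algebra_simps power2_eq_square)
  define n where "n = norm (x - y)"
  have n0: "0 \<le> n" by (simp add: n_def)
  have s: "norm (x + y) \<le> 2 * r" using x norm_triangle_ineq[of x y] by simp
  have "norm (a * (x + y) * (x - y)) \<le> (1 * (2 * r)) * n"
    unfolding norm_mult n_def[symmetric] by (intro mult_mono a s) (use r0 n0 in auto)
  moreover have "norm (2 * a * cnj x * (x - y)) \<le> (2 * 1 * r) * n" "norm (2 * a * y * cnj (x - y)) \<le> (2 * 1 * r) * n"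
    unfolding norm_mult complex_mod_cnj n_def[symmetric] by (intro mult_mono a x; use r0 n0 in auto)+
  moreover have "norm (cnj x * (x + y) * (x - y)) \<le> (1 * (2 * r)) * n"
    unfolding norm_mult complex_mod_cnj n_def[symmetric] by (intro mult_mono s) (use r0 n0 x r in auto)
  moreover have "norm (y^2 * cnj (x - y)) \<le> (1 * r) * n"
    unfolding norm_mult complex_mod_cnj n_def[symmetric] power2_eq_square by (intro mult_mono x) (use r0 n0 x r in auto)
  ultimately have "norm ((a * (x + y) * (x - y)) + (2 * a * cnj x * (x - y) + 2 * a * y * cnj (x - y))
      + (cnj x * (x + y) * (x - y) + y^2 * cnj (x - y))) \<le> (2 * r) * n + (2 * r * n + 2 * r * n) + (2 * r * n + r * n)"
    by (intro norm_triangle_mono) simp_all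
  then have X: "norm X \<le> 9 * (r * n)" unfolding X_def by (simp add: mult.commute)
  have "norm (avg_quad \<sigma> t z - avg_quad \<sigma> t w) = 2 * norm X"
    unfolding e by (simp add: norm_Pair norm_mult real_sqrt_mult)
  also have "\<dots> \<le> 2 * (9 * (r * n))" using X by linarith
  also have "\<dots> \<le> 18 * r * norm (z - w)" using mult_left_mono[OF xy, of "18 * r"] r0 by (simp add: n_def)
  finally show ?thesis .
qed

end

lemma sech_lin_diff: "sech_lin t (z - w) = sech_lin t z - sech_lin t w"
  by (simp add: sech_lin_def prod_eq_iff complex_eq_iff distrib_left right_diff_distrib)

lemma sech_lin_0 [simp]: "sech_lin t 0 = 0"
  by (simp add: sech_lin_def zero_prod_def complex_eq_iff)

lemma sech_lin_bound: "norm (sech_lin t z) \<le> 8 * norm z"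
proof -
  have c: "cosh t ^ 2 \<ge> 1" using cosh_real_ge_1[of t] by simp
  then have d: "1 / cosh t ^ 2 \<le> 1" "0 \<le> 1 / cosh t ^ 2" by (simp_all add: divide_le_eq_1)
  have 1: "\<bar>1 - 6 / cosh t ^ 2\<bar> \<le> 5" "\<bar>1 - 2 / cosh t ^ 2\<bar> \<le> 2"
    by (rule abs_leI; use d in argo)+
  have n: "\<bar>Re (fst z)\<bar> \<le> norm z" "\<bar>Im (fst z)\<bar> \<le> norm z"
    using abs_Re_le_cmod[of "fst z"] abs_Im_le_cmod[of "fst z"] norm_fst_snd_le(1)[of z] by linarith+
  have "norm (sech_lin t z) \<le> norm (snd z) + (\<bar>(1 - 6 / cosh t ^ 2) * Re (fst z)\<bar> + \<bar>(1 - 2 / cosh t ^ 2) * Im (fst z)\<bar>)"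
    unfolding sech_lin_def by (rule order_trans[OF norm_Pair_le add_left_mono[OF order_trans[OF cmod_le]]]) simp
  also have "\<dots> \<le> norm z + (5 * norm z + 2 * norm z)"
    unfolding abs_mult by (intro add_mono mult_mono 1 n norm_fst_snd_le) auto
  finally show ?thesis by simp
qed

section \<open>Continuity in time of the composed fields\<close>

lemma continuous_on_cscale:
  "continuous_on A f \<Longrightarrow> continuous_on A g \<Longrightarrow> continuous_on A (\<lambda>t. cscale (f t) (g t))"
  by (rule cscale.continuous_on)

lemma continuous_on_nf_S: "continuous_on A f \<Longrightarrow> continuous_on A (\<lambda>t. nf_S b c (f t))"
  unfolding nf_S_def Let_def by (intro continuous_intros) auto

lemma continuous_on_cis_scaled: "continuous_on A (\<lambda>t. cis (t / \<mu>))"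
  by (rule continuous_on_vector_derivative[OF has_vector_derivative_cis_scaled])

lemma continuous_on_rot:
  assumes "\<And>f. continuous_on A f \<Longrightarrow> continuous_on A (\<lambda>t. g (f t))" "continuous_on A f"
  shows "continuous_on A (\<lambda>t. rot (cis (t / \<mu>)) g (f t))"
  unfolding rot_def by (intro continuous_on_cscale assms continuous_on_cnj continuous_on_cis_scaled)

lemma continuous_on_residual: "continuous_on A f \<Longrightarrow> continuous_on A (\<lambda>t. residual \<beta> k \<mu> (f t))"
  unfolding residual_def sqrt_rem_def divide_inverse by (intro continuous_intros)

lemma continuous_on_G_rem: "continuous_on A f \<Longrightarrow> continuous_on A (\<lambda>t. G_rem \<beta> k \<mu> (f t))"
  unfolding G_rem_def by (intro continuous_intros continuous_on_residual)

lemma continuous_on_R_rem: "continuous_on A f \<Longrightarrow> continuous_on A (\<lambda>t. R_rem \<beta> k b c \<mu> (f t))"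
  unfolding R_rem_def full_field_def nf_dS_def nf_Phi_def nf_Phi1_def nf_Phi2_def Let_def
  by (intro continuous_intros continuous_on_G_rem) auto

lemma continuous_on_sech_lin: "continuous_on A f \<Longrightarrow> continuous_on A (\<lambda>t. sech_lin t (f t))"
  unfolding sech_lin_def Complex_eq by (intro continuous_intros) auto

lemma continuous_on_avg_quad: "continuous_on A f \<Longrightarrow> continuous_on A (\<lambda>t. avg_quad \<sigma> t (f t))"
  unfolding avg_quad_def sech_r_def by (intro continuous_intros) auto

lemma rot_0: "f 0 = 0 \<Longrightarrow> rot e f 0 = 0"
  by (simp add: rot_def cscale.zero_right)

text \<open>The phase turns at rate \<open>1 / \<mu>\<close>, which cancels the prefactor
  \<open>\<mu>\<close>. The homological equation then makes the time derivative exactly the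
  oscillating part of the field, \<open>nf_Phi\<close> minus its average, while the space derivative
  stays of order \<open>\<mu>\<close>.\<close>

lemma rot_nf_S_has_derivative:
  assumes bc: "3 / 8 * c + 19 / 18 * b^2 = 2" and \<mu>: "\<mu> \<noteq> 0"
  shows "((\<lambda>x. \<mu> *\<^sub>R rot (cis (fst x / \<mu>)) (nf_S b c) (snd x)) has_derivative
     (\<lambda>w. fst w *\<^sub>R (rot (cis (t / \<mu>)) (nf_Phi b c) z - nf_avg z)
        + \<mu> *\<^sub>R cscale (cnj (cis (t / \<mu>))) (nf_dS b c (cscale (cis (t / \<mu>)) z) (cscale (cis (t / \<mu>)) (snd w)))))
     (at (t, z))"
proof -
  define e where "e = cis (t / \<mu>)"
  have e: "cnj e * e = 1" "e * cnj e = 1" "norm e = 1"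
    unfolding e_def by (simp_all add: cis_cnj cis_mult)
  have e1: "((\<lambda>x. cis (fst x / \<mu>)) has_derivative (\<lambda>w. (fst w / \<mu>) *\<^sub>R (\<i> * e))) (at (t, z))"
    using \<mu> unfolding e_def by (auto intro!: derivative_eq_intros)
  have e2: "((\<lambda>x. cnj (cis (fst x / \<mu>))) has_derivative (\<lambda>w. cnj ((fst w / \<mu>) *\<^sub>R (\<i> * e)))) (at (t, z))"
    using e1 by (rule has_derivative_cnj)
  have z1: "((\<lambda>x. cscale (cis (fst x / \<mu>)) (snd x)) has_derivative
     (\<lambda>w. cscale e (snd w) + cscale ((fst w / \<mu>) *\<^sub>R (\<i> * e)) z)) (at (t, z))"
    using cscale.FDERIV[OF e1 has_derivative_snd[OF has_derivative_ident]] by (simp add: e_def)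
  have S: "((\<lambda>x. nf_S b c (cscale (cis (fst x / \<mu>)) (snd x))) has_derivative
     (\<lambda>w. nf_dS b c (cscale e z) (cscale e (snd w) + cscale ((fst w / \<mu>) *\<^sub>R (\<i> * e)) z))) (at (t, z))"
    using has_derivative_compose[OF z1, of "nf_S b c" "nf_dS b c (cscale e z)"] nf_S_has_derivative
    by (simp add: e_def)
  have eq: "\<mu> *\<^sub>R (cscale (cnj e) (nf_dS b c (cscale e z) (cscale e (snd w) + cscale ((fst w / \<mu>) *\<^sub>R (\<i> * e)) z))
       + cscale (cnj ((fst w / \<mu>) *\<^sub>R (\<i> * e))) (nf_S b c (cscale e z))) =
     fst w *\<^sub>R (rot e (nf_Phi b c) z - nf_avg z) + \<mu> *\<^sub>R cscale (cnj e) (nf_dS b c (cscale e z) (cscale e (snd w)))" for w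
  proof -
    have 1: "cscale ((fst w / \<mu>) *\<^sub>R (\<i> * e)) z = (fst w / \<mu>) *\<^sub>R cscale \<i> (cscale e z)"
      by (simp add: cscale.scaleR_left)
    have 2: "cscale (cnj ((fst w / \<mu>) *\<^sub>R (\<i> * e))) (nf_S b c (cscale e z)) =
       (fst w / \<mu>) *\<^sub>R cscale (cnj e) (- cscale \<i> (nf_S b c (cscale e z)))"
      by (simp add: cscale_def prod_eq_iff scaleR_conv_of_real)
    have "rot e (nf_Phi b c) z - nf_avg z = cscale (cnj e) (nf_Phi b c (cscale e z) - nf_avg (cscale e z))"
      using nf_avg_cscale[OF e(3), of z] by (simp add: rot_def cscale.diff_right e)
    also have "\<dots> = cscale (cnj e) (nf_dS b c (cscale e z) (cscale \<i> (cscale e z))) + cscale (cnj e) (- cscale \<i> (nf_S b c (cscale e z)))"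
      unfolding nf_homological[OF bc, symmetric] by (simp add: cscale.diff_right cscale.minus_right)
    finally show ?thesis
      unfolding 1 2 nf_dS_add nf_dS_scaleR using \<mu> by (simp add: cscale.add_right cscale.scaleR_right scaleR_add_right)
  qed
  have "((\<lambda>x. \<mu> *\<^sub>R rot (cis (fst x / \<mu>)) (nf_S b c) (snd x)) has_derivative
      (\<lambda>w. \<mu> *\<^sub>R (cscale (cnj e) (nf_dS b c (cscale e z) (cscale e (snd w) + cscale ((fst w / \<mu>) *\<^sub>R (\<i> * e)) z))
       + cscale (cnj ((fst w / \<mu>) *\<^sub>R (\<i> * e))) (nf_S b c (cscale e z))))) (at (t, z))"
    unfolding rot_def
    using has_derivative_scaleR_right[OF cscale.FDERIV[OF e2 S], of \<mu>] by (simp add: e_def)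
  then show ?thesis unfolding eq by (simp add: e_def)
qed

text \<open>Write \<open>Z\<close> as the sech orbit plus \<open>\<zeta>\<close> and
  \<open>W = Z - S t Z\<close>. Then \<open>W' = nf_avg Z\<close> up to order \<open>\<mu>\<close>,
  and expanding \<open>nf_avg\<close> about the sech orbit turns \<open>W\<close> minus this orbit
  into \<open>solveK\<close> of a forcing in \<open>\<zeta>\<close>. This is a fixed point equation
  for \<open>\<zeta>\<close>, with constants independent of the phase.\<close>

lemma slow_existence:
  assumes bc: "3 / 8 * c + 19 / 18 * b^2 = 2" and k: "k > 0"
  shows "\<exists>\<mu>0>0. \<forall>\<mu> \<sigma>. 0 < \<mu> \<longrightarrow> \<mu> < \<mu>0 \<longrightarrow> \<sigma>^2 = 1 \<longrightarrow>
    (\<exists>Z. (\<forall>t\<ge>0. (Z has_vector_derivative rot (cis (t / \<mu>)) (full_field \<beta> k b c \<mu>) (Z t)) (at t within {0..}) \<and>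
          norm (Z t - sech_orbit \<sigma> t) \<le> 1 / 100000 * exp (- (t / 2))) \<and>
        Im (fst (Z 0)) = 0 \<and> Re (snd (Z 0)) = 0)"
proof -
  define \<mu>1 where "\<mu>1 = min 1 (1 / (20 * k))"
  have \<mu>1: "\<mu>1 > 0" "\<mu>1 \<le> 1" "\<mu>1 * k * 5 \<le> 1 / 4" using k by (auto simp: \<mu>1_def min_def field_simps)
  obtain BR where BR: "BR \<ge> 0" "\<And>\<mu> z w. \<mu> \<in> {0<..\<mu>1} \<Longrightarrow> norm z \<le> 5 \<Longrightarrow> norm w \<le> 5 \<Longrightarrow>
      norm (R_rem \<beta> k b c \<mu> z - R_rem \<beta> k b c \<mu> w) \<le> BR * norm (z - w)"
    using ulip_R_rem[OF k _ \<mu>1(3,2), of \<beta> b c, simplified] by (elim ulipE) auto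
  obtain BS where BS: "BS \<ge> 0" "\<And>z w. norm z \<le> 5 \<Longrightarrow> norm w \<le> 5 \<Longrightarrow>
      norm (nf_S b c z - nf_S b c w) \<le> BS * norm (z - w)"
    using ulip_nf_S[of "UNIV :: unit set" 5 b c] by (elim ulipE) auto
  obtain BD where BD: "BD \<ge> 0" "\<And>z w. norm z \<le> 5 \<Longrightarrow> norm (nf_dS b c z w) \<le> BD * norm w"
    using nf_dS_bound[of 5 b c] by blast
  define B where "B = 9 * BS + BR + BD + 1"
  \<comment> \<open>The quadratic term enters the contraction with
    \<open>1536 * 18 * r < 0.28\<close>. With \<open>\<mu> * B \<le> r / 20000\<close> the rest fits
    below \<open>1/2\<close>, and \<open>1537 * 4 / 20000 < 1/2\<close> makes the ball
    invariant.\<close>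
  define r where "r = (1 / 100000 :: real)"
  define \<mu>0 where "\<mu>0 = min \<mu>1 (r / (20000 * B))"
  have B: "B \<ge> 1" "BS \<le> B" "BD \<le> B" "8 * BS + BR \<le> B" using BR BS BD by (auto simp: B_def)
  have \<mu>0: "\<mu>0 > 0" using \<mu>1 B by (simp add: \<mu>0_def r_def)
  show ?thesis
  proof (intro exI[of _ \<mu>0] conjI allI impI \<mu>0)
    fix \<mu> \<sigma> :: real
    assume \<mu>: "0 < \<mu>" "\<mu> < \<mu>0" and \<sigma>: "\<sigma>^2 = 1"
    have \<mu>m: "\<mu> \<in> {0<..\<mu>1}" using \<mu> by (auto simp: \<mu>0_def)
    have \<mu>B: "20000 * (\<mu> * B) \<le> r" using \<mu> B by (simp add: \<mu>0_def field_simps)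
    define E where "E t = cis (t / \<mu>)" for t
    have E: "norm (E t) = 1" "cnj (E t) * E t = 1" "norm (cnj (E t)) = 1" for t
      unfolding E_def by (simp_all add: cis_cnj cis_mult)
    define Z0 where "Z0 = sech_orbit \<sigma>"
    define S where "S t z = \<mu> *\<^sub>R rot (E t) (nf_S b c) z" for t z
    \<comment> \<open>The linearization acts on \<open>\<zeta>\<close>, but \<open>solveK\<close>
      governs \<open>\<zeta>\<close> minus the averaging term \<open>S\<close>; the first summand
      makes up for the difference.\<close>
    define R where "R t z = sech_lin t (S t z) + \<mu> *\<^sub>R rot (E t) (R_rem \<beta> k b c \<mu>) z" for t z
    have S_lip: "norm (S t z - S t w) \<le> \<mu> * BS * norm (z - w)" if "norm z \<le> 5" "norm w \<le> 5" for t z w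
      using mult_left_mono[OF rot_lipschitz[OF E(1)[of t] that BS(2)], of \<mu>] \<mu>
      by (simp add: S_def mult.assoc flip: scaleR_diff_right)
    have R_lip: "norm (R t z - R t w) \<le> \<mu> * B * norm (z - w)" if "norm z \<le> 5" "norm w \<le> 5" for t z w
    proof -
      have "norm (rot (E t) (R_rem \<beta> k b c \<mu>) z - rot (E t) (R_rem \<beta> k b c \<mu>) w) \<le> BR * norm (z - w)"
        by (rule rot_lipschitz[OF E(1) that BR(2)[OF \<mu>m]])
      from mult_left_mono[OF this, of \<mu>] have 1: "norm (\<mu> *\<^sub>R rot (E t) (R_rem \<beta> k b c \<mu>) z - \<mu> *\<^sub>R rot (E t) (R_rem \<beta> k b c \<mu>) w)
          \<le> \<mu> * BR * norm (z - w)"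
        using \<mu> by (simp add: mult.assoc flip: scaleR_diff_right)
      have 2: "norm (sech_lin t (S t z) - sech_lin t (S t w)) \<le> 8 * (\<mu> * BS * norm (z - w))"
        unfolding sech_lin_diff[symmetric]
        by (rule order_trans[OF sech_lin_bound]) (use S_lip[OF that] in simp)
      have "norm (R t z - R t w) \<le> 8 * (\<mu> * BS * norm (z - w)) + \<mu> * BR * norm (z - w)"
        unfolding R_def using 1 2 by (metis add_diff_add norm_triangle_mono)
      also have "\<dots> = (8 * BS + BR) * (\<mu> * norm (z - w))" by (simp add: algebra_simps)
      also have "\<dots> \<le> B * (\<mu> * norm (z - w))" using B(4) \<mu> by (intro mult_right_mono) auto
      finally show ?thesis by (simp add: mult_ac)
    qed
    have S_lipB: "norm (S t z - S t w) \<le> \<mu> * B * norm (z - w)" if "norm z \<le> 5" "norm w \<le> 5" for t z w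
      using order_trans[OF S_lip[OF that] mult_right_mono[of "\<mu> * BS" "\<mu> * B"]] \<mu> B(2) by simp
    have S_cont: "continuous_on {0..} (\<lambda>t. S t (z t))" if "continuous_on {0..} z" for z
      unfolding S_def E_def using that by (intro continuous_intros continuous_on_rot continuous_on_nf_S)
    have R_cont: "continuous_on {0..} (\<lambda>t. R t (z t))" if "continuous_on {0..} z" for z
      unfolding R_def E_def using that
      by (intro continuous_intros continuous_on_sech_lin S_cont continuous_on_rot continuous_on_R_rem)
    have Z0_cont: "continuous_on {0..} Z0"
      unfolding Z0_def by (rule continuous_on_vector_derivative[OF sech_orbit_deriv[OF \<sigma>]]) auto
    have "\<exists>\<zeta>. continuous_on {0..} \<zeta> \<and> (\<forall>t\<ge>0. norm (\<zeta> t) \<le> r * exp (- (t / 2)) \<and>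
       \<zeta> t = S t (Z0 t + \<zeta> t) + solveK (\<lambda>t. avg_quad \<sigma> t (\<zeta> t) + R t (Z0 t + \<zeta> t)) t)"
    proof (rule weighted_fixed_point[where CK = 1536 and ?C0.0 = 4 and \<rho> = 5 and LQ = "18 * r" and L = "\<mu> * B"])
      show "continuous_on {0..} (solveK h)"
        if "continuous_on {0..} h" "\<And>t. t \<ge> 0 \<Longrightarrow> norm (h t) \<le> N * exp (- (t / 2))" for h N
        by (rule continuous_on_vector_derivative[OF solveK_deriv[OF that]]) auto
      show "1536 * (18 * r + \<mu> * B) + \<mu> * B \<le> 1 / 2" "(1536 * (\<mu> * B) + \<mu> * B) * 4 \<le> r / 2"
        using \<mu>B mult_nonneg_nonneg[of \<mu> B] \<mu> B by (simp_all add: r_def mult.commute)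
      show "solveK (\<lambda>t. h t - g t) t = solveK h t - solveK g t" if "continuous_on {0..} h"
        "\<And>t. t \<ge> 0 \<Longrightarrow> norm (h t) \<le> N * exp (- (t / 2))" "continuous_on {0..} g"
        "\<And>t. t \<ge> 0 \<Longrightarrow> norm (g t) \<le> M * exp (- (t / 2))" "t \<ge> 0" for h g N M t
        by (rule solveK_diff[OF that])
      show "S t 0 = 0" "R t 0 = 0" for t by (simp_all add: S_def R_def rot_0)
      show "norm (avg_quad \<sigma> t z - avg_quad \<sigma> t w) \<le> 18 * r * norm (z - w)"
        if "t \<ge> 0" "norm z \<le> r" "norm w \<le> r" for t z w
        by (rule avg_quad_lipschitz[OF \<sigma> that]) (simp add: r_def)
      show "norm (Z0 t) \<le> 4 * exp (- (t / 2))" if "t \<ge> 0" for t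
        unfolding Z0_def by (rule sech_orbit_bound[OF \<sigma> that])
      show "0 \<le> \<mu> * B" using \<mu> B by simp
      show "avg_quad \<sigma> t 0 = 0" for t by (simp add: avg_quad_def zero_prod_def)
    qed (use solveK_bound R_lip S_lipB in \<open>auto simp: r_def intro: Z0_cont R_cont S_cont continuous_on_avg_quad\<close>)
    then obtain \<zeta> where \<zeta>: "continuous_on {0..} \<zeta>" "\<And>t. t \<ge> 0 \<Longrightarrow> norm (\<zeta> t) \<le> r * exp (- (t / 2))"
      "\<And>t. t \<ge> 0 \<Longrightarrow> \<zeta> t = S t (Z0 t + \<zeta> t) + solveK (\<lambda>t. avg_quad \<sigma> t (\<zeta> t) + R t (Z0 t + \<zeta> t)) t"
      by blast
    define h where "h t = avg_quad \<sigma> t (\<zeta> t) + R t (Z0 t + \<zeta> t)" for t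
    define Z where "Z t = Z0 t + \<zeta> t" for t
    define W where "W t = Z0 t + solveK h t" for t
    have ZW: "Z t = W t + S t (Z t)" if "t \<ge> 0" for t
    proof -
      have "\<zeta> t = S t (Z t) + solveK h t" using \<zeta>(3)[OF that] unfolding Z_def h_def[abs_def] .
      then have "Z0 t + \<zeta> t = Z0 t + (S t (Z t) + solveK h t)" by (rule arg_cong)
      also have "\<dots> = W t + S t (Z t)" by (simp add: W_def add_ac)
      finally show ?thesis unfolding Z_def[of t, symmetric] .
    qed
    have exp1: "exp (- (t / 2)) \<le> 1" if "t \<ge> 0" for t :: real using that by simp
    have Z5: "norm (Z t) \<le> 5" if "t \<ge> 0" for t
    proof -
      have "norm (Z0 t) \<le> 4" using sech_orbit_bound[OF \<sigma> that] exp1[OF that] unfolding Z0_def by linarith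
      moreover have "norm (\<zeta> t) \<le> 1" using \<zeta>(2)[OF that] exp1[OF that] unfolding r_def by linarith
      ultimately show ?thesis unfolding Z_def using norm_triangle_ineq[of "Z0 t" "\<zeta> t"] by linarith
    qed
    have Z_cont: "continuous_on {0..} Z"
      unfolding Z_def[abs_def] by (intro continuous_intros Z0_cont \<zeta>)
    have h_cont: "continuous_on {0..} h"
      unfolding h_def[abs_def] by (intro continuous_intros continuous_on_avg_quad R_cont Z0_cont \<zeta>)
    have h_bound: "norm (h t) \<le> (18 * r * r + \<mu> * B * 5) * exp (- (t / 2))" if "t \<ge> 0" for t
    proof -
      have "norm (\<zeta> t) \<le> r" using \<zeta>(2)[OF that] exp1[OF that] unfolding r_def by linarith
      from avg_quad_lipschitz[OF \<sigma> that this, of 0]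
      have 1: "norm (avg_quad \<sigma> t (\<zeta> t)) \<le> 18 * r * norm (\<zeta> t)"
        by (simp add: r_def) (simp add: avg_quad_def zero_prod_def)
      have "norm (R t (Z t)) \<le> \<mu> * B * norm (Z t)"
        using R_lip[OF Z5[OF that], of 0 t] by (simp add: R_def S_def rot_0)
      moreover have "norm (Z t) \<le> 5 * exp (- (t / 2))"
      proof -
        have "norm (Z t) \<le> 4 * exp (- (t / 2)) + r * exp (- (t / 2))"
          unfolding Z_def Z0_def by (intro norm_triangle_mono sech_orbit_bound[OF \<sigma> that] \<zeta>(2)[OF that])
        also have "\<dots> = (4 + r) * exp (- (t / 2))" by (simp add: algebra_simps)
        also have "\<dots> \<le> 5 * exp (- (t / 2))" by (rule mult_right_mono) (auto simp: r_def)
        finally show ?thesis .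
      qed
      ultimately have "norm (R t (Z t)) \<le> \<mu> * B * (5 * exp (- (t / 2)))"
        using \<mu> B by (meson less_imp_le mult_left_mono order_trans mult_nonneg_nonneg zero_le_one)
      moreover have "norm (avg_quad \<sigma> t (\<zeta> t)) \<le> 18 * r * (r * exp (- (t / 2)))"
        using order_trans[OF 1 mult_left_mono[OF \<zeta>(2)[OF that]]] by (simp add: r_def)
      ultimately have "norm (h t) \<le> 18 * r * (r * exp (- (t / 2))) + \<mu> * B * (5 * exp (- (t / 2)))"
        unfolding h_def Z_def[symmetric] by (intro norm_triangle_mono)
      then show ?thesis by (simp add: algebra_simps)
    qed
    have deriv: "(Z has_vector_derivative rot (E t) (full_field \<beta> k b c \<mu>) (Z t)) (at t within {0..})" if t: "t \<ge> 0" for t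
    proof (rule implicit_curve_has_vector_derivative[where W = W and
          S = "\<lambda>x. \<mu> *\<^sub>R rot (cis (fst x / \<mu>)) (nf_S b c) (snd x)", OF _ _ _ _ rot_nf_S_has_derivative[OF bc]])
      show "Z s = W s + \<mu> *\<^sub>R rot (cis (fst (s, Z s) / \<mu>)) (nf_S b c) (snd (s, Z s))" if "s \<in> {0..}" for s
        using ZW[of s] that by (simp add: S_def E_def)
      show "continuous (at t within {0..}) Z" using Z_cont t by (simp add: continuous_on_eq_continuous_within)
      show "(W has_vector_derivative nf_avg (Z0 t) + (sech_lin t (solveK h t) + h t)) (at t within {0..})"
        unfolding W_def[abs_def] Z0_def
        by (intro has_vector_derivative_add sech_orbit_deriv \<sigma> t solveK_deriv[OF h_cont h_bound])
      show "norm (fst (0, v) *\<^sub>R (rot (cis (t / \<mu>)) (nf_Phi b c) (Z t) - nf_avg (Z t)) +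
          \<mu> *\<^sub>R cscale (cnj (cis (t / \<mu>))) (nf_dS b c (cscale (cis (t / \<mu>)) (Z t)) (cscale (cis (t / \<mu>)) (snd (0, v)))))
          \<le> norm v / 2" for v
      proof -
        have "norm (nf_dS b c (cscale (E t) (Z t)) (cscale (E t) v)) \<le> BD * norm v"
          using BD(2)[of "cscale (E t) (Z t)" "cscale (E t) v"] Z5[OF t] by (simp add: norm_cscale E)
        then have "\<mu> * norm (nf_dS b c (cscale (E t) (Z t)) (cscale (E t) v)) \<le> \<mu> * (BD * norm v)"
          using \<mu> by (intro mult_left_mono) auto
        also have "\<dots> \<le> \<mu> * (B * norm v)" using \<mu> B by (intro mult_left_mono mult_right_mono) auto
        also have "\<dots> \<le> (1/2) * norm v"
          using mult_right_mono[of "\<mu> * B" "1/2" "norm v"] \<mu>B by (simp add: r_def mult.assoc)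
        finally show ?thesis using \<mu> E(1) by (simp add: norm_cscale E_def)
      qed
      \<comment> \<open>The averaging identities close here: \<open>nf_avg (Z t)\<close> and the
        \<open>nf_dS\<close> terms cancel, leaving the rotated \<open>nf_Phi\<close> plus
        \<open>\<mu>\<close> times the rotated \<open>G_rem\<close>.\<close>
      show "rot (E t) (full_field \<beta> k b c \<mu>) (Z t) = nf_avg (Z0 t) + (sech_lin t (solveK h t) + h t) +
        (fst (1, rot (E t) (full_field \<beta> k b c \<mu>) (Z t)) *\<^sub>R (rot (cis (t / \<mu>)) (nf_Phi b c) (Z t) - nf_avg (Z t)) +
         \<mu> *\<^sub>R cscale (cnj (cis (t / \<mu>))) (nf_dS b c (cscale (cis (t / \<mu>)) (Z t))
          (cscale (cis (t / \<mu>)) (snd (1::real, rot (E t) (full_field \<beta> k b c \<mu>) (Z t))))))"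
      proof -
        have sK: "solveK h t = \<zeta> t - S t (Z t)" using ZW[OF t] by (simp add: Z_def W_def algebra_simps)
        have "nf_avg (Z0 t) + (sech_lin t (solveK h t) + h t) =
           nf_avg (Z0 t) + sech_lin t (\<zeta> t) + avg_quad \<sigma> t (\<zeta> t) + \<mu> *\<^sub>R rot (E t) (R_rem \<beta> k b c \<mu>) (Z t)"
          unfolding sK unfolding h_def R_def Z_def[symmetric] sech_lin_diff by simp
        also have "\<dots> = nf_avg (Z t) + \<mu> *\<^sub>R rot (E t) (R_rem \<beta> k b c \<mu>) (Z t)"
          using nf_avg_expand[OF \<sigma>, of t "\<zeta> t"] by (simp add: Z_def Z0_def)
        finally have 1: "nf_avg (Z0 t) + (sech_lin t (solveK h t) + h t) = nf_avg (Z t) + \<mu> *\<^sub>R rot (E t) (R_rem \<beta> k b c \<mu>) (Z t)" .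
        have 2: "cscale (E t) (rot (E t) (full_field \<beta> k b c \<mu>) (Z t)) = full_field \<beta> k b c \<mu> (cscale (E t) (Z t))"
          using E(2) by (simp add: rot_def mult.commute)
        have 3: "rot (E t) (full_field \<beta> k b c \<mu>) (Z t) = rot (E t) (nf_Phi b c) (Z t) + \<mu> *\<^sub>R cscale (cnj (E t)) (G_rem \<beta> k \<mu> (cscale (E t) (Z t)))"
          by (simp add: rot_def full_field_def cscale.add_right cscale.scaleR_right)
        have 4: "rot (E t) (R_rem \<beta> k b c \<mu>) (Z t) = cscale (cnj (E t)) (G_rem \<beta> k \<mu> (cscale (E t) (Z t)))
            - cscale (cnj (E t)) (nf_dS b c (cscale (E t) (Z t)) (full_field \<beta> k b c \<mu> (cscale (E t) (Z t))))"
          by (simp add: rot_def R_rem_def cscale.diff_right)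
        show ?thesis
          unfolding 1 E_def[symmetric] snd_conv fst_conv 2 unfolding 3 4 by (simp add: scaleR_diff_right)
      qed
    qed (use t \<mu> in auto)
    have "Im (fst (Z 0)) = 0 \<and> Re (snd (Z 0)) = 0"
    proof -
      \<comment> \<open>\<open>W 0\<close> is fixed by \<open>J\<close>, so \<open>Z 0\<close> and
        its image under \<open>J\<close> both solve \<open>z = W 0 + S 0 z\<close>; the right side
        is a contraction, so they coincide.\<close>
      define J where "J z = (cnj (fst z), - cnj (snd z))" for z :: "complex \<times> complex"
      have E0: "E 0 = 1" by (simp add: E_def)
      have nJ: "norm (J z) = norm z" for z by (simp add: J_def norm_prod_def)
      have "Im (fst (W 0)) = 0" "Re (snd (W 0)) = 0"
        using solveK_0[of h] by (simp_all add: W_def Z0_def sech_orbit_def sech_r'_def sech_p_def)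
      then have JW: "J (W 0) = W 0" by (simp add: J_def prod_eq_iff complex_eq_iff)
      have JS: "J (S 0 z) = S 0 (J z)" for z
        using nf_S_reverse[of b c z] by (simp add: J_def S_def rot_def E0 prod_eq_iff)
      have Z0W: "Z 0 = W 0 + S 0 (Z 0)" by (rule ZW) simp
      have "J (Z 0) = J (W 0 + S 0 (Z 0))" by (rule arg_cong[OF Z0W])
      also have "\<dots> = J (W 0) + J (S 0 (Z 0))" by (simp add: J_def)
      finally have JZ: "J (Z 0) = W 0 + S 0 (J (Z 0))" unfolding JW JS .
      have "norm (Z 0 - J (Z 0)) = norm ((W 0 + S 0 (Z 0)) - (W 0 + S 0 (J (Z 0))))"
        using Z0W JZ by simp
      also have "\<dots> = norm (S 0 (Z 0) - S 0 (J (Z 0)))" by simp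
      also have "\<dots> \<le> \<mu> * B * norm (Z 0 - J (Z 0))"
        by (rule S_lipB) (use Z5[of 0] nJ in auto)
      also have "\<dots> \<le> (1/2) * norm (Z 0 - J (Z 0))"
        using \<mu>B by (intro mult_right_mono) (auto simp: r_def)
      finally have "J (Z 0) = Z 0" by simp
      then show ?thesis by (simp add: J_def prod_eq_iff complex_eq_iff)
    qed
    then show "\<exists>Z. (\<forall>t\<ge>0. (Z has_vector_derivative rot (cis (t / \<mu>)) (full_field \<beta> k b c \<mu>) (Z t)) (at t within {0..}) \<and>
          norm (Z t - sech_orbit \<sigma> t) \<le> 1 / 100000 * exp (- (t / 2))) \<and>
        Im (fst (Z 0)) = 0 \<and> Re (snd (Z 0)) = 0"
      using deriv \<zeta>(2) unfolding E_def
      by (intro exI[of _ Z]) (auto simp: Z_def Z0_def r_def)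
  qed
qed

section \<open>Reversible systems\<close>

lemma has_vector_derivative_Un:
  assumes "(f has_vector_derivative d) (at x within S)" "(f has_vector_derivative d) (at x within T)"
  shows "(f has_vector_derivative d) (at x within S \<union> T)"
  using assms unfolding has_vector_derivative_def has_derivative_within by (auto intro: Lim_Un)

text \<open>As \<open>F\<close> anticommutes with \<open>R\<close>, reflection together with time
  reversal maps solutions to solutions. The two halves fit because \<open>X 0\<close> is fixed by
  \<open>R\<close>: both one-sided derivatives at \<open>0\<close> equal
  \<open>F (X 0)\<close>.\<close>

lemma reversible_extension:
  fixes F :: "'a::real_normed_vector \<Rightarrow> 'a"
  assumes R: "bounded_linear R" "\<And>x. R (R x) = x" "\<And>x. x \<in> U \<Longrightarrow> R x \<in> U" "\<And>x. F (R x) = - R (F x)"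
    and X: "\<And>t. t \<ge> 0 \<Longrightarrow> X t \<in> U" "\<And>t. t \<ge> 0 \<Longrightarrow> (X has_vector_derivative F (X t)) (at t within {0..})"
    and sym: "R (X 0) = X 0"
    and lim: "(X \<longlongrightarrow> 0) at_top"
  obtains Y where "solution_on_line F U Y" "(Y \<longlongrightarrow> 0) at_top" "(Y \<longlongrightarrow> 0) at_bot"
    "Y 0 = X 0" "\<And>t. Y (- t) = R (Y t)"
proof -
  interpret R: bounded_linear R by fact
  define Y where "Y t = (if t \<ge> 0 then X t else R (X (- t)))" for t
  have Y_neg: "Y t = R (X (- t))" if "t \<le> 0" for t
    using that sym by (cases "t = 0") (auto simp: Y_def)
  have Y_rev: "Y (- t) = R (Y t)" for t
    using Y_neg[of t] Y_neg[of "- t"] R(2) by (cases "t \<ge> 0") (auto simp: Y_def)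
  have d_pos: "(Y has_vector_derivative F (Y t)) (at t within {0..})" if "t \<ge> 0" for t
    by (rule has_vector_derivative_transform[where f = X]) (use that X(2)[OF that] in \<open>auto simp: Y_def\<close>)
  have d_neg: "(Y has_vector_derivative F (Y t)) (at t within {..0})" if "t \<le> 0" for t
  proof (rule has_vector_derivative_transform[where f = "\<lambda>t. R (X (- t))"])
    have "(X has_vector_derivative F (X (- t))) (at (- t) within uminus ` {..0})"
      using X(2)[of "- t"] that by simp
    then have "((X \<circ> uminus) has_vector_derivative (- 1) *\<^sub>R F (X (- t))) (at t within {..0})"
      by (intro vector_diff_chain_within) (auto intro!: derivative_eq_intros)
    then have "((\<lambda>t. R (X (- t))) has_vector_derivative R (- F (X (- t)))) (at t within {..0})"
      unfolding o_def by (intro R.has_vector_derivative) simp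
    then show "((\<lambda>t. R (X (- t))) has_vector_derivative F (Y t)) (at t within {..0})"
      using R(4)[of "X (- t)"] by (simp add: Y_neg that R.neg)
  qed (use that Y_neg in auto)
  have sol: "solution_on_line F U Y"
    unfolding solution_on_line_def
  proof (intro allI conjI)
    fix t
    show "Y t \<in> U" using X(1)[of t] X(1)[of "- t"] R(3) by (auto simp: Y_def)
    consider "t > 0" | "t < 0" | "t = 0" by linarith
    then show "(Y has_vector_derivative F (Y t)) (at t)"
    proof cases
      case 1
      then have "t \<in> interior {0..}" by simp
      then show ?thesis using d_pos[of t] 1 at_within_interior[of t "{0..}"] by simp
    next
      case 2
      then have "t \<in> interior {..0}" by simp
      then show ?thesis using d_neg[of t] 2 at_within_interior[of t "{..0}"] by simp
    next
      case 3
      have "{0..} \<union> {..0} = (UNIV :: real set)" by auto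
      then show ?thesis using has_vector_derivative_Un[OF d_pos[of 0] d_neg[of 0]] 3 by simp
    qed
  qed
  have top: "(Y \<longlongrightarrow> 0) at_top"
    using lim by (rule Lim_transform_eventually) (auto simp: Y_def eventually_at_top_linorder intro!: exI[of _ 0])
  have "((\<lambda>t. R (Y (- t))) \<longlongrightarrow> R 0) at_bot"
    by (intro R.tendsto filterlim_compose[OF top] filterlim_uminus_at_top_at_bot)
  then have bot: "(Y \<longlongrightarrow> 0) at_bot"
    by (simp add: Y_rev R(2) R.zero)
  show ?thesis
    by (rule that[OF sol top bot _ Y_rev]) (simp add: Y_def)
qed

text \<open>Gronwall's argument for the squared distance. Both curves over the interval between
  \<open>a\<close> and \<open>t\<close> lie in a compact subset of \<open>U\<close>, so a Lipschitz
  constant on compact sets is enough.\<close>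

lemma solution_on_line_unique:
  fixes F :: "'a::real_inner \<Rightarrow> 'a"
  assumes lip: "\<And>K. compact K \<Longrightarrow> K \<subseteq> U \<Longrightarrow> \<exists>L. \<forall>x\<in>K. \<forall>y\<in>K. norm (F x - F y) \<le> L * norm (x - y)"
    and X: "solution_on_line F U X" and Y: "solution_on_line F U Y" and eq: "X a = Y a"
  shows "X = Y"
proof
  fix t
  have dX: "(X has_vector_derivative F (X s)) (at s)" and dY: "(Y has_vector_derivative F (Y s)) (at s)" for s
    using X Y by (auto simp: solution_on_line_def)
  have cont: "continuous_on A X" "continuous_on A Y" for A
    using dX dY by (meson continuous_at_imp_continuous_on has_vector_derivative_continuous)+
  define I where "I = {min a t..max a t}"
  have "compact (X ` I \<union> Y ` I)"
    by (intro compact_Un compact_continuous_image cont) (simp_all add: I_def)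
  moreover have "X ` I \<union> Y ` I \<subseteq> U" using X Y by (auto simp: solution_on_line_def)
  ultimately obtain L where "\<forall>x\<in>X ` I \<union> Y ` I. \<forall>y\<in>X ` I \<union> Y ` I. norm (F x - F y) \<le> L * norm (x - y)"
    using lip by meson
  then have L: "norm (F (X s) - F (Y s)) \<le> L * norm (X s - Y s)" if "s \<in> I" for s using that by blast
  define f where "f s = (X s - Y s) \<bullet> (X s - Y s)" for s
  define f' where "f' s = 2 * ((X s - Y s) \<bullet> (F (X s) - F (Y s)))" for s
  have df: "(f has_real_derivative f' s) (at s)" for s
  proof -
    have "((\<lambda>s. X s - Y s) has_vector_derivative F (X s) - F (Y s)) (at s)"
      by (intro has_vector_derivative_diff dX dY)
    then have "((\<lambda>s. X s - Y s) has_derivative (\<lambda>h. h *\<^sub>R (F (X s) - F (Y s)))) (at s)"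
      by (simp add: has_vector_derivative_def)
    from has_derivative_inner[OF this this] show ?thesis
      unfolding f_def[abs_def] f'_def has_field_derivative_def
      by (rule has_derivative_eq_rhs) (simp add: fun_eq_iff inner_commute algebra_simps)
  qed
  have f'_bound: "\<bar>f' s\<bar> \<le> 2 * L * f s" if "s \<in> I" for s
  proof -
    have "\<bar>f' s\<bar> \<le> 2 * (norm (X s - Y s) * norm (F (X s) - F (Y s)))"
      unfolding f'_def using Cauchy_Schwarz_ineq2[of "X s - Y s" "F (X s) - F (Y s)"] by simp
    also have "\<dots> \<le> 2 * (norm (X s - Y s) * (L * norm (X s - Y s)))"
      by (intro mult_left_mono L that) auto
    also have "\<dots> = 2 * L * f s" by (simp add: f_def dot_square_norm power2_eq_square)
    finally show ?thesis .
  qed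
  have "f t \<le> 0"
  proof (cases "a \<le> t")
    case True
    have "exp (- (2 * L) * t) * f t \<le> exp (- (2 * L) * a) * f a"
    proof (rule DERIV_nonpos_imp_nonincreasing[OF True])
      fix s assume s: "a \<le> s" "s \<le> t"
      have "((\<lambda>s. exp (- (2 * L) * s) * f s) has_real_derivative exp (- (2 * L) * s) * (f' s - 2 * L * f s)) (at s)"
        by (auto intro!: derivative_eq_intros df simp: algebra_simps)
      moreover have "exp (- (2 * L) * s) * (f' s - 2 * L * f s) \<le> 0"
        using f'_bound[of s] s by (intro mult_nonneg_nonpos) (auto simp: I_def)
      ultimately show "\<exists>y. ((\<lambda>s. exp (- (2 * L) * s) * f s) has_real_derivative y) (at s) \<and> y \<le> 0" by blast
    qed
    also have "\<dots> = 0" using eq by (simp add: f_def)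
    finally show ?thesis by (simp add: mult_le_0_iff)
  next
    case False
    then have le: "t \<le> a" by simp
    have "exp ((2 * L) * t) * f t \<le> exp ((2 * L) * a) * f a"
    proof (rule DERIV_nonneg_imp_nondecreasing[OF le])
      fix s assume s: "t \<le> s" "s \<le> a"
      have "((\<lambda>s. exp ((2 * L) * s) * f s) has_real_derivative exp ((2 * L) * s) * (f' s + 2 * L * f s)) (at s)"
        by (auto intro!: derivative_eq_intros df simp: algebra_simps)
      moreover have "exp ((2 * L) * s) * (f' s + 2 * L * f s) \<ge> 0"
        using f'_bound[of s] s by (intro mult_nonneg_nonneg) (auto simp: I_def)
      ultimately show "\<exists>y. ((\<lambda>s. exp ((2 * L) * s) * f s) has_real_derivative y) (at s) \<and> y \<ge> 0" by blast
    qed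
    also have "\<dots> = 0" using eq by (simp add: f_def)
    finally show ?thesis by (simp add: mult_le_0_iff)
  qed
  then show "X t = Y t"
    using inner_ge_zero[of "X t - Y t"] by (simp add: f_def antisym)
qed

lemma solution_on_line_shift:
  assumes "solution_on_line F U X"
  shows "solution_on_line F U (\<lambda>t. X (s + t))"
  unfolding solution_on_line_def
proof (intro allI conjI)
  fix t
  have "((X \<circ> (\<lambda>t. s + t)) has_vector_derivative 1 *\<^sub>R F (X (s + t))) (at t)"
    using assms by (intro vector_diff_chain_at) (auto simp: solution_on_line_def intro!: derivative_eq_intros)
  then show "((\<lambda>t. X (s + t)) has_vector_derivative F (X (s + t))) (at t)" by (simp add: o_def)
  show "X (s + t) \<in> U" using assms by (simp add: solution_on_line_def)
qed

text \<open>If the two orbits coincide, \<open>Y\<close> is a translate of \<open>X\<close>; two different centres of symmetry on one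
  orbit make it periodic, which is incompatible with the limit \<open>0\<close>.\<close>

lemma reversible_homoclinic_range_neq:
  fixes F :: "'a::real_inner \<Rightarrow> 'a"
  assumes lip: "\<And>K. compact K \<Longrightarrow> K \<subseteq> U \<Longrightarrow> \<exists>L. \<forall>x\<in>K. \<forall>y\<in>K. norm (F x - F y) \<le> L * norm (x - y)"
    and X: "solution_on_line F U X" "(X \<longlongrightarrow> 0) at_top" "\<And>t. X (- t) = R (X t)"
    and Y: "solution_on_line F U Y" "\<And>t. Y (- t) = R (Y t)"
    and neq: "X 0 \<noteq> Y 0" "X 0 \<noteq> 0"
  shows "range X \<noteq> range Y"
proof
  assume "range X = range Y"
  then obtain s where s: "Y 0 = X s" by (metis rangeE rangeI)
  have "Y = (\<lambda>t. X (s + t))"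
    by (rule solution_on_line_unique[OF lip Y(1) solution_on_line_shift[OF X(1)], of 0]) (use s in auto)
  then have shift: "Y t = X (s + t)" for t by simp
  \<comment> \<open>The reflections in \<open>0\<close> and in \<open>s\<close> compose to the
    translation by \<open>2 * s\<close>.\<close>
  have per: "X (t + 2 * s) = X t" for t
  proof -
    have "X (- t) = Y (- t - s)" by (simp add: shift)
    also have "\<dots> = R (Y (t + s))" using Y(2)[of "t + s"] by simp
    also have "\<dots> = R (X (t + 2 * s))" by (simp add: shift algebra_simps)
    also have "\<dots> = X (- (t + 2 * s))" by (rule X(3)[symmetric])
    finally have "X (- t) = X (- (t + 2 * s))" .
    then have "X (- (- t)) = X (- (- (t + 2 * s)))" by (metis X(3))
    then show ?thesis by (simp add: add.commute)
  qed
  have "s \<noteq> 0" using s neq by auto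
  define d where "d = 2 * \<bar>s\<bar>"
  have d: "d > 0" "X (t + d) = X t" for t
    using \<open>s \<noteq> 0\<close> per[of t] per[of "t - 2 * s"] by (auto simp: d_def abs_if algebra_simps)
  have mult: "X (of_nat n * d) = X 0" for n
  proof (induction n)
    case (Suc n)
    then show ?case using d(2)[of "of_nat n * d"] by (simp add: algebra_simps)
  qed simp
  have "filterlim (\<lambda>n. of_nat n * d) at_top sequentially"
    by (rule filterlim_at_top_mult_tendsto_pos[OF tendsto_const d(1) filterlim_real_sequentially])
  then have "(\<lambda>n. X (of_nat n * d)) \<longlonglongrightarrow> 0" by (rule filterlim_compose[OF X(2)])
  then show False using neq(2) by (simp add: mult LIMSEQ_const_iff)
qed

section \<open>Return to the original variables\<close>

definition rotating_lift :: "real \<Rightarrow> (real \<Rightarrow> complex \<times> complex) \<Rightarrow> real \<Rightarrow> complex \<times> complex" where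
  "rotating_lift \<mu> Z t = cscale (cis (t / \<mu>)) (Z t)"

lemma rotating_lift_has_vector_derivative:
  assumes "(Z has_vector_derivative rot (cis (t / \<mu>)) f (Z t)) (at t within A)"
  shows "(rotating_lift \<mu> Z has_vector_derivative
     (cscale (\<i> / of_real \<mu>) (rotating_lift \<mu> Z t) + f (rotating_lift \<mu> Z t))) (at t within A)"
proof -
  have "cis (t / \<mu>) * cnj (cis (t / \<mu>)) = 1" by (simp add: cis_cnj cis_mult)
  then have "cscale (cis (t / \<mu>)) (rot (cis (t / \<mu>)) f (Z t)) = f (rotating_lift \<mu> Z t)"
    by (simp add: rot_def rotating_lift_def)
  moreover have "cscale ((\<i> / of_real \<mu>) * cis (t / \<mu>)) (Z t) = cscale (\<i> / of_real \<mu>) (rotating_lift \<mu> Z t)"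
    by (simp add: rotating_lift_def)
  ultimately show ?thesis
    using cscale.has_vector_derivative[OF has_vector_derivative_cis_scaled[where \<mu> = \<mu>] assms]
    unfolding rotating_lift_def[abs_def] by (simp add: add.commute)
qed

text \<open>With \<open>x = t / \<mu>\<close> and \<open>w = s'' + s\<close>, the fast variables are \<open>s - i s' = \<mu> k p\<close> and
  \<open>w - i w' = 2 i \<mu>\<^sup>2 k (q + nf_T p)\<close>; \<open>carrier_q\<close> undoes the first averaging step.\<close>

definition carrier_q :: "real \<Rightarrow> complex \<times> complex \<Rightarrow> complex" where
  "carrier_q b z = snd z + nf_T b (fst z)"

text \<open>The fast part of the derivative of \<open>nf_T\<close> restores the term
  \<open>(b / \<mu>) * v^2\<close> by \<open>nf_dT_homological\<close>; its slow part cancels the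
  \<open>nf_dT\<close> contained in \<open>nf_Phi2\<close>.\<close>

lemma carrier_q_has_vector_derivative:
  assumes z: "(z has_vector_derivative (cscale (\<i> / of_real \<mu>) (z t) + full_field \<beta> k b c \<mu> (z t))) (at t within A)"
    and \<mu>: "\<mu> \<noteq> 0" and v: "v = Re (fst (z t))"
  shows "((\<lambda>t. fst (z t)) has_vector_derivative (\<i> / of_real \<mu>) * fst (z t) + 2 * \<i> * of_real (Im (carrier_q b (z t)))) (at t within A)"
    and "((\<lambda>t. carrier_q b (z t)) has_vector_derivative (\<i> / of_real \<mu>) * carrier_q b (z t)
       + of_real (2 * v - c * v^3 + (b / \<mu>) * v^2 + \<mu> * residual \<beta> k \<mu> v)) (at t within A)"
proof -
  obtain p q where pq: "z t = (p, q)" by fastforce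
  have v2: "(p + cnj p) / 2 = of_real v" by (simp add: complex_eq_iff v pq)
  have f: "((\<lambda>t. fst (z t)) has_vector_derivative (\<i> / of_real \<mu>) * p + nf_Phi1 b (p, q)) (at t within A)"
    and s: "((\<lambda>t. snd (z t)) has_vector_derivative (\<i> / of_real \<mu>) * q + nf_Phi2 b c (p, q) + of_real (\<mu> * residual \<beta> k \<mu> v)) (at t within A)"
    using bounded_linear.has_vector_derivative[OF bounded_linear_fst z] bounded_linear.has_vector_derivative[OF bounded_linear_snd z]
    by (simp_all add: pq v cscale_def full_field_def nf_Phi_def G_rem_def scaleR_conv_of_real add.assoc)
  have "nf_Phi1 b (p, q) = 2 * \<i> * of_real (Im (carrier_q b (p, q)))"
    unfolding nf_Phi1_eq[symmetric] carrier_q_def by (simp add: complex_eq_iff)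
  then show "((\<lambda>t. fst (z t)) has_vector_derivative (\<i> / of_real \<mu>) * fst (z t) + 2 * \<i> * of_real (Im (carrier_q b (z t)))) (at t within A)"
    using f by (simp add: pq)
  have "((\<lambda>t. nf_T b (fst (z t))) has_vector_derivative nf_dT b p ((\<i> / of_real \<mu>) * p + nf_Phi1 b (p, q))) (at t within A)"
    using vector_derivative_diff_chain_within[OF f, of "nf_T b" "nf_dT b p"] nf_T_has_derivative[of b p]
    by (simp add: o_def pq has_derivative_at_withinI)
  from has_vector_derivative_add[OF s this]
  have d: "((\<lambda>t. carrier_q b (z t)) has_vector_derivative (\<i> / of_real \<mu>) * q + nf_Phi2 b c (p, q) + of_real (\<mu> * residual \<beta> k \<mu> v)
     + nf_dT b p ((\<i> / of_real \<mu>) * p + nf_Phi1 b (p, q))) (at t within A)"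
    by (simp add: carrier_q_def)
  have lin: "nf_dT b p ((\<i> / of_real \<mu>) * p + w) = nf_dT b p (\<i> * p) / of_real \<mu> + nf_dT b p w" for w
    unfolding nf_dT_def by (simp add: algebra_simps add_divide_distrib diff_divide_distrib)
  have h: "nf_dT b p (\<i> * p) = \<i> * nf_T b p + of_real b * (of_real v)^2"
    using nf_dT_homological[of b p] unfolding v2 by (simp add: algebra_simps)
  have vv: "p + cnj p = 2 * of_real v" using v2 by (simp add: field_simps)
  have eq: "(\<i> / of_real \<mu>) * q + nf_Phi2 b c (p, q) + of_real (\<mu> * residual \<beta> k \<mu> v)
     + nf_dT b p ((\<i> / of_real \<mu>) * p + nf_Phi1 b (p, q)) =
     (\<i> / of_real \<mu>) * carrier_q b (p, q)
       + of_real (2 * v - c * v^3 + (b / \<mu>) * v^2 + \<mu> * residual \<beta> k \<mu> v)"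
    unfolding lin h nf_Phi2_eq[symmetric] v2 unfolding vv
    by (simp add: carrier_q_def algebra_simps add_divide_distrib)
  show "((\<lambda>t. carrier_q b (z t)) has_vector_derivative (\<i> / of_real \<mu>) * carrier_q b (z t)
       + of_real (2 * v - c * v^3 + (b / \<mu>) * v^2 + \<mu> * residual \<beta> k \<mu> v)) (at t within A)"
    unfolding pq by (rule d[unfolded eq])
qed

text \<open>The four functions are \<open>s\<close>, \<open>s'\<close>, \<open>w\<close>,
  \<open>w'\<close> with primes in \<open>x = t / \<mu>\<close>, so each right side is an
  \<open>x\<close>-derivative divided by \<open>\<mu>\<close>. The last one is
  \<open>w'' = - w - (4 \<mu>^2 s + N(s))\<close>.\<close>

lemma fourth_order_system:
  assumes z: "(z has_vector_derivative (cscale (\<i> / of_real \<mu>) (z t) + full_field \<beta> k (\<beta> * k / 4) (\<beta> * k^2 / 4) \<mu> (z t))) (at t within A)"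
    and \<mu>: "\<mu> > 0" and k: "k > 0" and s: "s = \<mu> * k * Re (fst (z t))" and b: "b = \<beta> * k / 4"
  shows "((\<lambda>t. \<mu> * k * Re (fst (z t))) has_real_derivative - k * Im (fst (z t))) (at t within A)"
    and "((\<lambda>t. - \<mu> * k * Im (fst (z t))) has_real_derivative
          - k * Re (fst (z t)) - 2 * \<mu> * k * Im (carrier_q b (z t))) (at t within A)"
    and "((\<lambda>t. - 2 * \<mu>^2 * k * Im (carrier_q b (z t))) has_real_derivative - 2 * \<mu> * k * Re (carrier_q b (z t))) (at t within A)"
    and "((\<lambda>t. - 2 * \<mu>^2 * k * Re (carrier_q b (z t))) has_real_derivative
          2 * \<mu> * k * Im (carrier_q b (z t)) - (4 * \<mu>^2 * s + (\<beta> - 4 * \<mu>^2) * (s + 1 - sqrt (1 + 2 * s))) / \<mu>) (at t within A)"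
proof -
  define v where "v = Re (fst (z t))"
  define c where "c = \<beta> * k^2 / 4"
  note d = carrier_q_has_vector_derivative[OF z _ v_def, folded b c_def]
  have p: "((\<lambda>t. Re (fst (z t))) has_real_derivative - Im (fst (z t)) / \<mu>) (at t within A)"
    "((\<lambda>t. Im (fst (z t))) has_real_derivative Re (fst (z t)) / \<mu> + 2 * Im (carrier_q b (z t))) (at t within A)"
    using d(1)[unfolded has_vector_derivative_complex_iff] \<mu>
    by (simp_all add: Re_divide Im_divide power2_eq_square)
  have q: "((\<lambda>t. Re (carrier_q b (z t))) has_real_derivative - Im (carrier_q b (z t)) / \<mu> +
       (2 * v - c * v^3 + (b / \<mu>) * v^2 + \<mu> * residual \<beta> k \<mu> v)) (at t within A)"
    "((\<lambda>t. Im (carrier_q b (z t))) has_real_derivative Re (carrier_q b (z t)) / \<mu>) (at t within A)"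
    using d(2)[unfolded has_vector_derivative_complex_iff] \<mu>
    by (simp_all add: Re_divide Im_divide power2_eq_square)
  show "((\<lambda>t. \<mu> * k * Re (fst (z t))) has_real_derivative - k * Im (fst (z t))) (at t within A)"
    by (rule DERIV_cong[OF DERIV_cmult[OF p(1)]]) (use \<mu> in simp)
  show "((\<lambda>t. - \<mu> * k * Im (fst (z t))) has_real_derivative
          - k * Re (fst (z t)) - 2 * \<mu> * k * Im (carrier_q b (z t))) (at t within A)"
    by (rule DERIV_cong[OF DERIV_cmult[OF p(2)]]) (use \<mu> in \<open>simp add: field_simps\<close>)
  show "((\<lambda>t. - 2 * \<mu>^2 * k * Im (carrier_q b (z t))) has_real_derivative - 2 * \<mu> * k * Re (carrier_q b (z t))) (at t within A)"
    by (rule DERIV_cong[OF DERIV_cmult[OF q(2)]]) (use \<mu> in \<open>simp add: field_simps power2_eq_square\<close>)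
  have sv: "s = \<mu> * k * v" by (simp add: s v_def)
  have rem: "s + 1 - sqrt (1 + 2 * s) = sqrt_rem s + s^2 / 2 - s^3 / 2" by (simp add: sqrt_rem_def)
  \<comment> \<open>\<open>residual\<close> holds both the fourth-order remainder and the part
    \<open>- 4 \<mu>^2\<close> of the coefficient times the Taylor polynomial. Adding the terms with
    \<open>\<beta>\<close> in \<open>m2\<close> reassembles the exact nonlinearity.\<close>
  have m1: "2 * \<mu>^4 * k * residual \<beta> k \<mu> v = (\<beta> - 4 * \<mu>^2) * sqrt_rem s - 2 * \<mu>^4 * k * (k * v^2 - \<mu> * k^2 * v^3)"
    using \<mu> k unfolding residual_def sv right_diff_distrib by simp
  have m2: "2 * \<mu>^3 * k * (2 * v - c * v^3 + (b / \<mu>) * v^2) = 4 * \<mu>^3 * k * v + \<beta> * s^2 / 2 - \<beta> * s^3 / 2"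
    using \<mu> unfolding sv c_def b by (simp add: field_simps power2_eq_square power3_eq_cube)
  have "2 * \<mu>^3 * k * (2 * v - c * v^3 + (b / \<mu>) * v^2 + \<mu> * residual \<beta> k \<mu> v) =
     2 * \<mu>^3 * k * (2 * v - c * v^3 + (b / \<mu>) * v^2) + 2 * \<mu>^4 * k * residual \<beta> k \<mu> v"
    unfolding distrib_left by (simp add: power3_eq_cube power4_eq_xxxx)
  also have "\<dots> = 4 * \<mu>^2 * s + (\<beta> - 4 * \<mu>^2) * (sqrt_rem s + s^2 / 2 - s^3 / 2)"
    unfolding m1 m2 unfolding sv
    by (simp add: field_simps power2_eq_square power3_eq_cube power4_eq_xxxx)
  finally have key: "2 * \<mu>^3 * k * (2 * v - c * v^3 + (b / \<mu>) * v^2 + \<mu> * residual \<beta> k \<mu> v) =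
     4 * \<mu>^2 * s + (\<beta> - 4 * \<mu>^2) * (s + 1 - sqrt (1 + 2 * s))"
    unfolding rem .
  have key2: "(4 * \<mu>^2 * s + (\<beta> - 4 * \<mu>^2) * (s + 1 - sqrt (1 + 2 * s))) / \<mu> =
     2 * \<mu>^2 * k * (2 * v - c * v^3 + (b / \<mu>) * v^2 + \<mu> * residual \<beta> k \<mu> v)"
    unfolding key[symmetric] using \<mu> by (simp add: power2_eq_square power3_eq_cube)
  show "((\<lambda>t. - 2 * \<mu>^2 * k * Re (carrier_q b (z t))) has_real_derivative
          2 * \<mu> * k * Im (carrier_q b (z t)) - (4 * \<mu>^2 * s + (\<beta> - 4 * \<mu>^2) * (s + 1 - sqrt (1 + 2 * s))) / \<mu>) (at t within A)"
    unfolding key2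
    by (rule DERIV_cong[OF DERIV_cmult[OF q(1)]]) (use \<mu> in \<open>simp only: distrib_left; simp add: power2_eq_square\<close>)
qed

section \<open>Assembling the orbit in phase space\<close>

lemma has_vector_derivative_vector_4:
  assumes "(f has_real_derivative f') F" "(g has_real_derivative g') F"
    "(h has_real_derivative h') F" "(k has_real_derivative k') F"
  shows "((\<lambda>x. vector [f x, g x, h x, k x] :: real^4) has_vector_derivative vector [f', g', h', k']) F"
proof -
  have "(\<lambda>t. t *\<^sub>R (vector [f', g', h', k'] :: real^4)) = (\<lambda>t. vector [f' * t, g' * t, h' * t, k' * t])"
    by (simp add: fun_eq_iff vec_eq_iff forall_4)
  then show ?thesis
    using assms has_derivative_vector_4[of f "(*) f'" F g "(*) g'" h "(*) h'" k "(*) k'"]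
    by (simp add: has_vector_derivative_def has_field_derivative_def)
qed

lemma tendsto_vector_4:
  assumes "(f \<longlongrightarrow> 0) F" "(g \<longlongrightarrow> 0) F" "(h \<longlongrightarrow> 0) F" "(k \<longlongrightarrow> (0::real)) F"
  shows "((\<lambda>x. vector [f x, g x, h x, k x] :: real^4) \<longlongrightarrow> 0) F"
proof -
  have "((\<lambda>x. f x *\<^sub>R axis 1 1 + g x *\<^sub>R axis 2 1 + h x *\<^sub>R axis 3 1 + k x *\<^sub>R axis 4 1 :: real^4)
     \<longlongrightarrow> 0 *\<^sub>R axis 1 1 + 0 *\<^sub>R axis 2 1 + 0 *\<^sub>R axis 3 1 + 0 *\<^sub>R axis 4 1) F"
    by (intro tendsto_intros assms)
  then show ?thesis unfolding vector_4_eq_sum by simp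
qed

lemma upper_sheet_half_orbit:
  fixes D lam \<mu> k b :: real and Z :: "real \<Rightarrow> complex \<times> complex"
  assumes D: "D > 0" and lam: "lam > 1" and \<mu>: "\<mu> > 0" "4 * \<mu>^2 = 4 * D^2 * (1 - 1 / lam) - 1"
    and \<beta>: "\<beta> = 4 * D^2 - 1" and k: "k > 0" "\<mu> * k * 5 \<le> 1 / 4"
    and Z: "\<And>t. t \<ge> 0 \<Longrightarrow> (Z has_vector_derivative
         rot (cis (t / \<mu>)) (full_field \<beta> k (\<beta> * k / 4) (\<beta> * k^2 / 4) \<mu>) (Z t)) (at t within {0..})"
      "\<And>t. t \<ge> 0 \<Longrightarrow> norm (Z t) \<le> 5 * exp (- (t / 2))" "Im (fst (Z 0)) = 0" "Re (snd (Z 0)) = 0"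
  obtains X where "\<And>y. y \<ge> 0 \<Longrightarrow> X y \<in> upper_sheet_space lam"
    "\<And>y. y \<ge> 0 \<Longrightarrow> (X has_vector_derivative upper_sheet_field D lam (X y)) (at y within {0..})"
    "reversor (X 0) = X 0" "(X \<longlongrightarrow> 0) at_top" "X 0 $ 1 = lam^2 * \<mu> * k * Re (fst (Z 0))"
proof -
  define b where "b = \<beta> * k / 4"
  define z where "z = rotating_lift \<mu> Z"
  \<comment> \<open>The substitution \<open>y = sqrt 2 * D * x\<close> gives \<open>s''''\<close>
    and \<open>s''\<close> the coefficients \<open>1\<close> and \<open>2\<close>; hence
    \<open>t = \<mu> x = \<nu> y\<close>.\<close>
  define \<nu> where "\<nu> = \<mu> / (sqrt 2 * D)"
  have \<nu>: "\<nu> > 0" using \<mu> D by (simp add: \<nu>_def)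
  define f1 where "f1 t = \<mu> * k * Re (fst (z t))" for t
  define f2 where "f2 t = - \<mu> * k * Im (fst (z t))" for t
  define f3 where "f3 t = - 2 * \<mu>^2 * k * Im (carrier_q b (z t))" for t
  define f4 where "f4 t = - 2 * \<mu>^2 * k * Re (carrier_q b (z t))" for t
  define j where "j s = s + 1 - sqrt (1 + 2 * s)" for s :: real
  have zb: "norm (z t) \<le> 5 * exp (- (t / 2))" if "t \<ge> 0" for t
    using Z(2)[OF that] by (simp add: z_def rotating_lift_def norm_cscale)
  have df: "(f1 has_real_derivative f2 t / \<mu>) (at t within {0..})"
    "(f2 has_real_derivative (f3 t - f1 t) / \<mu>) (at t within {0..})"
    "(f3 has_real_derivative f4 t / \<mu>) (at t within {0..})"
    "(f4 has_real_derivative - (f3 t + (4 * \<mu>^2 * f1 t + (\<beta> - 4 * \<mu>^2) * j (f1 t))) / \<mu>) (at t within {0..})"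
    if "t \<ge> 0" for t
  proof -
    have dz: "(z has_vector_derivative (cscale (\<i> / of_real \<mu>) (z t) + full_field \<beta> k (\<beta> * k / 4) (\<beta> * k^2 / 4) \<mu> (z t)))
       (at t within {0..})"
      unfolding z_def by (rule rotating_lift_has_vector_derivative[OF Z(1)[OF that]])
    note d = fourth_order_system[OF dz \<mu>(1) k(1) f1_def b_def]
    show "(f1 has_real_derivative f2 t / \<mu>) (at t within {0..})"
      unfolding f1_def[abs_def] f2_def by (rule DERIV_cong[OF d(1)]) (use \<mu> in simp)
    show "(f2 has_real_derivative (f3 t - f1 t) / \<mu>) (at t within {0..})"
      unfolding f1_def f2_def[abs_def] f3_def
      by (rule DERIV_cong[OF d(2)]) (use \<mu> in \<open>simp add: field_simps power2_eq_square\<close>)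
    show "(f3 has_real_derivative f4 t / \<mu>) (at t within {0..})"
      unfolding f3_def[abs_def] f4_def
      by (rule DERIV_cong[OF d(3)]) (use \<mu> in \<open>simp add: power2_eq_square\<close>)
    have "2 * \<mu> * k * Im (carrier_q b (z t)) = - f3 t / \<mu>"
      using \<mu> by (simp add: f3_def power2_eq_square)
    then show "(f4 has_real_derivative - (f3 t + (4 * \<mu>^2 * f1 t + (\<beta> - 4 * \<mu>^2) * j (f1 t))) / \<mu>) (at t within {0..})"
      unfolding f4_def[abs_def]
      by (intro DERIV_cong[OF d(4)[folded j_def]]) (simp add: add_divide_distrib diff_divide_distrib)
  qed
  have chain: "((\<lambda>y. f (\<nu> * y)) has_real_derivative d * \<nu>) (at y within {0..})"
    if "(f has_real_derivative d) (at (\<nu> * y) within {0..})" "y \<ge> 0" for f d y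
  proof -
    have "(f has_real_derivative d) (at (\<nu> * y) within ((\<lambda>y. \<nu> * y) ` {0..}))"
      by (rule DERIV_subset[OF that(1)]) (use \<nu> in auto)
    then have "((f \<circ> (\<lambda>y. \<nu> * y)) has_real_derivative d * \<nu>) (at y within {0..})"
      by (rule DERIV_image_chain) (auto intro!: derivative_eq_intros)
    then show ?thesis by (simp add: o_def)
  qed
  \<comment> \<open>\<open>f1\<close>, \<open>f2\<close>, \<open>f3\<close>, \<open>f4\<close> are
    \<open>s\<close>, \<open>s'\<close>, \<open>w\<close>, \<open>w'\<close>. The components follow
    from \<open>u1 = S\<close>, \<open>v1 = - S' - D^2 S'''\<close>, \<open>u2 = S'\<close>,
    \<open>v2 = D S''\<close> with \<open>S = lam^2 s\<close>, \<open>s'' = w - s\<close> and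
    \<open>s''' = w' - s'\<close>.\<close>
  define X :: "real \<Rightarrow> real^4" where "X y = vector [lam^2 * f1 (\<nu> * y), - (lam^2) / (2 * sqrt 2 * D) * (f4 (\<nu> * y) + f2 (\<nu> * y)),
     lam^2 / (sqrt 2 * D) * f2 (\<nu> * y), lam^2 / (2 * D) * (f3 (\<nu> * y) - f1 (\<nu> * y))]" for y
  have f1_small: "\<bar>f1 t\<bar> \<le> 1 / 4" if "t \<ge> 0" for t
  proof -
    have "\<bar>Re (fst (z t))\<bar> \<le> norm (z t)" by (rule order_trans[OF abs_Re_le_cmod norm_fst_snd_le(1)])
    also have "\<dots> \<le> 5 * 1" by (rule order_trans[OF zb[OF that]]) (use that in simp)
    finally have "\<mu> * k * \<bar>Re (fst (z t))\<bar> \<le> \<mu> * k * 5" using \<mu> k by (intro mult_left_mono) auto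
    then have "\<mu> * k * \<bar>Re (fst (z t))\<bar> \<le> 1 / 4" using k(2) by linarith
    then show ?thesis using k \<mu> by (simp add: f1_def abs_mult)
  qed
  have field: "(X has_vector_derivative upper_sheet_field D lam (X y)) (at y within {0..})" if "y \<ge> 0" for y
  proof -
    define t where "t = \<nu> * y"
    have t: "t \<ge> 0" using \<nu> that by (simp add: t_def)
    note d = df[OF t, unfolded t_def, THEN chain[OF _ that], folded t_def]
    have \<nu>\<mu>: "a / \<mu> * \<nu> = a / (sqrt 2 * D)" for a using \<mu> by (simp add: \<nu>_def)
    have r2: "sqrt 2 * (sqrt 2 * x) = 2 * x" for x by (simp flip: mult.assoc)
    have sq: "sqrt (lam^2 + 2 * (lam^2 * f1 t)) = lam * sqrt (1 + 2 * f1 t)"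
    proof -
      have "lam^2 + 2 * (lam^2 * f1 t) = lam^2 * (1 + 2 * f1 t)" by (simp add: algebra_simps)
      then show ?thesis using lam by (simp add: real_sqrt_mult)
    qed
    have F: "upper_sheet_field D lam (X y) = vector [lam^2 / (sqrt 2 * D) * f2 t,
       lam^2 * f1 t + lam - lam * sqrt (1 + 2 * f1 t), lam^2 / (2 * D) * (f3 t - f1 t) / D,
       (- (lam^2 / (sqrt 2 * D) * f2 t) - (- (lam^2) / (2 * sqrt 2 * D) * (f4 t + f2 t))) / D]"
      unfolding upper_sheet_field_def X_def vector_4 t_def[symmetric] sq ..
    have 1: "((\<lambda>y. lam^2 * f1 (\<nu> * y)) has_real_derivative lam^2 / (sqrt 2 * D) * f2 t) (at y within {0..})"
      by (rule DERIV_cong[OF DERIV_cmult[OF d(1)]]) (simp only: \<nu>\<mu>, simp)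
    have 3: "((\<lambda>y. lam^2 / (sqrt 2 * D) * f2 (\<nu> * y)) has_real_derivative lam^2 / (2 * D) * (f3 t - f1 t) / D) (at y within {0..})"
      by (rule DERIV_cong[OF DERIV_cmult[OF d(2)]]) (use D in \<open>simp only: \<nu>\<mu>; simp add: r2 mult.assoc mult.left_commute\<close>)
    have 4: "((\<lambda>y. lam^2 / (2 * D) * (f3 (\<nu> * y) - f1 (\<nu> * y))) has_real_derivative
        (- (lam^2 / (sqrt 2 * D) * f2 t) - (- (lam^2) / (2 * sqrt 2 * D) * (f4 t + f2 t))) / D) (at y within {0..})"
      by (rule DERIV_cong[OF DERIV_cmult[OF DERIV_diff[OF d(3) d(1)]]])
         (use D in \<open>simp only: \<nu>\<mu>; simp add: field_simps r2\<close>)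
    have b1: "1 + 4 * \<mu>^2 = 4 * D^2 * (1 - 1 / lam)" "\<beta> - 4 * \<mu>^2 = 4 * D^2 / lam"
      using \<mu>(2) by (simp_all add: \<beta> algebra_simps)
    have 2: "((\<lambda>y. - (lam^2) / (2 * sqrt 2 * D) * (f4 (\<nu> * y) + f2 (\<nu> * y))) has_real_derivative
        lam^2 * f1 t + lam - lam * sqrt (1 + 2 * f1 t)) (at y within {0..})"
    proof (rule DERIV_cong[OF DERIV_cmult[OF DERIV_add[OF d(4) d(2)]]])
      have "- (lam^2) / (2 * sqrt 2 * D) * (- (f3 t + (4 * \<mu>^2 * f1 t + (\<beta> - 4 * \<mu>^2) * j (f1 t))) / \<mu> * \<nu> + (f3 t - f1 t) / \<mu> * \<nu>) =
         lam^2 / (4 * D^2) * ((1 + 4 * \<mu>^2) * f1 t + (\<beta> - 4 * \<mu>^2) * j (f1 t))"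
        unfolding \<nu>\<mu> using D by (simp add: field_simps power2_eq_square r2)
      also have "\<dots> = lam^2 * f1 t + lam - lam * sqrt (1 + 2 * f1 t)"
        unfolding b1 j_def using D lam by (simp add: field_simps power2_eq_square)
      finally show "- (lam^2) / (2 * sqrt 2 * D) * (- (f3 t + (4 * \<mu>^2 * f1 t + (\<beta> - 4 * \<mu>^2) * j (f1 t))) / \<mu> * \<nu> + (f3 t - f1 t) / \<mu> * \<nu>) =
         lam^2 * f1 t + lam - lam * sqrt (1 + 2 * f1 t)" .
    qed
    show ?thesis unfolding F unfolding X_def[abs_def] by (rule has_vector_derivative_vector_4[OF 1 2 3 4])
  qed
  have z0: "z 0 = Z 0" by (simp add: z_def rotating_lift_def)
  \<comment> \<open>For real \<open>p\<close> the correction \<open>nf_T b p\<close> is purely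
    imaginary, so undoing the first averaging step respects the boundary condition.\<close>
  have "Re (carrier_q b (z 0)) = 0"
    using Z(3,4) by (simp add: z0 carrier_q_def nf_T_def power2_eq_square)
  then have "f2 0 = 0" "f4 0 = 0" using Z(3) by (simp_all add: f2_def f4_def z0)
  then have sym: "reversor (X 0) = X 0"
    by (simp add: reversor_def X_def vec_eq_iff forall_4)
  have "(z \<longlongrightarrow> 0) at_top"
  proof (rule Lim_null_comparison)
    show "\<forall>\<^sub>F t in at_top. norm (z t) \<le> 5 * exp (- (t / 2))"
      using eventually_ge_at_top[of 0] by eventually_elim (rule zb)
    have "((\<lambda>t::real. exp (- (t / 2))) \<longlongrightarrow> 0) at_top"
      by (rule filterlim_compose[OF exp_at_bot filterlim_compose[OF filterlim_uminus_at_bot_at_top]])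
         (simp add: filterlim_at_top_div_const_nat filterlim_at_top_mult_tendsto_pos[OF tendsto_const _ filterlim_ident, of "1/2", simplified])
    then show "((\<lambda>t::real. 5 * exp (- (t / 2))) \<longlongrightarrow> 0) at_top" by (intro tendsto_mult_right_zero)
  qed
  then have "((\<lambda>y. z (\<nu> * y)) \<longlongrightarrow> 0) at_top"
    by (rule filterlim_compose) (rule filterlim_tendsto_pos_mult_at_top[OF tendsto_const \<nu> filterlim_ident])
  note zl = tendsto_fst[OF this] tendsto_snd[OF this]
  have "((\<lambda>y. carrier_q b (z (\<nu> * y))) \<longlongrightarrow> 0 + nf_T b 0) at_top"
    unfolding carrier_q_def nf_T_def using zl by (intro tendsto_intros) simp_all
  then have "((\<lambda>y. carrier_q b (z (\<nu> * y))) \<longlongrightarrow> 0) at_top" by (simp add: nf_T_def)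
  note cl = tendsto_Re[OF this] tendsto_Im[OF this] tendsto_Re[OF zl(1)] tendsto_Im[OF zl(1)]
  have lim: "(X \<longlongrightarrow> 0) at_top"
    unfolding X_def[abs_def]
    by (intro tendsto_vector_4 tendsto_mult_right_zero tendsto_add_zero tendsto_diff[of _ 0 _ _ 0, simplified];
        unfold f1_def f2_def f3_def f4_def; intro tendsto_mult_right_zero; use cl in simp)
  have space: "X y \<in> upper_sheet_space lam" if "y \<ge> 0" for y
  proof -
    have "f1 (\<nu> * y) > - 1 / 2" using f1_small[of "\<nu> * y"] \<nu> that by simp
    then have "lam^2 * (- 1 / 2) < lam^2 * f1 (\<nu> * y)" using lam by (intro mult_strict_left_mono) auto
    then show ?thesis by (simp add: upper_sheet_space_def X_def)
  qed
  show ?thesis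
    by (rule that[OF space field sym lim]) (simp_all add: X_def f1_def z0)
qed

text \<open>On a compact subset of the open half-space the radicand has a positive minimum
  \<open>m^2\<close>; rationalizing the difference of two roots gives the constant
  \<open>1 / m\<close>.\<close>

lemma upper_sheet_field_lipschitz:
  assumes "compact K" "K \<subseteq> upper_sheet_space lam"
  shows "\<exists>L. \<forall>x\<in>K. \<forall>y\<in>K. norm (upper_sheet_field D lam x - upper_sheet_field D lam y) \<le> L * norm (x - y)"
proof (cases "K = {}")
  case False
  have "continuous_on K (\<lambda>x. lam^2 + 2 * x $ 1)" by (intro continuous_intros)
  from continuous_attains_inf[OF assms(1) False this] obtain x0 where
    x0: "x0 \<in> K" "\<And>x. x \<in> K \<Longrightarrow> lam^2 + 2 * x0 $ 1 \<le> lam^2 + 2 * x $ 1" by auto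
  define m where "m = sqrt (lam^2 + 2 * x0 $ 1)"
  have m: "m > 0" using x0(1) assms(2) by (auto simp: m_def upper_sheet_space_def)
  have sq: "\<bar>sqrt (lam^2 + 2 * x $ 1) - sqrt (lam^2 + 2 * y $ 1)\<bar> \<le> (1 / m) * \<bar>x $ 1 - y $ 1\<bar>" if "x \<in> K" "y \<in> K" for x y
  proof -
    define a where "a = sqrt (lam^2 + 2 * x $ 1)"
    define c where "c = sqrt (lam^2 + 2 * y $ 1)"
    have ac: "a \<ge> m" "c \<ge> m" using x0(2) that by (auto simp: a_def c_def m_def)
    have pos: "lam^2 + 2 * x $ 1 \<ge> 0" "lam^2 + 2 * y $ 1 \<ge> 0"
      using that assms(2) by (auto simp: upper_sheet_space_def)
    then have "(a - c) * (a + c) = 2 * (x $ 1 - y $ 1)"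
      by (simp add: a_def c_def algebra_simps)
    then have "\<bar>a - c\<bar> * (a + c) = 2 * \<bar>x $ 1 - y $ 1\<bar>"
      using ac m by (metis abs_mult abs_numeral abs_of_pos add_pos_pos order_less_le_trans)
    moreover have "\<bar>a - c\<bar> * (2 * m) \<le> \<bar>a - c\<bar> * (a + c)" using ac by (intro mult_left_mono) auto
    ultimately show ?thesis using m by (simp add: a_def c_def field_simps)
  qed
  define L where "L = 1 + (1 + 1 / m) + 1 / \<bar>D\<bar> + 2 / \<bar>D\<bar>"
  have "norm (upper_sheet_field D lam x - upper_sheet_field D lam y) \<le> L * norm (x - y)" if "x \<in> K" "y \<in> K" for x y
  proof -
    define n where "n = norm (x - y)"
    have c: "\<bar>x $ i - y $ i\<bar> \<le> n" for i
      using component_le_norm_cart[of "x - y" i] by (simp add: n_def)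
    define d where "d = upper_sheet_field D lam x - upper_sheet_field D lam y"
    have d1: "\<bar>d $ 1\<bar> \<le> n" using c[of 3] by (simp add: d_def upper_sheet_field_def)
    have d2: "\<bar>d $ 2\<bar> \<le> (1 + 1 / m) * n"
    proof -
      have "\<bar>d $ 2\<bar> \<le> \<bar>x $ 1 - y $ 1\<bar> + \<bar>sqrt (lam^2 + 2 * x $ 1) - sqrt (lam^2 + 2 * y $ 1)\<bar>"
        by (simp add: d_def upper_sheet_field_def)
      also have "\<dots> \<le> n + (1 / m) * n"
        using c[of 1] order_trans[OF sq[OF that] mult_left_mono[OF c[of 1], of "1 / m"]] m by (intro add_mono) auto
      finally show ?thesis by (simp add: algebra_simps)
    qed
    have d3: "\<bar>d $ 3\<bar> \<le> 1 / \<bar>D\<bar> * n"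
      using divide_right_mono[OF c[of 4], of "\<bar>D\<bar>"]
      by (simp add: d_def upper_sheet_field_def abs_divide flip: diff_divide_distrib)
    have "\<bar>(- x $ 3 - x $ 2) - (- y $ 3 - y $ 2)\<bar> \<le> 2 * n" using c[of 3] c[of 2] by linarith
    from divide_right_mono[OF this, of "\<bar>D\<bar>"] have d4: "\<bar>d $ 4\<bar> \<le> 2 / \<bar>D\<bar> * n"
      unfolding d_def upper_sheet_field_def by (simp only: vector_minus_component vector_4 flip: diff_divide_distrib) (simp add: abs_divide)
    have "norm d \<le> \<bar>d $ 1\<bar> + \<bar>d $ 2\<bar> + \<bar>d $ 3\<bar> + \<bar>d $ 4\<bar>"
      using norm_le_l1_cart[of d] by (simp add: sum_4)
    also have "\<dots> \<le> n + (1 + 1 / m) * n + 1 / \<bar>D\<bar> * n + 2 / \<bar>D\<bar> * n"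
      by (intro add_mono d1 d2 d3 d4)
    also have "\<dots> = L * n" by (simp add: L_def algebra_simps)
    finally show ?thesis by (simp add: d_def n_def)
  qed
  then show ?thesis by blast
qed auto

lemma bounded_linear_reversor: "bounded_linear reversor"
proof
  show "\<exists>K. \<forall>x. norm (reversor x) \<le> norm x * K"
    by (intro exI[of _ 1]) (simp add: reversor_def norm_vec_def L2_set_def sum_4)
qed (simp_all add: reversor_def vec_eq_iff forall_4)

lemma reversor_upper_sheet:
  "reversor (reversor X) = X"
  "X \<in> upper_sheet_space lam \<Longrightarrow> reversor X \<in> upper_sheet_space lam"
  "upper_sheet_field D lam (reversor X) = - reversor (upper_sheet_field D lam X)"
  by (auto simp: reversor_def upper_sheet_space_def upper_sheet_field_def vec_eq_iff forall_4 add_divide_distrib diff_divide_distrib)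

theorem mainTheorem1:
  fixes D lam0 :: real
  assumes "D > 0" and "D^2 > 1/4"
    and "lam0 = 4 * D^2 / (4 * D^2 - 1)"
  shows "(\<forall>lam > lam0. saddle_focus (upper_sheet_field D lam) 0) \<and>
    (\<exists>\<delta> > 0. \<forall>lam \<in> {lam0 <..< lam0 + \<delta>}.
       \<exists>\<Gamma>1 \<Gamma>2. \<Gamma>1 \<noteq> \<Gamma>2 \<and>
         symmetric_homoclinic_orbit (upper_sheet_field D lam) (upper_sheet_space lam) reversor 0 \<Gamma>1 \<and>
         symmetric_homoclinic_orbit (upper_sheet_field D lam) (upper_sheet_space lam) reversor 0 \<Gamma>2)"
proof (intro conjI allI impI)
  show "saddle_focus (upper_sheet_field D lam) 0" if "lam > lam0" for lam
    using upper_sheet_saddle_focus assms that by simp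
  define \<beta> where "\<beta> = 4 * D^2 - 1"
  have \<beta>: "\<beta> > 0" using assms(2) by (simp add: \<beta>_def)
  \<comment> \<open>\<open>k^2 * K\<close> is the averaged cubic coefficient for
    \<open>b = \<beta> k / 4\<close> and \<open>c = \<beta> k^2 / 4\<close>. Its sign, which decides
    that the system is focusing, comes from \<open>\<beta> > 0\<close>.\<close>
  define K where "K = 3 * \<beta> / 32 + 19 * \<beta>^2 / 288"
  have K: "K > 0" using \<beta> by (simp add: K_def add_pos_pos)
  define k where "k = sqrt (2 / K)"
  have k: "k > 0" "k^2 * K = 2" using K by (simp_all add: k_def)
  have bc: "3 / 8 * (\<beta> * k^2 / 4) + 19 / 18 * (\<beta> * k / 4)^2 = 2"
  proof -
    have "3 / 8 * (\<beta> * k^2 / 4) + 19 / 18 * (\<beta> * k / 4)^2 = k^2 * K"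
      by (simp add: K_def field_simps power2_eq_square)
    then show ?thesis using k(2) by simp
  qed
  obtain \<mu>0 where \<mu>0: "\<mu>0 > 0" "\<And>\<mu> \<sigma>. 0 < \<mu> \<Longrightarrow> \<mu> < \<mu>0 \<Longrightarrow> \<sigma>^2 = 1 \<Longrightarrow>
    (\<exists>Z. (\<forall>t\<ge>0. (Z has_vector_derivative rot (cis (t / \<mu>)) (full_field \<beta> k (\<beta> * k / 4) (\<beta> * k^2 / 4) \<mu>) (Z t)) (at t within {0..}) \<and>
          norm (Z t - sech_orbit \<sigma> t) \<le> 1 / 100000 * exp (- (t / 2))) \<and>
        Im (fst (Z 0)) = 0 \<and> Re (snd (Z 0)) = 0)"
    using slow_existence[OF bc k(1), of \<beta>] by blast
  define \<mu>1 where "\<mu>1 = min \<mu>0 (1 / (20 * k))"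
  have \<mu>1: "\<mu>1 > 0" "\<mu>1 \<le> \<mu>0" "\<mu>1 * k * 5 \<le> 1 / 4" using \<mu>0(1) k by (auto simp: \<mu>1_def min_def field_simps)
  have lam0: "lam0 > 1" using \<beta> assms(3) by (simp add: \<beta>_def)
  show "\<exists>\<delta> > 0. \<forall>lam \<in> {lam0 <..< lam0 + \<delta>}. \<exists>\<Gamma>1 \<Gamma>2. \<Gamma>1 \<noteq> \<Gamma>2 \<and>
         symmetric_homoclinic_orbit (upper_sheet_field D lam) (upper_sheet_space lam) reversor 0 \<Gamma>1 \<and>
         symmetric_homoclinic_orbit (upper_sheet_field D lam) (upper_sheet_space lam) reversor 0 \<Gamma>2"
  \<comment> \<open>Since \<open>\<mu>^2 = D^2 (lam - lam0) / (lam * lam0)\<close> and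
    \<open>lam * lam0 \<ge> 1\<close>, this width ensures \<open>\<mu> < \<mu>1\<close>.\<close>
  proof (intro exI[of _ "\<mu>1^2 / D^2"] conjI ballI)
    show "\<mu>1^2 / D^2 > 0" using \<mu>1 assms(1) by simp
    fix lam assume "lam \<in> {lam0 <..< lam0 + \<mu>1^2 / D^2}"
    then have l: "lam0 < lam" "lam < lam0 + \<mu>1^2 / D^2" by auto
    then have lam: "lam > 1" using lam0 by simp
    define \<mu> where "\<mu> = sqrt (4 * D^2 * (1 - 1 / lam) - 1) / 2"
    have e: "4 * D^2 * (1 - 1 / lam) - 1 = 4 * D^2 * (lam - lam0) / (lam * lam0)"
    proof -
      have "4 * D^2 / lam0 = \<beta>" using \<beta> assms(1,3) by (simp add: \<beta>_def)
      then have "4 * D^2 * (1 - 1 / lam) - 1 = 4 * D^2 / lam0 - 4 * D^2 / lam"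
        by (simp add: \<beta>_def algebra_simps)
      also have "\<dots> = 4 * D^2 * (lam - lam0) / (lam * lam0)" using lam lam0 by (simp add: field_simps)
      finally show ?thesis .
    qed
    have pos: "4 * D^2 * (1 - 1 / lam) - 1 > 0" unfolding e using l lam lam0 assms(1) by simp
    then have \<mu>: "\<mu> > 0" "4 * \<mu>^2 = 4 * D^2 * (1 - 1 / lam) - 1" by (simp_all add: \<mu>_def power_divide)
    have "1 * 1 \<le> lam * lam0" using lam lam0 by (intro mult_mono) auto
    then have "4 * D^2 * (lam - lam0) / (lam * lam0) \<le> 4 * D^2 * (lam - lam0) / 1"
      using l by (intro divide_left_mono) auto
    also have "\<dots> < 4 * \<mu>1^2" using l assms(1) by (simp add: field_simps)
    finally have "\<mu>^2 < \<mu>1^2" using \<mu>(2) e by simp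
    then have \<mu>\<mu>1: "\<mu> < \<mu>1" using \<mu>1 \<mu> by (simp add: power2_less_imp_less)
    have \<mu>k: "\<mu> * k * 5 \<le> 1 / 4"
      using order_trans[OF _ \<mu>1(3), of "\<mu> * k * 5"] \<mu>\<mu>1 k by simp
    \<comment> \<open>The amplitude at \<open>t = 0\<close> is within \<open>1 / 100000\<close> of
      \<open>\<sigma>\<close>, so \<open>u1\<close> at the symmetric point has the sign of
      \<open>\<sigma>\<close>. This sign later yields non-constancy and tells the two symmetric
      points apart.\<close>
    have ex: "\<exists>Y. solution_on_line (upper_sheet_field D lam) (upper_sheet_space lam) Y \<and> (Y \<longlongrightarrow> 0) at_top \<and>
       (Y \<longlongrightarrow> 0) at_bot \<and> (\<forall>t. Y (- t) = reversor (Y t)) \<and> \<sigma> * Y 0 $ 1 > 0" if \<sigma>: "\<sigma>^2 = 1" for \<sigma>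
    proof -
      obtain Z where Z: "\<And>t. t \<ge> 0 \<Longrightarrow> (Z has_vector_derivative rot (cis (t / \<mu>)) (full_field \<beta> k (\<beta> * k / 4) (\<beta> * k^2 / 4) \<mu>) (Z t)) (at t within {0..})"
         "\<And>t. t \<ge> 0 \<Longrightarrow> norm (Z t - sech_orbit \<sigma> t) \<le> 1 / 100000 * exp (- (t / 2))"
         "Im (fst (Z 0)) = 0" "Re (snd (Z 0)) = 0"
        using \<mu>0(2)[OF \<mu>(1) _ \<sigma>] \<mu>\<mu>1 \<mu>1(2) by force
      have Zb: "norm (Z t) \<le> 5 * exp (- (t / 2))" if "t \<ge> 0" for t
      proof -
        have "norm (Z t) \<le> norm (Z t - sech_orbit \<sigma> t) + norm (sech_orbit \<sigma> t)"
          by (metis diff_add_cancel norm_triangle_ineq)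
        then show ?thesis
          using Z(2)[OF that] sech_orbit_bound[OF \<sigma> that] exp_ge_zero[of "- (t / 2)"] by linarith
      qed
      obtain X where X: "\<And>y. y \<ge> 0 \<Longrightarrow> X y \<in> upper_sheet_space lam"
        "\<And>y. y \<ge> 0 \<Longrightarrow> (X has_vector_derivative upper_sheet_field D lam (X y)) (at y within {0..})"
        "reversor (X 0) = X 0" "(X \<longlongrightarrow> 0) at_top" "X 0 $ 1 = lam^2 * \<mu> * k * Re (fst (Z 0))"
        using upper_sheet_half_orbit[OF assms(1) lam \<mu> \<beta>_def k(1) \<mu>k Z(1) Zb Z(3,4)] by blast
      obtain Y where Y: "solution_on_line (upper_sheet_field D lam) (upper_sheet_space lam) Y" "(Y \<longlongrightarrow> 0) at_top" "(Y \<longlongrightarrow> 0) at_bot"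
        "Y 0 = X 0" "\<And>t. Y (- t) = reversor (Y t)"
        by (rule reversible_extension[OF bounded_linear_reversor reversor_upper_sheet X(1-4)]) auto
      have "\<bar>Re (fst (Z 0)) - \<sigma>\<bar> \<le> norm (Z 0 - sech_orbit \<sigma> 0)"
        using order_trans[OF abs_Re_le_cmod norm_fst_snd_le(1), of "Z 0 - sech_orbit \<sigma> 0"]
        by (simp add: sech_orbit_def sech_r_def)
      then have "\<bar>Re (fst (Z 0)) - \<sigma>\<bar> \<le> 1 / 100000" using Z(2)[of 0] by simp
      moreover have "\<sigma> = 1 \<or> \<sigma> = - 1" using \<sigma> by (simp add: power2_eq_1_iff)
      ultimately have "\<sigma> * Re (fst (Z 0)) > 0" by (elim disjE; clarsimp; linarith)
      moreover have "lam^2 * \<mu> * k > 0" using lam \<mu> k by simp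
      ultimately have "(lam^2 * \<mu> * k) * (\<sigma> * Re (fst (Z 0))) > 0" by (metis mult_pos_pos)
      then have "\<sigma> * Y 0 $ 1 > 0" by (simp add: Y(4) X(5) mult_ac)
      then show ?thesis using Y by blast
    qed
    obtain Y1 where Y1: "solution_on_line (upper_sheet_field D lam) (upper_sheet_space lam) Y1" "(Y1 \<longlongrightarrow> 0) at_top"
       "(Y1 \<longlongrightarrow> 0) at_bot" "\<And>t. Y1 (- t) = reversor (Y1 t)" "Y1 0 $ 1 > 0"
      using ex[of 1] by auto
    obtain Y2 where Y2: "solution_on_line (upper_sheet_field D lam) (upper_sheet_space lam) Y2" "(Y2 \<longlongrightarrow> 0) at_top"
       "(Y2 \<longlongrightarrow> 0) at_bot" "\<And>t. Y2 (- t) = reversor (Y2 t)" "Y2 0 $ 1 < 0"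
      using ex[of "- 1"] by auto
    have orbit: "symmetric_homoclinic_orbit (upper_sheet_field D lam) (upper_sheet_space lam) reversor 0 (range Y)"
      if "solution_on_line (upper_sheet_field D lam) (upper_sheet_space lam) Y" "(Y \<longlongrightarrow> 0) at_top"
       "(Y \<longlongrightarrow> 0) at_bot" "\<And>t. Y (- t) = reversor (Y t)" "Y 0 $ 1 \<noteq> 0" for Y
    proof -
      have "\<not> Y constant_on UNIV"
      proof
        assume "Y constant_on UNIV"
        then obtain c where c: "Y = (\<lambda>_. c)" by (auto simp: constant_on_def)
        then have "c = 0" using that(2) by (simp add: tendsto_const_iff)
        then show False using that(5) c by simp
      qed
      moreover have "reversor ` range Y = range Y"
      proof
        show "reversor ` range Y \<subseteq> range Y" by (auto simp flip: that(4))
        show "range Y \<subseteq> reversor ` range Y"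
        proof
          fix x assume "x \<in> range Y"
          then obtain t where "x = Y t" by auto
          then have "x = reversor (Y (- t))" using that(4)[of "- t"] by simp
          then show "x \<in> reversor ` range Y" by auto
        qed
      qed
      ultimately show ?thesis
        unfolding symmetric_homoclinic_orbit_def homoclinic_orbit_def using that(1-3) by blast
    qed
    \<comment> \<open>Different symmetric points do not by themselves give different orbits, since
      one orbit might contain both; periodicity rules this out.\<close>
    have "range Y1 \<noteq> range Y2"
    proof (rule reversible_homoclinic_range_neq[OF _ Y1(1,2,4) Y2(1,4)])
      show "Y1 0 \<noteq> Y2 0" "Y1 0 \<noteq> 0" using Y1(5) Y2(5) by auto
    qed (rule upper_sheet_field_lipschitz)
    moreover have "symmetric_homoclinic_orbit (upper_sheet_field D lam) (upper_sheet_space lam) reversor 0 (range Y1)"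
      using Y1(5) by (intro orbit Y1(1-4)) simp
    moreover have "symmetric_homoclinic_orbit (upper_sheet_field D lam) (upper_sheet_space lam) reversor 0 (range Y2)"
      using Y2(5) by (intro orbit Y2(1-4)) simp
    ultimately show "\<exists>\<Gamma>1 \<Gamma>2. \<Gamma>1 \<noteq> \<Gamma>2 \<and>
         symmetric_homoclinic_orbit (upper_sheet_field D lam) (upper_sheet_space lam) reversor 0 \<Gamma>1 \<and>
         symmetric_homoclinic_orbit (upper_sheet_field D lam) (upper_sheet_space lam) reversor 0 \<Gamma>2"
      by blast
  qed
qed

end
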